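(* Let $\Sigma$ be the Boy's surface or the Girl's surface, with its natural CW-structure, and let $p:\mathbb{RP}^2\to\Sigma$ be the corresponding immersion, regarded as a map onto $\Sigma$. Consider representations of $\mathbb{RP}^2$ as a closed 2-disk with opposite boundary points identified, such that the boundary of the disk is mapped by $p$ (composed with the quotient map from the disk) into the 1-skeleton of $\Sigma$. Up to homeomorphism, there is exactly one such representation for each of the two surfaces: for the Boy's surface it is the planar model $D_{\mathrm{Boy}}$, and for the Girl's surface it is the planar model $D_{\mathrm{Girl}}$ (both defined in the context).
   Context: Boy's and Girl's surfaces are the images of the two immersions of $\mathbb{RP}^2$ in $\mathbb{R}^3$ with a single triple point and connected self-intersection set. In each case the self-intersection set consists of the triple point $O$ (the null-point) and three loops of double points $A,B,C$ based at $O$. Natural CW-structure: one 0-cell $O$, three oriented 1-cells $A,B,C$, and four 2-cells. Near $O$ the surface is three coordinate planes. The tangent direction at the end of $C$ continues into that of the start of $B$, the end of $B$ into the start of $A$, and the end of $A$ into the start of $C$. The 12 angles (quadrants) at $O$ are numbered $1,\dots,12$. Each 1-cell $X$ has two preimage arcs in $\mathbb{RP}^2$, denoted $X$ and $X'$; the prime labels the preimage arc and does not denote an inverse. In a boundary word, $iXj$ (or $iX'j$) denotes a side of the 2-cell lying on that arc and joining angles $i$ and $j$. Boy's surface. The oriented 1-cells run between angles as follows. $A$: $9\to9,\ 1\to6,\ 12\to10,\ 4\to7$. $B$: $3\to3,\ 8\to11,\ 4\to2,\ 7\to10$. $C$: $5\to5,\ 8\to6,\ 11\to2,\ 12\to1$.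 The 2-cells have boundaries $9A'9$, $3B'3$, $5C'5$ and $1A6C'8B11C2B'4A7B10A'12C1$. The planar model $D_{\mathrm{Boy}}$ is the hexagon obtained by gluing the three small 2-cells to the nonagon along the sides $A',B',C'$; its remaining six sides are, in cyclic order, $A,B,C,A,B,C$, and opposite sides are identified to form $\mathbb{RP}^2$. Girl's surface. The oriented 1-cells run between angles as follows. $A$: $9\to9,\ 1\to6,\ 12\to10,\ 4\to7$. $B$: $3\to3,\ 7\to10,\ 4\to2,\ 8\to11$. $C$: $5\to6,\ 12\to2,\ 8\to5,\ 11\to1$. The 2-cells have boundaries $9A'9$, $3B'3$, $1A6C'5C'8B11C1$ and $2C12A'10B7A4B'2$. The planar model $D_{\mathrm{Girl}}$ is the 2-disk obtained from the four 2-cells by gluing all pairs of equally labelled sides except the pair labelled $C'$; its boundary circle consists of the two sides $C'$, which are identified antipodally to form $\mathbb{RP}^2$. Two representations (disk together with the map of the disk to $\Sigma$) are considered the same up to homeomorphism if there is a homeomorphism of disks carrying one to the other, i.e. compatible with the boundary identifications and with the induced cell structures. *)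

theory Defs
  imports "HOL-Analysis.Analysis"
begin

section \<open>The projective plane and its immersions in 3-space\<close>

text \<open>The points of the quotient are the equivalence classes, as sets.\<close>

definition quotient_topology :: "'a topology \<Rightarrow> ('a \<times> 'a) set \<Rightarrow> 'a set topology" where
  "quotient_topology X R = topology (\<lambda>U. U \<subseteq> topspace X // R \<and>
     openin X {x \<in> topspace X. R `` {x} \<in> U})"

lemma openin_quotient_topology:
  "openin (quotient_topology X R) U \<longleftrightarrow>
     U \<subseteq> topspace X // R \<and> openin X {x \<in> topspace X. R `` {x} \<in> U}"
proof -
  have "istopology (\<lambda>U. U \<subseteq> topspace X // R \<and> openin X {x \<in> topspace X. R `` {x} \<in> U})"
    unfolding istopology_def
  proof (intro conjI allI impI; (elim conjE)?)
    fix S T assume "openin X {x \<in> topspace X. R `` {x} \<in> S}" "openin X {x \<in> topspace X. R `` {x} \<in> T}"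
    then have "openin X ({x \<in> topspace X. R `` {x} \<in> S} \<inter> {x \<in> topspace X. R `` {x} \<in> T})"
      by (rule openin_Int)
    moreover have "{x \<in> topspace X. R `` {x} \<in> S} \<inter> {x \<in> topspace X. R `` {x} \<in> T} =
        {x \<in> topspace X. R `` {x} \<in> S \<inter> T}" by blast
    ultimately show "openin X {x \<in> topspace X. R `` {x} \<in> S \<inter> T}" by simp
  next
    fix \<U> assume *: "\<forall>U\<in>\<U>. U \<subseteq> topspace X // R \<and> openin X {x \<in> topspace X. R `` {x} \<in> U}"
    have "openin X (\<Union>U\<in>\<U>. {x \<in> topspace X. R `` {x} \<in> U})"
      using * by blast
    moreover have "(\<Union>U\<in>\<U>. {x \<in> topspace X. R `` {x} \<in> U}) = {x \<in> topspace X. R `` {x} \<in> \<Union>\<U>}"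
      by blast
    ultimately show "openin X {x \<in> topspace X. R `` {x} \<in> \<Union>\<U>}" by simp
  qed blast+
  then show ?thesis
    unfolding quotient_topology_def by simp
qed

definition RP2 :: "(real^3) set topology" where
  "RP2 = quotient_topology (top_of_set (sphere 0 1)) {(x, y). y = x \<or> y = - x}"

text \<open>\<open>Ck_on k S f\<close>, for open \<open>S\<close>: \<open>f\<close> is \<open>k\<close> times continuously differentiable on \<open>S\<close>.\<close>

primrec Ck_on :: "nat \<Rightarrow> 'a::real_normed_vector set \<Rightarrow> ('a \<Rightarrow> 'b::real_normed_vector) \<Rightarrow> bool" where
  "Ck_on 0 S f \<longleftrightarrow> continuous_on S f"
| "Ck_on (Suc k) S f \<longleftrightarrow> f differentiable_on S \<and>
     (\<forall>v. Ck_on k S (\<lambda>x. frechet_derivative f (at x) v))"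

text \<open>Smoothness of \<open>p\<close> is expressed through the extension of \<open>S\<^sup>2 \<rightarrow> RP\<^sup>2 \<rightarrow> \<real>\<^sup>3\<close> that is
  constant on rays. As \<open>S\<^sup>2 \<rightarrow> RP\<^sup>2\<close> is a local diffeomorphism, \<open>p\<close> is a smooth immersion iff this
  extension is smooth and its differential at \<open>x\<close> vanishes only in the radial direction.\<close>

definition radial_extension :: "((real^3) set \<Rightarrow> real^3) \<Rightarrow> real^3 \<Rightarrow> real^3" where
  "radial_extension p x = p {x /\<^sub>R norm x, - (x /\<^sub>R norm x)}"

definition smooth_immersion :: "((real^3) set \<Rightarrow> real^3) \<Rightarrow> bool" where
  "smooth_immersion p \<longleftrightarrow>
     (\<forall>k. Ck_on k (- {0}) (radial_extension p)) \<and>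
     (\<forall>x\<in>sphere 0 1. \<forall>v. frechet_derivative (radial_extension p) (at x) v = 0 \<longleftrightarrow> v \<in> span {x})"

definition fibre :: "((real^3) set \<Rightarrow> real^3) \<Rightarrow> real^3 \<Rightarrow> (real^3) set set" where
  "fibre p y = {x \<in> topspace RP2. p x = y}"

definition single_triple_point_immersion :: "((real^3) set \<Rightarrow> real^3) \<Rightarrow> real^3 \<Rightarrow> bool" where
  "single_triple_point_immersion p v0 \<longleftrightarrow>
     smooth_immersion p \<and> (\<forall>y. finite (fibre p y)) \<and>
     {y. card (fibre p y) \<ge> 3} = {v0} \<and> card (fibre p v0) = 3 \<and>
     connected {y. card (fibre p y) \<ge> 2}"


section \<open>Combinatorial description of Boy's and Girl's surfaces\<close>

datatype surface = Boy | Girl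

datatype edge = LoopA | LoopB | LoopC

text \<open>\<open>(X, False)\<close> and \<open>(X, True)\<close> are the preimage arcs \<open>X\<close> and \<open>X'\<close> of the 1-cell \<open>X\<close>.\<close>

type_synonym arc = "edge \<times> bool"

text \<open>\<open>(i, (X, b), j)\<close> is the side \<open>iXj\<close> or \<open>iX'j\<close> of a boundary word.\<close>

type_synonym side = "nat \<times> arc \<times> nat"

fun angle_runs :: "surface \<Rightarrow> edge \<Rightarrow> (nat \<times> nat) set" where
  "angle_runs Boy LoopA = {(9, 9), (1, 6), (12, 10), (4, 7)}"
| "angle_runs Boy LoopB = {(3, 3), (8, 11), (4, 2), (7, 10)}"
| "angle_runs Boy LoopC = {(5, 5), (8, 6), (11, 2), (12, 1)}"
| "angle_runs Girl LoopA = {(9, 9), (1, 6), (12, 10), (4, 7)}"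
| "angle_runs Girl LoopB = {(3, 3), (7, 10), (4, 2), (8, 11)}"
| "angle_runs Girl LoopC = {(5, 6), (12, 2), (8, 5), (11, 1)}"

fun boundary_words :: "surface \<Rightarrow> side list list" where
  "boundary_words Boy =
    [[(9, (LoopA, True), 9)],
     [(3, (LoopB, True), 3)],
     [(5, (LoopC, True), 5)],
     [(1, (LoopA, False), 6), (6, (LoopC, True), 8), (8, (LoopB, False), 11),
      (11, (LoopC, False), 2), (2, (LoopB, True), 4), (4, (LoopA, False), 7),
      (7, (LoopB, False), 10), (10, (LoopA, True), 12), (12, (LoopC, False), 1)]]"
| "boundary_words Girl =
    [[(9, (LoopA, True), 9)],
     [(3, (LoopB, True), 3)],
     [(1, (LoopA, False), 6), (6, (LoopC, True), 5), (5, (LoopC, True), 8),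
      (8, (LoopB, False), 11), (11, (LoopC, False), 1)],
     [(2, (LoopC, False), 12), (12, (LoopA, True), 10), (10, (LoopB, False), 7),
      (7, (LoopA, False), 4), (4, (LoopB, True), 2)]]"

abbreviation word :: "surface \<Rightarrow> nat \<Rightarrow> side list" where
  "word S f \<equiv> boundary_words S ! f"

abbreviation side_arc :: "surface \<Rightarrow> nat \<Rightarrow> nat \<Rightarrow> arc" where
  "side_arc S f k \<equiv> fst (snd (word S f ! k))"

text \<open>The 2-cell with \<open>n\<close> sides is modelled on the closed unit disc, whose boundary circle is divided
  into \<open>n\<close> equal arcs; \<open>n = 1\<close> is allowed. The \<open>k\<close>-th side is traversed counterclockwise.\<close>

definition polygon_side :: "nat \<Rightarrow> nat \<Rightarrow> real \<Rightarrow> complex" where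
  "polygon_side n k t = cis (2 * pi * (real k + t) / real n)"

text \<open>The parameter on the oriented 1-cell of the point with parameter \<open>t\<close> on a side. The side
  \<open>iXj\<close> agrees with the orientation of \<open>X\<close> if \<open>X\<close> runs from \<open>i\<close> to \<open>j\<close>, and is opposite to it
  if \<open>X\<close> runs from \<open>j\<close> to \<open>i\<close>.\<close>

definition arc_param :: "surface \<Rightarrow> nat \<Rightarrow> nat \<Rightarrow> real \<Rightarrow> real" where
  "arc_param S f k t =
     (case word S f ! k of (i, (X, b), j) \<Rightarrow> if (i, j) \<in> angle_runs S X then t else 1 - t)"


section \<open>The CW-structure on the surface and its lift to the projective plane\<close>

datatype cell = Vertex | Edge edge | Face nat

definition cells :: "cell set" where
  "cells = insert Vertex (range Edge \<union> Face ` {..<4})"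

text \<open>\<open>\<alpha> (X, b)\<close> parametrises a preimage arc, and \<open>\<psi> f\<close> is the lift to the projective plane of the
  characteristic map of the \<open>f\<close>-th 2-cell.\<close>

fun open_cell :: "((real^3) set \<Rightarrow> real^3) \<Rightarrow> real^3 \<Rightarrow> (arc \<Rightarrow> real \<Rightarrow> (real^3) set) \<Rightarrow>
    (nat \<Rightarrow> complex \<Rightarrow> (real^3) set) \<Rightarrow> cell \<Rightarrow> (real^3) set" where
  "open_cell p v0 \<alpha> \<psi> Vertex = {v0}"
| "open_cell p v0 \<alpha> \<psi> (Edge X) = (\<lambda>t. p (\<alpha> (X, False) t)) ` {0<..<1}"
| "open_cell p v0 \<alpha> \<psi> (Face f) = (\<lambda>z. p (\<psi> f z)) ` ball 0 1"

definition one_skeleton :: "((real^3) set \<Rightarrow> real^3) \<Rightarrow> real^3 \<Rightarrow> (arc \<Rightarrow> real \<Rightarrow> (real^3) set) \<Rightarrow>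
    (nat \<Rightarrow> complex \<Rightarrow> (real^3) set) \<Rightarrow> (real^3) set" where
  "one_skeleton p v0 \<alpha> \<psi> = (\<Union>c\<in>insert Vertex (range Edge). open_cell p v0 \<alpha> \<psi> c)"

text \<open>Near the triple point the surface is three coordinate planes; the end of \<open>C\<close> continues
  along a coordinate axis into the start of \<open>B\<close>, the end of \<open>B\<close> into the start of \<open>A\<close>, and the end
  of \<open>A\<close> into the start of \<open>C\<close>.\<close>

definition coordinate_planes_near ::
  "((real^3) set \<Rightarrow> real^3) \<Rightarrow> real^3 \<Rightarrow> (arc \<Rightarrow> real \<Rightarrow> (real^3) set) \<Rightarrow> bool" where
  "coordinate_planes_near p v0 \<alpha> \<longleftrightarrow>
     (\<exists>U g g'. open U \<and> v0 \<in> U \<and> homeomorphism U (ball (0::real^3) 1) g g' \<and> g v0 = 0 \<and>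
        g ` (p ` topspace RP2 \<inter> U) = {v \<in> ball 0 1. \<exists>i. v $ i = 0} \<and>
        (\<forall>(X, Y) \<in> {(LoopC, LoopB), (LoopB, LoopA), (LoopA, LoopC)}.
           \<exists>a\<in>Basis. \<exists>s\<in>{1, -1}. \<exists>\<epsilon>>0. \<forall>t\<in>{0<..<\<epsilon>}.
             p (\<alpha> (X, False) (1 - t)) \<in> U \<and> p (\<alpha> (Y, False) t) \<in> U \<and>
             (\<exists>r>0. g (p (\<alpha> (X, False) (1 - t))) = (s * r) *\<^sub>R a) \<and>
             (\<exists>r>0. g (p (\<alpha> (Y, False) t)) = (- s * r) *\<^sub>R a)))"

definition natural_CW_structure ::
  "surface \<Rightarrow> ((real^3) set \<Rightarrow> real^3) \<Rightarrow> real^3 \<Rightarrow> (arc \<Rightarrow> real \<Rightarrow> (real^3) set) \<Rightarrow>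
    (nat \<Rightarrow> complex \<Rightarrow> (real^3) set) \<Rightarrow> bool" where
  "natural_CW_structure S p v0 \<alpha> \<psi> \<longleftrightarrow>
     coordinate_planes_near p v0 \<alpha> \<and>
     disjoint_family_on (open_cell p v0 \<alpha> \<psi>) cells \<and>
     (\<Union>c\<in>cells. open_cell p v0 \<alpha> \<psi> c) = p ` topspace RP2 \<and>
     \<comment> \<open>each 1-cell is an open arc that starts and ends at \<open>v0\<close> and has two preimage arcs\<close>
     (\<forall>e. continuous_map (top_of_set {0..1}) RP2 (\<alpha> e)) \<and>
     (\<forall>X. inj_on (\<lambda>t. p (\<alpha> (X, False) t)) {0<..<1}) \<and>
     (\<forall>X. \<forall>t\<in>{0..1}. p (\<alpha> (X, True) t) = p (\<alpha> (X, False) t)) \<and>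
     (\<forall>X. \<forall>t\<in>{0<..<1}. \<alpha> (X, True) t \<noteq> \<alpha> (X, False) t \<and>
        fibre p (p (\<alpha> (X, False) t)) = {\<alpha> (X, False) t, \<alpha> (X, True) t}) \<and>
     fibre p v0 = (\<Union>e. {\<alpha> e 0, \<alpha> e 1}) \<and>
     \<comment> \<open>the map \<open>p\<close> is injective over the 2-cells, which are attached along the boundary words\<close>
     (\<forall>f<4. continuous_map (top_of_set (cball 0 1)) RP2 (\<psi> f) \<and>
        inj_on (\<lambda>z. p (\<psi> f z)) (ball 0 1) \<and>
        (\<forall>z\<in>ball 0 1. fibre p (p (\<psi> f z)) = {\<psi> f z}) \<and>
        (\<forall>k<length (word S f). \<forall>t\<in>{0..1}.
           \<psi> f (polygon_side (length (word S f)) k t) = \<alpha> (side_arc S f k) (arc_param S f k t)))"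


section \<open>Representations as a disc with opposite boundary points identified\<close>

definition disc_representation ::
  "((real^3) set \<Rightarrow> real^3) \<Rightarrow> (real^3) set \<Rightarrow> 'd topology \<Rightarrow> ('d \<Rightarrow> (real^3) set) \<Rightarrow> bool" where
  "disc_representation p K X q \<longleftrightarrow>
     (\<exists>\<phi>. homeomorphic_map X (top_of_set (cball (0::complex) 1)) \<phi> \<and>
        quotient_map X RP2 q \<and>
        (\<forall>x\<in>topspace X. \<forall>y\<in>topspace X.
           q x = q y \<longleftrightarrow> x = y \<or> \<phi> x \<in> sphere 0 1 \<and> \<phi> y = - \<phi> x) \<and>
        (\<forall>x\<in>topspace X. \<phi> x \<in> sphere 0 1 \<longrightarrow> p (q x) \<in> K))"

definition induced_cells :: "'d topology \<Rightarrow> ('d \<Rightarrow> 'b) \<Rightarrow> 'b set set \<Rightarrow> 'd set set" where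
  "induced_cells X f \<C> =
     (\<Union>C\<in>\<C>. connected_components_of (subtopology X {x \<in> topspace X. f x \<in> C}))"

definition equivalent_representations ::
  "((real^3) set \<Rightarrow> real^3) \<Rightarrow> (real^3) set set \<Rightarrow> 'd topology \<Rightarrow> ('d \<Rightarrow> (real^3) set) \<Rightarrow>
    'e topology \<Rightarrow> ('e \<Rightarrow> (real^3) set) \<Rightarrow> bool" where
  "equivalent_representations p \<C> X q Y r \<longleftrightarrow>
     (\<exists>h. homeomorphic_map X Y h \<and>
        (\<forall>x\<in>topspace X. p (r (h x)) = p (q x)) \<and>
        (\<forall>x\<in>topspace X. \<forall>y\<in>topspace X. r (h x) = r (h y) \<longleftrightarrow> q x = q y) \<and>
        (\<lambda>c. h ` c) ` induced_cells X (p \<circ> q) \<C> = induced_cells Y (p \<circ> r) \<C>)"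


section \<open>The planar models\<close>

fun glued_arcs :: "surface \<Rightarrow> arc set" where
  "glued_arcs Boy = {(LoopA, True), (LoopB, True), (LoopC, True)}"
| "glued_arcs Girl = - {(LoopC, True)}"

definition side_gluing :: "surface \<Rightarrow> ((nat \<times> complex) \<times> (nat \<times> complex)) set" where
  "side_gluing S =
     {((f, polygon_side (length (word S f)) k t), (f', polygon_side (length (word S f')) k' t')) |
        f k t f' k' t'.
        f < 4 \<and> k < length (word S f) \<and> t \<in> {0..1} \<and>
        f' < 4 \<and> k' < length (word S f') \<and> t' \<in> {0..1} \<and>
        side_arc S f k = side_arc S f' k' \<and> side_arc S f k \<in> glued_arcs S \<and>
        arc_param S f k t = arc_param S f' k' t'}"

definition planar_model :: "surface \<Rightarrow> (nat \<times> complex) set topology" where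
  "planar_model S =
     quotient_topology (sum_topology (\<lambda>f. top_of_set (cball 0 1)) {..<4}) ((side_gluing S)\<^sup>*)"

text \<open>The map from the planar model to the projective plane induced by the lifted characteristic
  maps; these are constant on the gluing classes.\<close>

definition planar_map :: "(nat \<Rightarrow> complex \<Rightarrow> 'b) \<Rightarrow> (nat \<times> complex) set \<Rightarrow> 'b" where
  "planar_map \<psi> c = (case SOME v. v \<in> c of (f, z) \<Rightarrow> \<psi> f z)"

end

theory Submission
  imports Defs
begin

text \<open>
  The preimage of the 1-skeleton in the projective plane is a graph with six edges, the preimage
  arcs, and with vertices the preimages of the triple point. Following the boundary words from side
  to side shows that, for both surfaces, \<open>A\<close>, \<open>B\<close>, \<open>C\<close> join up to a closed triangle and \<open>A'\<close>, \<open>B'\<close>,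
  \<open>C'\<close> are loops based at the corners of the triangle (\<open>arc_ends\<close>); the three corners are distinct
  because the triple point has three preimages.

  Uniqueness. The boundary circle of a disc representing the projective plane covers, two to one, a
  simple closed curve in this graph, and the complement of the curve is the image of the open disc,
  hence connected. A simple closed curve that enters an open arc of a graph runs through all of it
  (\<open>arc_contained_or_avoided\<close>), and it cannot contain a loop that bounds a 2-cell with only one side,
  since that 2-cell would be a component of the complement (\<open>curve_avoids_monogon\<close>). For Boy's surface
  this excludes \<open>A'\<close>, \<open>B'\<close>, \<open>C'\<close> and leaves the triangle. For Girl's surface it excludes \<open>A'\<close> and \<open>B'\<close>;
  the triangle separates the 2-cell with the sides \<open>C'\<close> from the three others, and \<open>C'\<close> is left. So the
  boundary curve is always the union of the arcs that the planar model leaves unglued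
  (\<open>curve_eq_unglued_arcs\<close>).

  Two representations with the same boundary curve differ by a homeomorphism of the open discs, namely
  the one induced by the identity of the projective plane. It extends continuously to the closed
  discs: near a boundary point its values can only accumulate at two antipodal points, and they
  accumulate on a connected set (\<open>antipodal_discs_homeomorphic\<close>).

  Existence. It has to be seen that the abstract gluing of the four 2-cells is a disc with the
  predicted boundary. Each gluing step fills some consecutive sides of a polygon by a second polygon,
  whose whole boundary is attached to these sides; their two outer end points thereby become one
  point. So the first polygon is pinched onto the crescent between the unit circle and a smaller
  circle tangent to it from inside, and the second one fills the smaller circle
  (\<open>pasted_disc_fill\<close>). For Boy's surface the three monogons fill the sides \<open>A'\<close>, \<open>B'\<close>, \<open>C'\<close> of the
  nonagon. For Girl's surface the monogons fill \<open>A'\<close> and \<open>B'\<close> in one pentagon, and the resulting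
  triangle fills the sides \<open>B\<close>, \<open>C\<close>, \<open>A\<close> of the other one.
\<close>

section \<open>Filling a boundary arc of a disc by another disc\<close>

text \<open>The radial extension of a loop \<open>\<beta>\<close> on \<open>[0, 1]\<close> to the plane, as the cone over
  the loop.\<close>

definition cone_map :: "(real \<Rightarrow> complex) \<Rightarrow> complex \<Rightarrow> complex" where
  "cone_map \<beta> z = norm z *\<^sub>R \<beta> (Arg2pi z / (2 * pi))"

lemma Arg2pi_cis: "0 \<le> t \<Longrightarrow> t < 2 * pi \<Longrightarrow> Arg2pi (cis t) = t"
  by (rule Arg2pi_unique[of 1]) (simp_all add: cis_conv_exp)

lemma cone_map_polar:
  assumes "\<beta> 0 = \<beta> 1" "0 \<le> \<tau>" "\<tau> \<le> 1" "0 \<le> r"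
  shows "cone_map \<beta> (r *\<^sub>R cis (2 * pi * \<tau>)) = r *\<^sub>R \<beta> \<tau>"
proof (cases "r = 0")
  case False
  show ?thesis
  proof (cases "\<tau> = 1")
    case True
    then show ?thesis using assms False Arg2pi_times_of_real[of r 1] Arg2pi_cis[of 0]
      by (simp add: cone_map_def scaleR_conv_of_real)
  next
    case t: False
    then show ?thesis using assms False Arg2pi_cis[of "2 * pi * \<tau>"]
      by (simp add: cone_map_def scaleR_conv_of_real norm_mult)
  qed
qed (simp add: cone_map_def)

lemma polar_unit_interval:
  obtains \<tau> where "0 \<le> \<tau>" "\<tau> < 1" "z = norm z *\<^sub>R cis (2 * pi * \<tau>)"
proof
  show "0 \<le> Arg2pi z / (2 * pi)" "Arg2pi z / (2 * pi) < 1"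
    using Arg2pi[of z] by auto
  show "z = norm z *\<^sub>R cis (2 * pi * (Arg2pi z / (2 * pi)))"
    using Arg2pi_eq[of z] by (simp add: scaleR_conv_of_real cis_conv_exp)
qed

lemma continuous_on_cone_map:
  assumes "continuous_on {0..1} \<beta>" "\<beta> 0 = \<beta> 1"
  shows "continuous_on UNIV (cone_map \<beta>)"
proof -
  have "homotopic_loops UNIV \<beta> \<beta>"
    using assms by (simp add: homotopic_loops_refl path_def pathstart_def pathfinish_def)
  from homotopic_loops_imp_homotopic_circlemaps[OF this]
  have circ: "continuous_on (sphere 0 1) (\<beta> \<circ> (\<lambda>z. Arg2pi z / (2 * pi)))"
    by (auto dest: homotopic_with_imp_continuous)
  have eq: "cone_map \<beta> z = norm z *\<^sub>R (\<beta> \<circ> (\<lambda>z. Arg2pi z / (2 * pi))) (z / norm z)" for z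
    by (cases "z = 0") (simp_all add: cone_map_def)
  have "isCont (cone_map \<beta>) z" for z
  proof (cases "z = 0")
    case True
    have "compact (\<beta> ` {0..1})"
      using assms by (intro compact_continuous_image) auto
    then obtain K where K: "\<And>t. t \<in> {0..1} \<Longrightarrow> norm (\<beta> t) \<le> K"
      unfolding bounded_iff[symmetric] using compact_imp_bounded bounded_iff
      by (metis imageI)
    have "((\<lambda>w. cone_map \<beta> w) \<longlongrightarrow> 0) (at 0)"
    proof (rule Lim_null_comparison)
      show "\<forall>\<^sub>F w in at 0. norm (cone_map \<beta> w) \<le> norm w * K"
        using Arg2pi by (intro always_eventually allI)
          (auto simp: cone_map_def less_imp_le intro!: mult_left_mono K)
      show "((\<lambda>w. norm w * K) \<longlongrightarrow> 0) (at 0)"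
        by (auto intro!: tendsto_eq_intros)
    qed
    moreover have "cone_map \<beta> 0 = 0" by (simp add: cone_map_def)
    ultimately show ?thesis using True by (metis isCont_def)
  next
    case False
    have "continuous_on (- {0}) (\<lambda>z. norm z *\<^sub>R (\<beta> \<circ> (\<lambda>z. Arg2pi z / (2 * pi))) (z / complex_of_real (norm z)))"
      by (intro continuous_intros continuous_on_compose2[OF circ]) (auto simp: norm_divide split: if_splits)
    then have "continuous_on (- {0}) (cone_map \<beta>)" unfolding eq[abs_def] .
    moreover have "open (- {0 :: complex})" by (rule open_Compl) simp
    ultimately show ?thesis
      using False continuous_on_eq_continuous_at by blast
  qed
  then show ?thesis by (simp add: continuous_at_imp_continuous_on)
qed

text \<open>The boundary of the square with vertices \<open>1\<close>, \<open>\<i>\<close>, \<open>-1\<close>,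
  \<open>-\<i>\<close>. The upper half is run through for parameters in \<open>[0, c]\<close>, the lower half
  for parameters in \<open>[c, 1]\<close>, in both cases with constant horizontal speed, so that a boundary arc
  of the disc parametrised by its angle is mapped to an arc parametrised by the real part.\<close>

definition diamond_loop :: "real \<Rightarrow> real \<Rightarrow> complex" where
  "diamond_loop c \<tau> =
     (if \<tau> \<le> c then Complex (1 - 2 * \<tau> / c) (1 - \<bar>1 - 2 * \<tau> / c\<bar>)
      else Complex (2 * (\<tau> - c) / (1 - c) - 1) (\<bar>2 * (\<tau> - c) / (1 - c) - 1\<bar> - 1))"

context
  fixes c :: real
  assumes c: "0 < c" "c < 1"
begin

lemma diamond_loop_lower:
  "c \<le> \<tau> \<Longrightarrow> diamond_loop c \<tau> = Complex (2 * (\<tau> - c) / (1 - c) - 1) (\<bar>2 * (\<tau> - c) / (1 - c) - 1\<bar> - 1)"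
  using c by (cases "\<tau> = c") (auto simp: diamond_loop_def)

lemma diamond_loop_ends: "diamond_loop c 0 = 1" "diamond_loop c 1 = 1" "diamond_loop c c = -1"
  using c by (auto simp: diamond_loop_def complex_eq_iff divide_simps)

lemma continuous_on_diamond_loop: "continuous_on {0..1} (diamond_loop c)"
proof -
  have "continuous_on ({0..c} \<union> {c..1}) (diamond_loop c)"
  proof (rule continuous_on_closed_Un)
    have "continuous_on {0..c} (\<lambda>\<tau>. Complex (1 - 2 * \<tau> / c) (1 - \<bar>1 - 2 * \<tau> / c\<bar>))"
      unfolding Complex_eq using c by (intro continuous_intros) auto
    then show "continuous_on {0..c} (diamond_loop c)"
      by (rule continuous_on_eq) (auto simp: diamond_loop_def)
    have "continuous_on {c..1} (\<lambda>\<tau>. Complex (2 * (\<tau> - c) / (1 - c) - 1) (\<bar>2 * (\<tau> - c) / (1 - c) - 1\<bar> - 1))"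
      unfolding Complex_eq using c by (intro continuous_intros) auto
    then show "continuous_on {c..1} (diamond_loop c)"
      by (rule continuous_on_eq) (auto simp: diamond_loop_lower)
  qed auto
  moreover have "{0..c} \<union> {c..1} = {0..1}" using c by auto
  ultimately show ?thesis by simp
qed

lemma diamond_loop_norm1:
  assumes "0 \<le> \<tau>" "\<tau> \<le> 1"
  shows "\<bar>Re (diamond_loop c \<tau>)\<bar> + \<bar>Im (diamond_loop c \<tau>)\<bar> = 1"
proof (cases "\<tau> \<le> c")
  case True
  then have "0 \<le> \<tau> / c" "\<tau> / c \<le> 1" using c assms by auto
  then have "\<bar>1 - 2 * \<tau> / c\<bar> \<le> 1" by (simp add: abs_le_iff)
  then show ?thesis using True by (simp add: diamond_loop_def)
next
  case False
  then have "0 \<le> (\<tau> - c) / (1 - c)" "(\<tau> - c) / (1 - c) \<le> 1" using c assms by auto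
  then have "\<bar>2 * ((\<tau> - c) / (1 - c)) - 1\<bar> \<le> 1" unfolding abs_le_iff by linarith
  then show ?thesis using False by (simp add: diamond_loop_def)
qed

lemma diamond_loop_Im:
  assumes "0 \<le> \<tau>" "\<tau> \<le> 1"
  shows "\<tau> \<le> c \<Longrightarrow> 0 \<le> Im (diamond_loop c \<tau>)" "c \<le> \<tau> \<Longrightarrow> Im (diamond_loop c \<tau>) \<le> 0"
proof -
  have *: "\<bar>Re (diamond_loop c \<tau>)\<bar> \<le> 1" using diamond_loop_norm1[OF assms] by linarith
  show "\<tau> \<le> c \<Longrightarrow> 0 \<le> Im (diamond_loop c \<tau>)" using * by (auto simp: diamond_loop_def)
  show "c \<le> \<tau> \<Longrightarrow> Im (diamond_loop c \<tau>) \<le> 0" using * by (auto simp: diamond_loop_lower)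
qed

lemma diamond_loop_inj:
  assumes "0 \<le> \<tau>" "\<tau> < 1" "0 \<le> \<tau>'" "\<tau>' < 1" "diamond_loop c \<tau> = diamond_loop c \<tau>'"
  shows "\<tau> = \<tau>'"
proof -
  have *: "\<tau> = \<tau>'" if "0 \<le> \<tau>" "\<tau> \<le> c" "c < \<tau>'" "\<tau>' < 1" "diamond_loop c \<tau> = diamond_loop c \<tau>'" for \<tau> \<tau>'
  proof -
    have "Im (diamond_loop c \<tau>) = 0"
      using diamond_loop_Im[of \<tau>] diamond_loop_Im[of \<tau>'] that c by fastforce
    then have "\<bar>Re (diamond_loop c \<tau>')\<bar> = 1"
      using diamond_loop_norm1[of \<tau>] that c by auto
    moreover have "Re (diamond_loop c \<tau>') > -1" "Re (diamond_loop c \<tau>') < 1"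
      using that c by (auto simp: diamond_loop_def field_simps)
    ultimately show ?thesis by linarith
  qed
  show ?thesis
  proof (cases "\<tau> \<le> c"; cases "\<tau>' \<le> c")
    assume "\<tau> \<le> c" "\<tau>' \<le> c" then show ?thesis using assms c by (simp add: diamond_loop_def)
  next
    assume "\<not> \<tau> \<le> c" "\<not> \<tau>' \<le> c" then show ?thesis using assms c by (simp add: diamond_loop_def field_simps)
  next
    assume "\<tau> \<le> c" "\<not> \<tau>' \<le> c" then show ?thesis using assms *[of \<tau> \<tau>'] by auto
  next
    assume "\<not> \<tau> \<le> c" "\<tau>' \<le> c" then show ?thesis using assms *[of \<tau>' \<tau>] by auto
  qed
qed

lemma diamond_loop_surj:
  assumes "\<bar>x\<bar> + \<bar>y\<bar> = 1"
  obtains \<tau> where "0 \<le> \<tau>" "\<tau> \<le> 1" "diamond_loop c \<tau> = Complex x y"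
proof (cases "0 \<le> y")
  case True
  have "c * ((1 - x) / 2) \<le> c" using assms c by (intro mult_left_le) auto
  moreover have "0 \<le> c * ((1 - x) / 2)" using assms c by (intro mult_nonneg_nonneg) auto
  moreover have "2 * (c * ((1 - x) / 2)) / c = 1 - x" using c by simp
  moreover from calculation have "diamond_loop c (c * ((1 - x) / 2)) = Complex x y"
    unfolding diamond_loop_def using True assms by simp
  ultimately show ?thesis using that[of "c * ((1 - x) / 2)"] c by linarith
next
  case False
  have "(1 - c) * ((x + 1) / 2) \<le> 1 - c" using assms c by (intro mult_left_le) auto
  moreover have "0 \<le> (1 - c) * ((x + 1) / 2)" using assms c by (intro mult_nonneg_nonneg) auto
  moreover have "2 * ((1 - c) * ((x + 1) / 2)) / (1 - c) - 1 = x" using c by simp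
  moreover from calculation have "diamond_loop c (c + (1 - c) * ((x + 1) / 2)) = Complex x y"
    using False assms by (subst diamond_loop_lower) simp_all
  ultimately show ?thesis using that[of "c + (1 - c) * ((x + 1) / 2)"] c by linarith
qed

end

text \<open>Points of the disc other than \<open>1\<close> are written \<open>1 - 2 * \<rho> * cos \<omega> * cis
  \<omega>\<close> with \<open>-\<pi>/2 < \<omega> < \<pi>/2\<close> and \<open>0 < \<rho> \<le> 1\<close>,
  where \<open>\<rho>\<close> is the radius of the circle through the point that is tangent to the unit circle
  at \<open>1\<close>. The real part of a point of the square determines \<open>\<omega>\<close>, and its
  relative height \<open>\<rho> \<in> [1/2, 1]\<close>: the upper edges go to the unit circle, the lower edges
  to the circle of radius \<open>1/2\<close>, and the two vertices \<open>\<plusminus>1\<close> to the point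
  \<open>1\<close>. There division by zero gives \<open>\<rho> = 3/4\<close>, which is harmless as \<open>cos
  \<omega> = 0\<close>.\<close>

definition pinch_height :: "complex \<Rightarrow> real" where
  "pinch_height w = 3 / 4 + Im w / (1 - \<bar>Re w\<bar>) / 4"

definition pinch_map :: "complex \<Rightarrow> complex" where
  "pinch_map w = 1 - (2 * pinch_height w * cos (pi * Re w / 2)) *\<^sub>R cis (- (pi * Re w / 2))"

lemma isCont_cis [continuous_intros]: "isCont f z \<Longrightarrow> isCont (\<lambda>z. cis (f z)) z"
  for f :: "complex \<Rightarrow> real"
  unfolding cis.ctr Complex_eq by (intro continuous_intros)

definition diamond :: "complex set" where
  "diamond = {w. \<bar>Re w\<bar> + \<bar>Im w\<bar> \<le> 1}"

lemma diamond_height: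
  assumes "w \<in> diamond"
  shows "1 / 2 \<le> pinch_height w" "pinch_height w \<le> 1"
proof -
  have "\<bar>Re w\<bar> \<le> 1" "\<bar>Im w\<bar> \<le> 1 - \<bar>Re w\<bar>" using assms by (auto simp: diamond_def)
  then have "\<bar>Im w / (1 - \<bar>Re w\<bar>)\<bar> \<le> 1" by (cases "\<bar>Re w\<bar> = 1") (auto simp: abs_divide)
  moreover define q where "q = Im w / (1 - \<bar>Re w\<bar>)"
  ultimately show "1 / 2 \<le> pinch_height w" "pinch_height w \<le> 1"
    unfolding pinch_height_def q_def[symmetric] by linarith+
qed

lemma cos_half_eq_0_iff: "\<bar>x\<bar> \<le> 1 \<Longrightarrow> cos (pi * x / 2) = 0 \<longleftrightarrow> \<bar>x\<bar> = 1"
proof -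
  assume x: "\<bar>x\<bar> \<le> 1"
  have "0 < cos (pi * x / 2)" if "\<bar>x\<bar> < 1"
  proof (rule cos_gt_zero_pi)
    have "pi * x < pi * 1" "pi * (-1) < pi * x"
      using that by (intro mult_strict_left_mono; simp)+
    then show "- (pi / 2) < pi * x / 2" "pi * x / 2 < pi / 2" by auto
  qed
  moreover have "cos (pi * x / 2) = 0" if "\<bar>x\<bar> = 1"
    using that by (auto simp: abs_if split: if_splits)
  ultimately show ?thesis using x by fastforce
qed

lemma pinch_map_apex: "\<bar>Re w\<bar> = 1 \<Longrightarrow> pinch_map w = 1"
  using cos_half_eq_0_iff[of "Re w"] by (simp add: pinch_map_def)

lemma norm_1_minus_pinch_map:
  "w \<in> diamond \<Longrightarrow> norm (1 - pinch_map w) \<le> 2 * \<bar>cos (pi * Re w / 2)\<bar>"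
  using diamond_height[of w] by (auto simp: pinch_map_def abs_mult intro!: mult_left_le_one_le)

text \<open>The height \<open>\<rho>\<close> has no limit at the vertices \<open>\<plusminus>1\<close> of the square, but it
  stays bounded while the factor \<open>cos \<omega>\<close> tends to zero.\<close>

lemma continuous_on_pinch_map: "continuous_on diamond pinch_map"
  unfolding continuous_on_eq_continuous_within
proof
  fix w assume w: "w \<in> diamond"
  show "continuous (at w within diamond) pinch_map"
  proof (cases "\<bar>Re w\<bar> = 1")
    case True
    have "((\<lambda>v. pinch_map v - 1) \<longlongrightarrow> 0) (at w within diamond)"
    proof (rule Lim_null_comparison)
      show "\<forall>\<^sub>F v in at w within diamond. norm (pinch_map v - 1) \<le> 2 * \<bar>cos (pi * Re v / 2)\<bar>"
        using norm_1_minus_pinch_map by (auto simp: eventually_at_filter norm_minus_commute intro!: always_eventually)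
      have "((\<lambda>v. 2 * \<bar>cos (pi * Re v / 2)\<bar>) \<longlongrightarrow> 2 * \<bar>cos (pi * Re w / 2)\<bar>) (at w within diamond)"
        by (intro tendsto_intros)  auto
      then show "((\<lambda>v. 2 * \<bar>cos (pi * Re v / 2)\<bar>) \<longlongrightarrow> 0) (at w within diamond)"
        using True cos_half_eq_0_iff[of "Re w"] by (simp del: tendsto_mult_left_iff)
    qed
    then show ?thesis using pinch_map_apex[OF True] by (simp add: continuous_within LIM_zero_iff)
  next
    case False
    then have "1 - \<bar>Re w\<bar> \<noteq> 0" by simp
    then have "isCont pinch_map w"
      unfolding pinch_map_def pinch_height_def by (intro continuous_intros) auto
    then show ?thesis by (rule continuous_at_imp_continuous_at_within)
  qed
qed

lemma one_minus_pinch_map: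
  "1 - pinch_map w = (2 * pinch_height w * cos (pi * Re w / 2)) *\<^sub>R cis (- (pi * Re w / 2))"
  by (simp add: pinch_map_def)

lemma half_angle_bounds:
  "\<bar>x\<bar> < 1 \<Longrightarrow> \<bar>pi * x / 2\<bar> < pi / 2"
  by (simp add: abs_mult)

lemma cos_half_pos: "\<bar>x\<bar> < 1 \<Longrightarrow> 0 < cos (pi * x / 2)"
  using half_angle_bounds[of x] by (intro cos_gt_zero_pi) auto

lemma polar_unique:
  assumes "r *\<^sub>R cis a = s *\<^sub>R cis b" "0 < r" "0 < s" "\<bar>a\<bar> < pi" "\<bar>b\<bar> < pi"
  shows "r = s \<and> a = b"
proof -
  have "norm (r *\<^sub>R cis a) = norm (s *\<^sub>R cis b)" using assms(1) by (simp only:)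
  then have "r = s" using assms(2,3) unfolding norm_scaleR norm_cis by simp
  moreover from this have "cis a = cis b" using assms by simp
  moreover have "Arg (cis a) = a" "Arg (cis b) = b"
    using assms(4,5) by (intro Arg_cis; simp add: abs_less_iff)+
  ultimately have "a = b" by metis
  with \<open>r = s\<close> show ?thesis by simp
qed

lemma pinch_map_inj:
  assumes "w \<in> diamond" "w' \<in> diamond" "pinch_map w = pinch_map w'"
  shows "w = w' \<or> w \<in> {1, -1} \<and> w' \<in> {1, -1}"
proof -
  let ?\<rho> = pinch_height
  have pos: "0 < 2 * ?\<rho> w * cos (pi * Re w / 2)" if "w \<in> diamond" "\<bar>Re w\<bar> < 1" for w
    using diamond_height[OF that(1)] cos_half_pos[OF that(2)] by (intro mult_pos_pos) auto
  have one: "pinch_map w = 1 \<longleftrightarrow> \<bar>Re w\<bar> = 1" if "w \<in> diamond" for w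
  proof
    assume "pinch_map w = 1"
    then have "(2 * ?\<rho> w * cos (pi * Re w / 2)) *\<^sub>R cis (- (pi * Re w / 2)) = 0"
      using one_minus_pinch_map[of w] by simp
    then have "\<not> \<bar>Re w\<bar> < 1" using pos[OF that] by (auto simp: cis_neq_zero)
    then show "\<bar>Re w\<bar> = 1" using that by (auto simp: diamond_def)
  qed (rule pinch_map_apex)
  show ?thesis
  proof (cases "\<bar>Re w\<bar> = 1")
    case True
    then have "\<bar>Re w'\<bar> = 1" using one assms by metis
    with True assms show ?thesis
      by (auto simp: diamond_def complex_eq_iff abs_if split: if_splits)
  next
    case False
    then have "\<bar>Re w'\<bar> \<noteq> 1" using one assms by metis
    with False have lt: "\<bar>Re w\<bar> < 1" "\<bar>Re w'\<bar> < 1" using assms by (auto simp: diamond_def)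
    have "(2 * ?\<rho> w * cos (pi * Re w / 2)) *\<^sub>R cis (- (pi * Re w / 2)) =
      (2 * ?\<rho> w' * cos (pi * Re w' / 2)) *\<^sub>R cis (- (pi * Re w' / 2))"
      using one_minus_pinch_map[of w] one_minus_pinch_map[of w'] assms by simp
    from polar_unique[OF this pos pos] lt assms half_angle_bounds[OF lt(1)] half_angle_bounds[OF lt(2)]
    have "2 * ?\<rho> w * cos (pi * Re w / 2) = 2 * ?\<rho> w' * cos (pi * Re w' / 2)" "pi * Re w / 2 = pi * Re w' / 2"
      by auto
    then have "Re w = Re w'" "?\<rho> w = ?\<rho> w'" using cos_half_pos[OF lt(1)] by auto
    then show ?thesis using lt by (simp add: complex_eq_iff pinch_height_def)
  qed
qed

lemma norm_sq_1_minus_polar: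
  "(norm (1 - r *\<^sub>R cis a))\<^sup>2 = 1 - 2 * r * cos a + r\<^sup>2"
proof -
  have "(norm (1 - r *\<^sub>R cis a))\<^sup>2 = (1 - r * cos a)\<^sup>2 + (r * sin a)\<^sup>2"
    by (simp add: cmod_power2)
  also have "\<dots> = 1 - 2 * r * cos a + r\<^sup>2 * ((sin a)\<^sup>2 + (cos a)\<^sup>2)"
    by (simp only: power2_eq_square algebra_simps)
  finally show ?thesis by simp
qed

lemma polar_in_cball_iff:
  assumes "0 < r" shows "1 - r *\<^sub>R cis a \<in> cball 0 1 \<longleftrightarrow> r \<le> 2 * cos a"
proof -
  have "1 - r *\<^sub>R cis a \<in> cball 0 1 \<longleftrightarrow> (norm (1 - r *\<^sub>R cis a))\<^sup>2 \<le> 1"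
    by (simp add: power_le_one_iff)
  also have "\<dots> \<longleftrightarrow> r * r \<le> r * (2 * cos a)"
    unfolding norm_sq_1_minus_polar by (simp add: power2_eq_square algebra_simps)
  finally show ?thesis using assms by simp
qed

text \<open>The homothety onto the disc that is tangent to the unit circle at \<open>1\<close> and has radius
  \<open>1/2\<close>.\<close>

definition bubble_map :: "complex \<Rightarrow> complex" where
  "bubble_map z = (1 + z) / 2"

lemma polar_in_bubble_iff:
  assumes "0 < r" shows "1 - r *\<^sub>R cis a \<in> bubble_map ` cball 0 1 \<longleftrightarrow> r \<le> cos a"
proof -
  have "1 - r *\<^sub>R cis a \<in> bubble_map ` cball 0 1 \<longleftrightarrow> 1 - (2 * r) *\<^sub>R cis a \<in> cball 0 1"
  proof
    assume "1 - (2 * r) *\<^sub>R cis a \<in> cball 0 1"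
    then show "1 - r *\<^sub>R cis a \<in> bubble_map ` cball 0 1"
      by (rule rev_image_eqI) (simp add: bubble_map_def scaleR_conv_of_real field_simps)
  next
    assume "1 - r *\<^sub>R cis a \<in> bubble_map ` cball 0 1"
    then obtain z where "z \<in> cball 0 1" "1 - r *\<^sub>R cis a = (1 + z) / 2"
      by (auto simp: bubble_map_def)
    moreover from this have "z = 1 - (2 * r) *\<^sub>R cis a" by (simp add: scaleR_conv_of_real field_simps)
    ultimately show "1 - (2 * r) *\<^sub>R cis a \<in> cball 0 1" by simp
  qed
  then show ?thesis using polar_in_cball_iff[of "2 * r" a] assms by simp
qed

lemma pinch_map_in_cball: "w \<in> diamond \<Longrightarrow> pinch_map w \<in> cball 0 1"
proof (cases "\<bar>Re w\<bar> < 1")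
  assume w: "w \<in> diamond"
  case True
  let ?\<rho> = "pinch_height w"
  have pos: "0 < 2 * ?\<rho> * cos (pi * Re w / 2)"
    using diamond_height[OF w] cos_half_pos[OF True] by (intro mult_pos_pos) auto
  moreover have "2 * ?\<rho> * cos (pi * Re w / 2) \<le> 2 * 1 * cos (pi * Re w / 2)"
    using diamond_height[OF w] cos_half_pos[OF True] by (intro mult_mono) auto
  ultimately show ?thesis
    unfolding pinch_map_def by (subst polar_in_cball_iff) auto
next
  assume "w \<in> diamond"
  moreover case False
  ultimately have "\<bar>Re w\<bar> = 1" by (auto simp: diamond_def)
  then show ?thesis by (simp add: pinch_map_apex)
qed

lemma pinch_map_meets_bubble:
  assumes w: "w \<in> diamond" and "pinch_map w \<in> bubble_map ` cball 0 1"
  shows "\<bar>Re w\<bar> + \<bar>Im w\<bar> = 1 \<and> (Im w \<le> 0)"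
proof (cases "\<bar>Re w\<bar> < 1")
  case True
  let ?\<rho> = "pinch_height w"
  have pos: "0 < 2 * ?\<rho> * cos (pi * Re w / 2)"
    using diamond_height[OF w] cos_half_pos[OF True] by (intro mult_pos_pos) auto
  then have "2 * ?\<rho> * cos (pi * Re w / 2) \<le> cos (pi * Re w / 2)"
    using polar_in_bubble_iff[of "2 * ?\<rho> * cos (pi * Re w / 2)" "- (pi * Re w / 2)"] assms(2)
    by (simp add: pinch_map_def)
  then have "?\<rho> \<le> 1 / 2" using cos_half_pos[OF True] by simp
  moreover define q where "q = Im w / (1 - \<bar>Re w\<bar>)"
  ultimately have "q \<le> -1" unfolding pinch_height_def q_def[symmetric] by linarith
  then have "Im w / (1 - \<bar>Re w\<bar>) \<le> -1" unfolding q_def .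
  then have "Im w \<le> - (1 - \<bar>Re w\<bar>)" using True by (simp add: field_simps)
  then show ?thesis using w True by (auto simp: diamond_def)
next
  case False
  then show ?thesis using w by (auto simp: diamond_def)
qed

text \<open>In the polar coordinates \<open>1 - r * cis a\<close> the unit disc is \<open>r \<le> 2 * cos a\<close> and the
  small disc is \<open>r \<le> cos a\<close>; the pinch map covers what lies between.\<close>

lemma pinch_bubble_cover:
  assumes "v \<in> cball 0 1"
  shows "v \<in> pinch_map ` diamond \<union> bubble_map ` cball 0 1"
proof (cases "v = 1")
  case True
  have "1 \<in> diamond" by (simp add: diamond_def)
  then show ?thesis using pinch_map_apex[of 1] True by force
next
  case False
  define r a where "r = norm (1 - v)" and "a = Arg (1 - v)"
  have r: "0 < r" and v: "1 - r *\<^sub>R cis a = v"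
    using False by (simp_all add: r_def a_def scaleR_conv_of_real flip: rcis_def)
      (metis add_diff_cancel_left' diff_add_cancel rcis_cmod_Arg)
  then have "r \<le> 2 * cos a" using polar_in_cball_iff[of r a] assms by simp
  then have c: "0 < cos a" using r by simp
  moreover have "Re (1 - v) = r * cos a" unfolding v[symmetric] by simp
  ultimately have "0 < Re (1 - v)" using r by (metis mult_pos_pos)
  then have a: "\<bar>a\<bar> < pi / 2" unfolding a_def using Arg_Re_pos by blast
  show ?thesis
  proof (cases "r \<le> cos a")
    case True
    then show ?thesis using polar_in_bubble_iff[OF r] v by auto
  next
    case False
    \<comment> \<open>solves \<open>\<omega> = a\<close> and \<open>2 * \<rho> * cos a = r\<close> for the point of the square\<close>
    define x y where "x = - 2 * a / pi" and "y = (2 * r / cos a - 3) * (1 - \<bar>x\<bar>)"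
    have x: "\<bar>x\<bar> < 1" using a by (simp add: x_def abs_mult field_simps)
    have "1 \<le> r / cos a" "r / cos a \<le> 2" using c False \<open>r \<le> 2 * cos a\<close> by (auto simp: field_simps)
    then have "\<bar>2 * (r / cos a) - 3\<bar> \<le> 1" by (simp add: abs_le_iff)
    then have "\<bar>y\<bar> \<le> 1 * (1 - \<bar>x\<bar>)" unfolding y_def abs_mult using x by (intro mult_mono) auto
    then have "Complex x y \<in> diamond" by (simp add: diamond_def)
    moreover have "y / (1 - \<bar>x\<bar>) = 2 * r / cos a - 3"
      using x by (simp add: y_def)
    then have "pinch_height (Complex x y) = r / cos a / 2"
      unfolding pinch_height_def by (simp add: diff_divide_distrib)
    then have "pinch_map (Complex x y) = 1 - (2 * (r / cos a / 2) * cos (pi * x / 2)) *\<^sub>R cis (- (pi * x / 2))"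
      by (simp add: pinch_map_def)
    then have "pinch_map (Complex x y) = v" using c v by (simp add: x_def)
    ultimately show ?thesis by blast
  qed
qed

text \<open>The unit disc is mapped onto the crescent between the unit circle and the small circle. The boundary arc of
  relative length \<open>c\<close> that starts at \<open>1\<close> is stretched around the unit circle, and the
  remaining arc is wrapped around the small circle in the opposite sense.\<close>

definition pinch_disc :: "real \<Rightarrow> complex \<Rightarrow> complex" where
  "pinch_disc c z = pinch_map (cone_map (diamond_loop c) z)"

lemma cone_diamond:
  assumes c: "0 < c" "c < 1"
  shows "z \<in> cball 0 1 \<Longrightarrow> cone_map (diamond_loop c) z \<in> diamond"
    and "diamond \<subseteq> cone_map (diamond_loop c) ` cball 0 1"
    and "\<bar>Re (cone_map (diamond_loop c) z)\<bar> + \<bar>Im (cone_map (diamond_loop c) z)\<bar> = norm z"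
    and "inj (cone_map (diamond_loop c))"
proof -
  have ends: "diamond_loop c 0 = diamond_loop c 1" using diamond_loop_ends[OF c] by simp
  show nrm: "\<bar>Re (cone_map (diamond_loop c) z)\<bar> + \<bar>Im (cone_map (diamond_loop c) z)\<bar> = norm z" for z
  proof -
    obtain \<tau> where "0 \<le> \<tau>" "\<tau> < 1" "z = norm z *\<^sub>R cis (2 * pi * \<tau>)" by (rule polar_unit_interval)
    with cone_map_polar[of "diamond_loop c" \<tau> "norm z", OF ends]
    have "cone_map (diamond_loop c) z = norm z *\<^sub>R diamond_loop c \<tau>" by simp
    then show ?thesis using diamond_loop_norm1[OF c, of \<tau>] \<open>0 \<le> \<tau>\<close> \<open>\<tau> < 1\<close>
      by (simp add: abs_mult flip: distrib_left)
  qed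
  then show "z \<in> cball 0 1 \<Longrightarrow> cone_map (diamond_loop c) z \<in> diamond"
    by (simp add: diamond_def)
  show "inj (cone_map (diamond_loop c))"
  proof (rule injI)
    fix z z' assume eq: "cone_map (diamond_loop c) z = cone_map (diamond_loop c) z'"
    then have n: "norm z = norm z'" using nrm by metis
    obtain \<tau> where t: "0 \<le> \<tau>" "\<tau> < 1" "z = norm z *\<^sub>R cis (2 * pi * \<tau>)" by (rule polar_unit_interval)
    obtain \<tau>' where t': "0 \<le> \<tau>'" "\<tau>' < 1" "z' = norm z' *\<^sub>R cis (2 * pi * \<tau>')" by (rule polar_unit_interval)
    show "z = z'"
    proof (cases "norm z = 0")
      case False
      have "norm z *\<^sub>R diamond_loop c \<tau> = norm z *\<^sub>R diamond_loop c \<tau>'"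
        using cone_map_polar[of "diamond_loop c" \<tau> "norm z", OF ends]
          cone_map_polar[of "diamond_loop c" \<tau>' "norm z'", OF ends] t t' eq n by simp
      then have "\<tau> = \<tau>'" using False diamond_loop_inj[OF c] t t' by simp
      then show ?thesis using t t' n by metis
    qed (use n in auto)
  qed
  show "diamond \<subseteq> cone_map (diamond_loop c) ` cball 0 1"
  proof
    fix w assume w: "w \<in> diamond"
    define r where "r = \<bar>Re w\<bar> + \<bar>Im w\<bar>"
    show "w \<in> cone_map (diamond_loop c) ` cball 0 1"
    proof (cases "r = 0")
      case True
      then have "w = cone_map (diamond_loop c) 0" by (auto simp: r_def cone_map_def complex_eq_iff)
      then show ?thesis by auto
    next
      case False
      then have r: "0 < r" "r \<le> 1" using w by (auto simp: r_def diamond_def)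
      have "\<bar>Re w / r\<bar> + \<bar>Im w / r\<bar> = r / r" using r(1)
        unfolding abs_divide by (simp add: add_divide_distrib[symmetric] r_def)
      then have "\<bar>Re w / r\<bar> + \<bar>Im w / r\<bar> = 1" using r by simp
      from diamond_loop_surj[OF c this] obtain \<tau> where
        t: "0 \<le> \<tau>" "\<tau> \<le> 1" "diamond_loop c \<tau> = Complex (Re w / r) (Im w / r)" by blast
      have "cone_map (diamond_loop c) (r *\<^sub>R cis (2 * pi * \<tau>)) = w"
        using cone_map_polar[OF ends t(1,2), of r] t(3) r by (simp add: complex_eq_iff)
      then show ?thesis using r by (intro image_eqI[of _ _ "r *\<^sub>R cis (2 * pi * \<tau>)"]) auto
    qed
  qed
qed

lemma continuous_on_pinch_disc:
  assumes c: "0 < c" "c < 1" shows "continuous_on (cball 0 1) (pinch_disc c)"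
  unfolding pinch_disc_def
  using continuous_on_cone_map[OF continuous_on_diamond_loop[OF c]] diamond_loop_ends[OF c] cone_diamond(1)[OF c]
  by (intro continuous_on_compose2[OF continuous_on_pinch_map]) (auto intro: continuous_on_subset)

lemma pinch_disc_range:
  assumes c: "0 < c" "c < 1"
  shows "pinch_disc c ` cball 0 1 \<union> bubble_map ` cball 0 1 = cball 0 1"
proof -
  have "pinch_disc c ` cball 0 1 = pinch_map ` diamond"
    using cone_diamond(1,2)[OF c] unfolding pinch_disc_def by blast
  moreover have "bubble_map ` cball 0 1 \<subseteq> cball 0 1"
  proof safe
    fix z :: complex assume "z \<in> cball 0 1"
    then show "bubble_map z \<in> cball 0 1"
      using norm_triangle_ineq[of 1 z] by (simp add: bubble_map_def norm_divide)
  qed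
  moreover have "pinch_map ` diamond \<subseteq> cball 0 1" using pinch_map_in_cball by (rule image_subsetI)
  moreover have "cball 0 1 \<subseteq> pinch_map ` diamond \<union> bubble_map ` cball 0 1"
    using pinch_bubble_cover by (rule subsetI)
  ultimately show ?thesis by (metis Un_least subset_antisym)
qed

lemma pinch_disc_outer:
  assumes c: "0 < c" "c < 1" and "0 \<le> \<sigma>" "\<sigma> \<le> 1"
  shows "pinch_disc c (cis (2 * pi * (c * \<sigma>))) = cis (2 * pi * \<sigma>)"
proof -
  have "c * \<sigma> \<le> c" using assms by (intro mult_left_le) auto
  moreover from this have "c * \<sigma> \<le> 1" using c by linarith
  moreover have "0 \<le> c * \<sigma>" using assms by (intro mult_nonneg_nonneg) auto
  ultimately have "cone_map (diamond_loop c) (1 *\<^sub>R cis (2 * pi * (c * \<sigma>))) = 1 *\<^sub>R diamond_loop c (c * \<sigma>)"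
    by (intro cone_map_polar) (simp_all only: diamond_loop_ends[OF c] zero_le_one)
  then have "pinch_disc c (cis (2 * pi * (c * \<sigma>))) = pinch_map (Complex (1 - 2 * \<sigma>) (1 - \<bar>1 - 2 * \<sigma>\<bar>))"
    using \<open>c * \<sigma> \<le> c\<close> c by (simp add: pinch_disc_def diamond_loop_def)
  also have "\<dots> = cis (2 * pi * \<sigma>)"
  proof (cases "\<sigma> = 0 \<or> \<sigma> = 1")
    case True
    then show ?thesis by (auto simp: pinch_map_apex)
  next
    case False
    define a where "a = pi * \<sigma>"
    have "1 - \<bar>1 - 2 * \<sigma>\<bar> \<noteq> 0" using False assms by auto
    then have "pinch_height (Complex (1 - 2 * \<sigma>) (1 - \<bar>1 - 2 * \<sigma>\<bar>)) = 1" by (simp add: pinch_height_def)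
    then have "pinch_map (Complex (1 - 2 * \<sigma>) (1 - \<bar>1 - 2 * \<sigma>\<bar>)) =
        1 - (2 * cos (pi * (1 - 2 * \<sigma>) / 2)) *\<^sub>R cis (- (pi * (1 - 2 * \<sigma>) / 2))"
      unfolding pinch_map_def by simp
    also have "pi * (1 - 2 * \<sigma>) / 2 = pi / 2 - a" by (simp add: field_simps a_def)
    also have "1 - (2 * cos (pi / 2 - a)) *\<^sub>R cis (- (pi / 2 - a)) = cis (2 * a)"
      using cos_double_sin[of a] sin_double[of a]
      by (simp add: complex_eq_iff cos_diff sin_diff power2_eq_square)
    finally show ?thesis by (simp add: a_def mult.assoc)
  qed
  finally show ?thesis .
qed

lemma pinch_disc_inner:
  assumes c: "0 < c" "c < 1" and "0 \<le> \<sigma>" "\<sigma> \<le> 1"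
  shows "pinch_disc c (cis (2 * pi * (c + (1 - c) * \<sigma>))) = bubble_map (cis (2 * pi * (1 - \<sigma>)))"
proof -
  have le: "(1 - c) * \<sigma> \<le> 1 - c" using assms by (intro mult_left_le) auto
  then have "c + (1 - c) * \<sigma> \<le> 1" by linarith
  then have "cone_map (diamond_loop c) (1 *\<^sub>R cis (2 * pi * (c + (1 - c) * \<sigma>))) = 1 *\<^sub>R diamond_loop c (c + (1 - c) * \<sigma>)"
    using c assms(3) by (intro cone_map_polar) (simp_all add: diamond_loop_ends)
  moreover have "2 * (c + (1 - c) * \<sigma> - c) / (1 - c) = 2 * \<sigma>" using c by simp
  ultimately have "pinch_disc c (cis (2 * pi * (c + (1 - c) * \<sigma>))) = pinch_map (Complex (2 * \<sigma> - 1) (\<bar>2 * \<sigma> - 1\<bar> - 1))"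
    using assms c by (simp only: pinch_disc_def scaleR_one) (subst diamond_loop_lower, auto)
  also have "\<dots> = bubble_map (cis (2 * pi * (1 - \<sigma>)))"
  proof (cases "\<sigma> = 0 \<or> \<sigma> = 1")
    case True
    then show ?thesis by (auto simp: pinch_map_apex bubble_map_def)
  next
    case False
    define a where "a = pi * \<sigma>"
    have nz: "1 - \<bar>2 * \<sigma> - 1\<bar> \<noteq> 0" using False assms by auto
    have "(\<bar>2 * \<sigma> - 1\<bar> - 1) / (1 - \<bar>2 * \<sigma> - 1\<bar>) = - 1"
      using nz by (metis divide_minus1 minus_diff_eq minus_divide_left divide_self)
    then have "pinch_height (Complex (2 * \<sigma> - 1) (\<bar>2 * \<sigma> - 1\<bar> - 1)) = 1 / 2"
      by (simp add: pinch_height_def)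
    then have "pinch_map (Complex (2 * \<sigma> - 1) (\<bar>2 * \<sigma> - 1\<bar> - 1)) =
        1 - (cos (pi * (2 * \<sigma> - 1) / 2)) *\<^sub>R cis (- (pi * (2 * \<sigma> - 1) / 2))"
      unfolding pinch_map_def by simp
    also have "pi * (2 * \<sigma> - 1) / 2 = a - pi / 2" by (simp add: field_simps a_def)
    also have "1 - (cos (a - pi / 2)) *\<^sub>R cis (- (a - pi / 2)) = (1 + cis (2 * pi - 2 * a)) / 2"
      using cos_double_sin[of a] sin_double[of a]
      by (simp add: complex_eq_iff cos_diff sin_diff power2_eq_square)
    finally show ?thesis by (simp add: a_def bubble_map_def algebra_simps)
  qed
  finally show ?thesis .
qed

text \<open>Only the end points of the two boundary arcs get identified.\<close>

lemma pinch_disc_inj: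
  assumes c: "0 < c" "c < 1" and z: "z \<in> cball 0 1" "z' \<in> cball 0 1" "pinch_disc c z = pinch_disc c z'"
  shows "z = z' \<or> z \<in> {1, cis (2 * pi * c)} \<and> z' \<in> {1, cis (2 * pi * c)}"
proof -
  let ?H = "cone_map (diamond_loop c)"
  have "?H (1 *\<^sub>R cis (2 * pi * 0)) = 1 *\<^sub>R diamond_loop c 0"
       "?H (1 *\<^sub>R cis (2 * pi * c)) = 1 *\<^sub>R diamond_loop c c"
    using c diamond_loop_ends[OF c] by (intro cone_map_polar; simp)+
  then have e: "?H 1 = 1" "?H (cis (2 * pi * c)) = -1"
    using diamond_loop_ends[OF c] by simp_all
  have "?H z = ?H z' \<or> ?H z \<in> {1, -1} \<and> ?H z' \<in> {1, -1}"
    using pinch_map_inj[of "?H z" "?H z'"] cone_diamond(1)[OF c] z unfolding pinch_disc_def by blast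
  then show ?thesis
    using cone_diamond(4)[OF c] e unfolding inj_def by (metis insert_iff singletonD)
qed

text \<open>The crescent and the small disc meet in the small circle only.\<close>

lemma pinch_disc_meets_bubble:
  assumes c: "0 < c" "c < 1" and z: "z \<in> cball 0 1" "pinch_disc c z \<in> bubble_map ` cball 0 1"
  obtains \<sigma> where "0 \<le> \<sigma>" "\<sigma> \<le> 1" "z = cis (2 * pi * (c + (1 - c) * \<sigma>))"
proof -
  let ?w = "cone_map (diamond_loop c) z"
  have w: "\<bar>Re ?w\<bar> + \<bar>Im ?w\<bar> = 1" "Im ?w \<le> 0"
    using pinch_map_meets_bubble[of ?w] cone_diamond(1)[OF c z(1)] z(2) unfolding pinch_disc_def by auto
  then have nz: "norm z = 1" using cone_diamond(3)[OF c, of z] by simp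
  obtain \<tau> where t: "0 \<le> \<tau>" "\<tau> < 1" "z = norm z *\<^sub>R cis (2 * pi * \<tau>)" by (rule polar_unit_interval)
  have "?w = diamond_loop c \<tau>"
    using cone_map_polar[of "diamond_loop c" \<tau> 1] diamond_loop_ends[OF c] t nz by simp
  have "\<exists>\<tau>. c \<le> \<tau> \<and> \<tau> \<le> 1 \<and> z = cis (2 * pi * \<tau>)"
  proof (cases "c \<le> \<tau>")
    case True
    then show ?thesis using t nz by (intro exI[of _ \<tau>]) auto
  next
    case False
    have "Im ?w = 0" using diamond_loop_Im(1)[OF c, of \<tau>] t False w \<open>?w = _\<close> by auto
    then have "\<bar>1 - 2 * \<tau> / c\<bar> = 1" using w \<open>?w = _\<close> False by (simp add: diamond_loop_def)
    then have "\<tau> = 0" using t False c by (auto simp: field_simps abs_if split: if_splits)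
    then have "z = cis (2 * pi * 1)" using t nz by (simp add: complex_eq_iff)
    then show ?thesis using c by (intro exI[of _ 1]) auto
  qed
  then obtain \<tau> where t: "c \<le> \<tau>" "\<tau> \<le> 1" "z = cis (2 * pi * \<tau>)" by blast
  have "c + (1 - c) * ((\<tau> - c) / (1 - c)) = \<tau>" using c by simp
  then show ?thesis using that[of "(\<tau> - c) / (1 - c)"] t c by simp
qed

section \<open>Discs with opposite boundary points identified\<close>

definition antipodal_disc :: "'a topology \<Rightarrow> (complex \<Rightarrow> 'a) \<Rightarrow> bool" where
  "antipodal_disc Y q \<longleftrightarrow>
     continuous_map (top_of_set (cball 0 1)) Y q \<and> q ` cball 0 1 = topspace Y \<and>
     (\<forall>x\<in>cball 0 1. \<forall>y\<in>cball 0 1. q x = q y \<longleftrightarrow> x = y \<or> x \<in> sphere 0 1 \<and> y = - x)"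

lemma antipodal_discD:
  assumes "antipodal_disc Y q"
  shows "continuous_map (top_of_set (cball 0 1)) Y q" "q ` cball 0 1 = topspace Y"
    "\<And>x y. x \<in> cball 0 1 \<Longrightarrow> y \<in> cball 0 1 \<Longrightarrow> q x = q y \<longleftrightarrow> x = y \<or> x \<in> sphere 0 1 \<and> y = - x"
  using assms unfolding antipodal_disc_def by blast+

lemma antipodal_disc_interior:
  assumes "antipodal_disc Y q" "x \<in> cball 0 1"
  shows "q x \<in> q ` sphere 0 1 \<longleftrightarrow> x \<in> sphere 0 1"
proof
  assume "q x \<in> q ` sphere 0 1"
  then obtain y where y: "y \<in> sphere 0 1" "q x = q y" by blast
  then have "x = y \<or> x \<in> sphere 0 1 \<and> y = - x"
    using antipodal_discD(3)[OF assms(1), of x y] assms(2) by auto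
  then show "x \<in> sphere 0 1" using y by auto
qed simp

lemma Hausdorff_coincidence_closed:
  fixes q r :: "complex \<Rightarrow> 'a"
  assumes "Hausdorff_space Y" "continuous_map (top_of_set A) Y q" "continuous_map (top_of_set B) Y r"
    "closed A" "closed B"
  shows "closed {(x, y). x \<in> A \<and> y \<in> B \<and> q x = r y}"
proof -
  have "continuous_map (top_of_set (A \<times> B)) (top_of_set A) fst"
       "continuous_map (top_of_set (A \<times> B)) (top_of_set B) snd"
    by (auto intro: continuous_on_fst continuous_on_snd continuous_on_id)
  then have "continuous_map (top_of_set (A \<times> B)) Y (q \<circ> fst)" "continuous_map (top_of_set (A \<times> B)) Y (r \<circ> snd)"
    using assms by (meson continuous_map_compose)+
  note closedin_continuous_maps_eq[OF assms(1) this]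
  moreover have "{z \<in> topspace (top_of_set (A \<times> B)). (q \<circ> fst) z = (r \<circ> snd) z} = {(x, y). x \<in> A \<and> y \<in> B \<and> q x = r y}"
    by auto
  ultimately have "closedin (top_of_set (A \<times> B)) {(x, y). x \<in> A \<and> y \<in> B \<and> q x = r y}"
    by simp
  then show ?thesis using assms closed_Times closedin_closed_trans by blast
qed

text \<open>The open discs are both mapped homeomorphically to the complement of the common image of the boundary circles,
  which gives a map \<open>h\<close> between them. The graph of the required extension is the closure
  \<open>G\<close> of the graph of \<open>h\<close>. It is compact, so it only remains to see that it is
  single-valued. Over a boundary point it contains at most two values \<open>y\<close> and \<open>-y\<close>. If
  it contained both, then \<open>h\<close> would map the intersections of the disc with small balls, which are
  connected, into the union of two disjoint neighbourhoods of \<open>y\<close> and \<open>-y\<close> and would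
  meet both.\<close>

lemma disc_lift_exists:
  fixes q r :: "complex \<Rightarrow> 'a"
  assumes Y: "Hausdorff_space Y" and q: "antipodal_disc Y q" and r: "antipodal_disc Y r"
    and boundary: "q ` sphere 0 1 = r ` sphere 0 1"
  obtains h where "continuous_on (cball 0 1) h" "h ` cball 0 1 \<subseteq> cball 0 1"
    "h ` ball 0 1 \<subseteq> ball 0 1" "\<And>x. x \<in> cball 0 1 \<Longrightarrow> r (h x) = q x"
proof -
  note qD = antipodal_discD[OF q] and rD = antipodal_discD[OF r]
  define W where "W = {(x, y). x \<in> cball 0 1 \<and> y \<in> cball 0 1 \<and> q x = r y}"
  define G where "G = closure (W \<inter> ball 0 1 \<times> UNIV)"
  have "closed W"
    unfolding W_def by (rule Hausdorff_coincidence_closed[OF Y qD(1) rD(1)]) auto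
  then have GW: "G \<subseteq> W" unfolding G_def by (intro closure_minimal) auto
  have "W \<subseteq> cball 0 1 \<times> cball 0 1" unfolding W_def by auto
  then have "compact W" using \<open>closed W\<close> compact_Times[OF compact_cball compact_cball]
    by (metis closed_Int_compact inf.absorb1)
  then have "compact G" using GW unfolding G_def
    by (metis closed_closure closed_Int_compact inf.absorb1)
  have interior: "y \<in> ball 0 1" if "(x, y) \<in> W" "x \<in> ball 0 1" for x y
  proof (rule ccontr)
    assume "y \<notin> ball 0 1"
    then have "y \<in> sphere 0 1" using that by (auto simp: W_def)
    then have "q x \<in> q ` sphere 0 1" using that boundary by (auto simp: W_def)
    then show False using antipodal_disc_interior[OF q, of x] that by (auto simp: W_def)
  qed
  have uniq_int: "y = y'" if "(x, y) \<in> W" "(x, y') \<in> W" "x \<in> ball 0 1" for x y y'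
    using that rD(3)[of y y'] interior[of x y] by (auto simp: W_def)
  have ex_int: "\<exists>y. (x, y) \<in> W" if "x \<in> cball 0 1" for x
  proof -
    have "q x \<in> r ` cball 0 1" using qD(2) rD(2) that by auto
    then show ?thesis using that by (auto simp: W_def)
  qed
  have Gball: "(x, y) \<in> G" if "(x, y) \<in> W" "x \<in> ball 0 1" for x y
    using that closure_subset[of "W \<inter> ball 0 1 \<times> UNIV"] by (auto simp: G_def)
  have ex: "\<exists>y. (x, y) \<in> G" if "x \<in> cball 0 1" for x
  proof -
    have "closed (fst ` G)" using \<open>compact G\<close>
      by (intro compact_imp_closed compact_continuous_image continuous_intros)
    moreover have "ball 0 1 \<subseteq> fst ` G"
      using ex_int Gball by (force intro: rev_image_eqI)
    ultimately have "closure (ball 0 1) \<subseteq> fst ` G" by (rule closure_minimal[rotated])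
    then show ?thesis using that by force
  qed
  define k where "k x = (THE y. (x, y) \<in> W)" for x
  have k: "(x, y) \<in> W \<longleftrightarrow> y = k x" if "x \<in> ball 0 1" for x y
    using ex_int[of x] uniq_int[of x] that unfolding k_def
    by (metis (no_types, lifting) ball_subset_cball subsetD the_equality)
  have contk: "continuous_on (ball 0 1) k"
  proof (subst continuous_closed_graph_eq[OF compact_cball[of 0 1]])
    have kW: "(x, k x) \<in> W" if "x \<in> ball 0 1" for x using k[OF that] by blast
    then show "k \<in> ball 0 1 \<rightarrow> cball 0 1" by (auto simp: W_def)
    have "(\<lambda>x. (x, k x)) ` ball 0 1 = (ball 0 1 \<times> cball 0 1) \<inter> W"
      using k kW \<open>W \<subseteq> cball 0 1 \<times> cball 0 1\<close> by fastforce
    then show "closedin (top_of_set (ball 0 1 \<times> cball 0 1)) ((\<lambda>x. (x, k x)) ` ball 0 1)"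
      using \<open>closed W\<close> by (simp add: closedin_closed_Int)
  qed
  have uniq_sph: "y = y'" if xy: "(x, y) \<in> G" "(x, y') \<in> G" "x \<in> sphere 0 1" for x y y'
  proof (rule ccontr)
    assume ne: "y \<noteq> y'"
    have Wxy: "(x, y) \<in> W" "(x, y') \<in> W" using xy GW by auto
    have fib: "v = y \<or> v = - y" if "(x, v) \<in> G" for v
      using GW that Wxy rD(3)[of y v] by (auto simp: W_def)
    have y': "y' = - y" using fib[OF xy(2)] ne by auto
    have "q x \<in> r ` sphere 0 1" using boundary xy(3) by auto
    then have ysph: "norm y = 1" using antipodal_disc_interior[OF r, of y] Wxy by (auto simp: W_def)
    define N where "N = {v. dist v y < 1 / 2}"
    define N' where "N' = {v. dist v y' < 1 / 2}"
    have N: "open N" "open N'" "N \<inter> N' = {}" "y \<in> N" "y' \<in> N'"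
    proof -
      show "open N" "open N'" unfolding N_def N'_def by (intro open_Collect_less continuous_intros)+
      show "y \<in> N" "y' \<in> N'" by (auto simp: N_def N'_def)
      have "dist y y' = norm (2 *\<^sub>R y)" by (simp add: dist_norm y' scaleR_2)
      then have "dist y y' = 2" using ysph by simp
      then show "N \<inter> N' = {}" unfolding N_def N'_def
        using dist_triangle_half_r[of _ y 1 y'] by (force simp: dist_commute)
    qed
    \<comment> \<open>the points over which the graph leaves the two neighbourhoods; they form a compact set without \<open>x\<close>\<close>
    define B where "B = fst ` (G \<inter> UNIV \<times> - (N \<union> N'))"
    have "compact (G \<inter> UNIV \<times> - (N \<union> N'))"
      using \<open>compact G\<close> N by (intro compact_Int_closed closed_Times) auto
    then have "closed B" unfolding B_def
      by (intro compact_imp_closed compact_continuous_image continuous_intros)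
    moreover have "x \<notin> B" unfolding B_def using fib N(4,5) y' by fastforce
    ultimately obtain e where e: "0 < e" "ball x e \<inter> B = {}"
      by (metis ComplI disjoint_eq_subset_Compl open_Compl open_contains_ball)
    let ?D = "ball 0 1 \<inter> ball x e"
    have sub: "k ` ?D \<subseteq> N \<union> N'"
    proof
      fix v assume "v \<in> k ` ?D"
      then obtain u where u: "u \<in> ball 0 1" "u \<in> ball x e" "v = k u" by blast
      then have "(u, v) \<in> G" using k Gball by blast
      then show "v \<in> N \<union> N'" using e u unfolding B_def by (force intro: rev_image_eqI)
    qed
    have "connected (k ` ?D)"
      using contk by (intro connected_continuous_image convex_connected convex_Int convex_ball)
        (auto intro: continuous_on_subset)
    then have "N \<inter> k ` ?D = {} \<or> N' \<inter> k ` ?D = {}"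
      using connectedD[of "k ` ?D" N N'] N sub by blast
    moreover have "M \<inter> k ` ?D \<noteq> {}" if "(x, v) \<in> G" "v \<in> M" "open M" for v M
    proof -
      have "open (ball x e \<times> M)" using that by (intro open_Times) auto
      moreover have "(x, v) \<in> ball x e \<times> M" using e that by auto
      ultimately have "(ball x e \<times> M) \<inter> (W \<inter> ball 0 1 \<times> UNIV) \<noteq> {}"
        using that(1) unfolding G_def closure_iff_nhds_not_empty by blast
      then obtain u w where "u \<in> ball x e" "w \<in> M" "(u, w) \<in> W" "u \<in> ball 0 1" by auto
      then have "w \<in> M \<inter> k ` ?D" using k by blast
      then show ?thesis by blast
    qed
    ultimately show False using xy N by blast
  qed
  have uniq: "y = y'" if "(x, y) \<in> G" "(x, y') \<in> G" for x y y'
  proof (cases "x \<in> ball 0 1")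
    case True then show ?thesis using uniq_int GW that by blast
  next
    case False
    then have "x \<in> sphere 0 1" using that GW by (auto simp: W_def)
    then show ?thesis using uniq_sph that by blast
  qed
  define h where "h x = (THE y. (x, y) \<in> G)" for x
  have h: "(x, y) \<in> G \<longleftrightarrow> y = h x" if "x \<in> cball 0 1" for x y
    using ex[OF that] uniq[of x] unfolding h_def by (metis (no_types, lifting) the_equality)
  have hW: "(x, h x) \<in> W" if "x \<in> cball 0 1" for x using h[OF that] GW by blast
  show ?thesis
  proof
    show hc: "h ` cball 0 1 \<subseteq> cball 0 1" using hW by (auto simp: W_def)
    have "(\<lambda>x. (x, h x)) ` cball 0 1 = G"
      using h GW by (auto simp: W_def)
    then show "continuous_on (cball 0 1) h"
      using \<open>compact G\<close> hc by (intro continuous_from_closed_graph[OF compact_cball[of 0 1]])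
        (auto simp: compact_imp_closed)
    show "h ` ball 0 1 \<subseteq> ball 0 1" using hW interior by (meson ball_subset_cball image_subsetI subsetD)
    show "r (h x) = q x" if "x \<in> cball 0 1" for x using hW[OF that] by (auto simp: W_def)
  qed
qed

text \<open>The extensions obtained in both directions are inverse to each other on the open discs, and therefore on the
  closed ones.\<close>

lemma antipodal_discs_homeomorphic:
  fixes q r :: "complex \<Rightarrow> 'a"
  assumes Y: "Hausdorff_space Y" and q: "antipodal_disc Y q" and r: "antipodal_disc Y r"
    and boundary: "q ` sphere 0 1 = r ` sphere 0 1"
  obtains h where "homeomorphic_map (top_of_set (cball 0 1)) (top_of_set (cball 0 1)) h"
    "\<And>x. x \<in> cball 0 1 \<Longrightarrow> r (h x) = q x"
proof -
  obtain h where h: "continuous_on (cball 0 1) h" "h ` cball 0 1 \<subseteq> cball 0 1"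
    "h ` ball 0 1 \<subseteq> ball 0 1" "\<And>x. x \<in> cball 0 1 \<Longrightarrow> r (h x) = q x"
    using disc_lift_exists[OF Y q r boundary] by blast
  obtain k where k: "continuous_on (cball 0 1) k" "k ` cball 0 1 \<subseteq> cball 0 1"
    "k ` ball 0 1 \<subseteq> ball 0 1" "\<And>x. x \<in> cball 0 1 \<Longrightarrow> q (k x) = r x"
    using disc_lift_exists[OF Y r q boundary[symmetric]] by blast
  have inv: "g (f x) = x" if f: "continuous_on (cball 0 1) f" "f ` cball 0 1 \<subseteq> cball 0 1"
    and g: "continuous_on (cball 0 1) g" "g ` cball 0 1 \<subseteq> cball 0 1"
    and s: "antipodal_disc Y s" "\<And>x. x \<in> cball 0 1 \<Longrightarrow> s (g (f x)) = s x" and x: "x \<in> cball 0 1"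
    for f g :: "complex \<Rightarrow> complex" and s x
  proof -
    have "continuous_on (closure (ball 0 1)) (\<lambda>x. g (f x) - x)"
      using f g by (auto intro!: continuous_intros continuous_on_compose2[OF g(1) f(1)])
    moreover have "g (f x) - x = 0" if "x \<in> ball 0 1" for x
    proof -
      have "g (f x) \<in> cball 0 1" "x \<in> cball 0 1" using f g that by (auto simp: image_subset_iff)
      then show ?thesis using antipodal_discD(3)[OF s(1), of x "g (f x)"] s(2)[of x] that by auto
    qed
    moreover have "x \<in> closure (ball 0 1)" using x by simp
    ultimately have "g (f x) - x = 0" by (rule continuous_constant_on_closure)
    then show ?thesis by simp
  qed
  have "k (h x) = x" if "x \<in> cball 0 1" for x
    by (rule inv[OF h(1,2) k(1,2) q _ that]) (use h k in \<open>auto simp: image_subset_iff\<close>)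
  moreover have "h (k x) = x" if "x \<in> cball 0 1" for x
    by (rule inv[OF k(1,2) h(1,2) r _ that]) (use h k in \<open>auto simp: image_subset_iff\<close>)
  ultimately have "homeomorphic_maps (top_of_set (cball 0 1)) (top_of_set (cball 0 1)) h k"
    using h k by (auto simp: homeomorphic_maps_def image_subset_iff)
  then show ?thesis using that h(4) homeomorphic_maps_map by blast
qed

section \<open>Simple closed curves in a graph\<close>

text \<open>The two properties of a simple closed curve that are used. They pass to the image of a circle under an
  identification of antipodal points without choosing a parametrisation of this image.\<close>

definition punctured_connected :: "'a topology \<Rightarrow> 'a set \<Rightarrow> bool" where
  "punctured_connected Y \<Gamma> \<longleftrightarrow> infinite \<Gamma> \<and> (\<forall>x\<in>\<Gamma>. connectedin Y (\<Gamma> - {x}))"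

lemma connectedin_closed_cover:
  assumes "connectedin X C" "closedin X A" "closedin X B" "C \<subseteq> A \<union> B" "A \<inter> B \<inter> C = {}"
  shows "A \<inter> C = {} \<or> B \<inter> C = {}"
  using assms unfolding connectedin_closedin by blast

lemma punctured_connected_split:
  assumes "punctured_connected Y \<Gamma>" "x \<in> \<Gamma>" "closedin Y A" "closedin Y B" "\<Gamma> \<subseteq> A \<union> B" "A \<inter> B \<inter> \<Gamma> \<subseteq> {x}"
  shows "\<Gamma> \<inter> A \<subseteq> {x} \<or> \<Gamma> \<inter> B \<subseteq> {x}"
proof -
  have "connectedin Y (\<Gamma> - {x})" using assms(1,2) unfolding punctured_connected_def by blast
  from connectedin_closed_cover[OF this assms(3,4)] show ?thesis using assms(5,6) by blast
qed

text \<open>The end points may coincide, but they do not lie in the interior of the arc.\<close>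

definition arc_or_loop :: "'a topology \<Rightarrow> (real \<Rightarrow> 'a) \<Rightarrow> bool" where
  "arc_or_loop Y g \<longleftrightarrow> continuous_map (top_of_set {0..1}) Y g \<and>
     (\<forall>s\<in>{0<..<1}. \<forall>t\<in>{0..1}. g s = g t \<longrightarrow> s = t)"

context
  fixes Y :: "'a topology"
  assumes Y: "Hausdorff_space Y"
begin

lemma arc_or_loop_closedin:
  assumes "arc_or_loop Y g" "0 \<le> a" "b \<le> 1"
  shows "closedin Y (g ` {a..b})"
proof -
  have "compactin (top_of_set {0..1}) {a..b}"
    using assms by (simp add: compactin_subtopology)
  then show ?thesis
    using assms image_compactin compactin_imp_closedin[OF Y] unfolding arc_or_loop_def by blast
qed

lemma arc_or_loop_reverse: "arc_or_loop Y g \<Longrightarrow> arc_or_loop Y (\<lambda>t. g (1 - t))"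
proof -
  assume g: "arc_or_loop Y g"
  have "continuous_map (top_of_set {0..1}) (top_of_set {0..1::real}) (\<lambda>t. 1 - t)"
    by (auto intro!: continuous_intros)
  then have "continuous_map (top_of_set {0..1}) Y (g \<circ> (\<lambda>t. 1 - t))"
    using g unfolding arc_or_loop_def by (meson continuous_map_compose)
  moreover have "s = t" if "s \<in> {0<..<1}" "t \<in> {0..1}" "g (1 - s) = g (1 - t)" for s t
    using g that unfolding arc_or_loop_def by (force dest: bspec[of _ _ "1 - s"] bspec[of _ _ "1 - t"])
  ultimately show ?thesis unfolding arc_or_loop_def by (simp add: o_def)
qed

lemma reverse_image: "(\<lambda>t::real. g (1 - t)) ` {0..1} = g ` {0..1}"
  "(\<lambda>t::real. g (1 - t)) ` {0<..<1} = g ` {0<..<1}"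
proof -
  have "(\<lambda>t::real. 1 - t) ` {0..1} = {0..1}" by simp
  moreover have "(\<lambda>t::real. 1 - t) ` {0<..<1} = {0<..<1}"
  proof (intro equalityI subsetI)
    fix t :: real assume "t \<in> {0<..<1}"
    then show "t \<in> (\<lambda>t::real. 1 - t) ` {0<..<1}" by (intro image_eqI[of _ _ "1 - t"]) auto
  qed auto
  ultimately show "(\<lambda>t::real. g (1 - t)) ` {0..1} = g ` {0..1}"
    "(\<lambda>t::real. g (1 - t)) ` {0<..<1} = g ` {0<..<1}" by (metis image_image)+
qed

text \<open>A point of the curve between two others on the arc would separate the curve.\<close>

lemma not_in_open_arc:
  assumes \<Gamma>: "punctured_connected Y \<Gamma>" and g: "arc_or_loop Y g" and sub: "\<Gamma> \<subseteq> g ` {0<..<1}"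
  shows False
proof -
  have inj: "\<And>s t. s \<in> {0<..<1} \<Longrightarrow> t \<in> {0..1} \<Longrightarrow> g s = g t \<Longrightarrow> s = t"
    using g unfolding arc_or_loop_def by blast
  define I where "I = {s \<in> {0<..<1}. g s \<in> \<Gamma>}"
  have \<Gamma>I: "\<Gamma> = g ` I" using sub unfolding I_def by blast
  then have inf: "infinite I" using \<Gamma> unfolding punctured_connected_def by auto
  obtain a where a: "a \<in> I" using inf infinite_imp_nonempty by blast
  have "infinite (I - {a})" using inf by simp
  then obtain b where b: "b \<in> I - {a}" using infinite_imp_nonempty by blast
  have "infinite (I - {a, b})" using inf by simp
  then obtain c where c: "c \<in> I - {a, b}" using infinite_imp_nonempty by blast
  have "\<exists>x y z. x \<in> I \<and> y \<in> I \<and> z \<in> I \<and> x < y \<and> y < z"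
    using a b c by (metis Diff_iff insertCI linorder_neqE_linordered_idom)
  then obtain x y z where xyz: "x \<in> I" "y \<in> I" "z \<in> I" "x < y" "y < z" by blast
  have I01: "\<And>s. s \<in> I \<Longrightarrow> 0 < s \<and> s < 1" by (auto simp: I_def)
  have "\<Gamma> \<inter> g ` {0..y} \<subseteq> {g y} \<or> \<Gamma> \<inter> g ` {y..1} \<subseteq> {g y}"
  proof (rule punctured_connected_split[OF \<Gamma>])
    show "g y \<in> \<Gamma>" using xyz by (auto simp: I_def)
    show "closedin Y (g ` {0..y})" "closedin Y (g ` {y..1})"
      using arc_or_loop_closedin[OF g] I01[OF xyz(2)] by auto
    show "\<Gamma> \<subseteq> g ` {0..y} \<union> g ` {y..1}"
      using sub by force
    show "g ` {0..y} \<inter> g ` {y..1} \<inter> \<Gamma> \<subseteq> {g y}"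
    proof
      fix v assume "v \<in> g ` {0..y} \<inter> g ` {y..1} \<inter> \<Gamma>"
      then obtain s t u where s: "v = g s" "s \<in> {0..y}" and t: "v = g t" "t \<in> {y..1}"
        and u: "v = g u" "u \<in> {0<..<1}"
        using sub by blast
      have "u = s" "u = t"
        using inj[OF u(2), of s] inj[OF u(2), of t] s t u I01[OF xyz(2)] by auto
      then have "s = y" using s t by auto
      then show "v \<in> {g y}" using s by simp
    qed
  qed
  moreover have "x \<in> {0..y}" "z \<in> {y..1}" using xyz I01[of x] I01[of z] by auto
  then have "g x \<in> \<Gamma> \<inter> g ` {0..y}" "g z \<in> \<Gamma> \<inter> g ` {y..1}"
    using xyz(1,3) \<Gamma>I by blast+
  moreover have "g x \<noteq> g y" "g z \<noteq> g y"
    using inj[of x y] inj[of z y] xyz I01[of x] I01[of y] I01[of z] by auto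
  ultimately show False by blast
qed

text \<open>Let \<open>g u\<close> be missed and \<open>g x\<close> be met by the curve. Removing \<open>g x\<close>
  separates the part of the curve between \<open>u\<close> and \<open>x\<close> from the rest, so one of the two
  parts is empty. If it is the rest, then the curve lies in an open arc. Otherwise \<open>g x\<close> is the
  only point met above \<open>u\<close>; then it is isolated in the curve, which is again impossible. The set
  \<open>H\<close> is the remaining part of the graph.\<close>

lemma missing_point_above:
  assumes \<Gamma>: "punctured_connected Y \<Gamma>" and g: "arc_or_loop Y g"
    and H: "closedin Y H" "H \<inter> g ` {0<..<1} = {}" and sub: "\<Gamma> \<subseteq> g ` {0..1} \<union> H"
    and u: "0 \<le> u" "u < x" "x < 1" "g u \<notin> \<Gamma>" "g x \<in> \<Gamma>"
  shows False
proof -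
  have inj: "\<And>s t. s \<in> {0<..<1} \<Longrightarrow> t \<in> {0..1} \<Longrightarrow> g s = g t \<Longrightarrow> s = t"
    using g unfolding arc_or_loop_def by blast
  have cl: "\<And>a b. 0 \<le> a \<Longrightarrow> b \<le> 1 \<Longrightarrow> closedin Y (g ` {a..b})" using arc_or_loop_closedin[OF g] by blast
  have key: "\<Gamma> \<inter> g ` {u..y} \<subseteq> {g y}" if y: "u < y" "y < 1" "g y \<in> \<Gamma>" for y
  proof -
    let ?B = "g ` {0..u} \<union> g ` {y..1} \<union> H"
    have AB: "g ` {u..y} \<inter> ?B \<inter> \<Gamma> \<subseteq> {g y}"
    proof
      fix v assume v: "v \<in> g ` {u..y} \<inter> ?B \<inter> \<Gamma>"
      then obtain s where s: "v = g s" "u \<le> s" "s \<le> y" by (meson IntD1 atLeastAtMost_iff imageE)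
      then have su: "s \<noteq> u" using v u(4) by auto
      then have s01: "s \<in> {0<..<1}" using s u y by auto
      then have "v \<notin> H" using H(2) s by blast
      then obtain t where t: "v = g t" "t \<in> {0..u} \<union> {y..1}" using v by auto
      then have "s = t" using inj[OF s01, of t] s y u by auto
      then show "v \<in> {g y}" using t s su by auto
    qed
    have "\<Gamma> \<inter> g ` {u..y} \<subseteq> {g y} \<or> \<Gamma> \<inter> ?B \<subseteq> {g y}"
    proof (rule punctured_connected_split[OF \<Gamma> y(3) _ _ _ AB])
      show "closedin Y (g ` {u..y})" "closedin Y ?B"
        using u y H by (auto intro!: cl closedin_Un)
      have "{0..1} \<subseteq> {0..u} \<union> {u..y} \<union> {y..1}" using u y by auto
      then show "\<Gamma> \<subseteq> g ` {u..y} \<union> ?B" using sub by blast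
    qed
    moreover have False if B: "\<Gamma> \<inter> ?B \<subseteq> {g y}"
    proof (rule not_in_open_arc[OF \<Gamma> g])
      show "\<Gamma> \<subseteq> g ` {0<..<1}"
      proof
        fix v assume v: "v \<in> \<Gamma>"
        show "v \<in> g ` {0<..<1}"
        proof (cases "v = g y")
          case True then show ?thesis using y u by auto
        next
          case False
          then have "v \<notin> ?B" using B v by blast
          then obtain s where "v = g s" "s \<in> {0..1}" "s \<notin> {0..u}" "s \<notin> {y..1}" using v sub by blast
          then show ?thesis using u y by auto
        qed
      qed
    qed
    ultimately show ?thesis by blast
  qed
  have only: "y = x" if y: "u < y" "y < 1" "g y \<in> \<Gamma>" for y
  proof (rule ccontr)
    assume "y \<noteq> x"
    then consider "y < x" | "x < y" by linarith
    then show False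
    proof cases
      case 1
      then have "g y = g x" using key[of x] y u by auto
      then show False using inj[of y x] y u 1 by auto
    next
      case 2
      then have "g x = g y" using key[of y] y u by auto
      then show False using inj[of x y] y u 2 by auto
    qed
  qed
  have "infinite (\<Gamma> - {g x})" using \<Gamma> unfolding punctured_connected_def by simp
  then obtain w where w: "w \<in> \<Gamma> - {g x}" using infinite_imp_nonempty by blast
  \<comment> \<open>\<open>{1..1}\<close> keeps the upper end point, which may belong to the curve\<close>
  let ?B = "g ` {0..u} \<union> g ` {1..1} \<union> H"
  have xB: "g x \<notin> ?B"
  proof
    assume "g x \<in> ?B"
    moreover have "g x \<notin> H" using H(2) u by fastforce
    ultimately obtain t where "g x = g t" "t \<in> {0..u} \<union> {1..1}" by blast
    then show False using inj[of x t] u by auto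
  qed
  have split: "\<Gamma> \<inter> {g x} \<subseteq> {w} \<or> \<Gamma> \<inter> ?B \<subseteq> {w}"
  proof (rule punctured_connected_split[OF \<Gamma>])
    show "w \<in> \<Gamma>" using w by simp
    have "{g x} = g ` {x..x}" by simp
    then show "closedin Y {g x}" using cl[of x x] u by simp
    show "closedin Y ?B" using u H by (intro cl closedin_Un) auto
    show "{g x} \<inter> ?B \<inter> \<Gamma> \<subseteq> {w}" using xB by blast
    show "\<Gamma> \<subseteq> {g x} \<union> ?B"
    proof
      fix v assume v: "v \<in> \<Gamma>"
      show "v \<in> {g x} \<union> ?B"
      proof (cases "v \<in> H")
        case False
        then obtain s where s: "v = g s" "s \<in> {0..1}" using v sub by auto
        consider "s \<le> u" | "s = 1" | "u < s" "s < 1" using s by force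
        then show ?thesis
        proof cases
          case 3
          then have "s = x" using only[of s] v s by simp
          then show ?thesis using s by simp
        qed (use s in auto)
      qed simp
    qed
  qed
  moreover have "\<Gamma> \<subseteq> {g x, w}" if "\<Gamma> \<inter> ?B \<subseteq> {w}"
  proof
    fix v assume v: "v \<in> \<Gamma>"
    show "v \<in> {g x, w}"
    proof (cases "v \<in> ?B")
      case False
      then obtain s where s: "v = g s" "s \<in> {0..1}" "s \<notin> {0..u}" "s \<notin> {1..1}" using v sub by blast
      then show ?thesis using only[of s] v by auto
    qed (use that v in blast)
  qed
  moreover have "infinite \<Gamma>" using \<Gamma> unfolding punctured_connected_def by simp
  moreover have "\<not> \<Gamma> \<inter> {g x} \<subseteq> {w}" using w u(5) by auto
  ultimately show False using finite_subset[of \<Gamma> "{g x, w}"] by auto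
qed

lemma arc_contained_or_avoided:
  assumes \<Gamma>: "punctured_connected Y \<Gamma>" and g: "arc_or_loop Y g"
    and H: "closedin Y H" "H \<inter> g ` {0<..<1} = {}" and sub: "\<Gamma> \<subseteq> g ` {0..1} \<union> H"
  shows "g ` {0..1} \<subseteq> \<Gamma> \<or> \<Gamma> \<inter> g ` {0<..<1} = {}"
proof (rule ccontr)
  assume "\<not> ?thesis"
  then obtain u x where u: "u \<in> {0..1}" "g u \<notin> \<Gamma>" and x: "x \<in> {0<..<1}" "g x \<in> \<Gamma>" by blast
  have "u \<noteq> x" using u x by blast
  then consider "u < x" | "x < u" by linarith
  then show False
  proof cases
    case 1
    then show False using missing_point_above[OF \<Gamma> g H sub, of u x] u x by auto
  next
    case 2
    show False
      by (rule missing_point_above[OF \<Gamma> arc_or_loop_reverse[OF g] H(1), of "1 - u" "1 - x"])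
        (use u x 2 H(2) sub reverse_image[of g] in auto)
  qed
qed

text \<open>Here \<open>g 0\<close> is a free end of the graph. If the curve ran through the whole arc, then removing the
  midpoint would cut off the free end.\<close>

lemma dead_end_avoided:
  assumes \<Gamma>: "punctured_connected Y \<Gamma>" and g: "arc_or_loop Y g"
    and H: "closedin Y H" "H \<inter> g ` {0..<1} = {}" and sub: "\<Gamma> \<subseteq> g ` {0..1} \<union> H" and ends: "g 0 \<noteq> g 1"
  shows "\<Gamma> \<inter> g ` {0<..<1} = {}"
proof (rule ccontr)
  assume ne: "\<not> ?thesis"
  have inj: "\<And>s t. s \<in> {0<..<1} \<Longrightarrow> t \<in> {0..1} \<Longrightarrow> g s = g t \<Longrightarrow> s = t"
    using g unfolding arc_or_loop_def by blast
  have H': "H \<inter> g ` {0<..<1} = {}" using H(2) by fastforce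
  have all: "g ` {0..1} \<subseteq> \<Gamma>" using arc_contained_or_avoided[OF \<Gamma> g H(1) H' sub] ne by blast
  let ?m = "g (1 / 2)"
  have m: "?m \<in> \<Gamma>" using all by auto
  have "\<Gamma> \<inter> g ` {0..1 / 2} \<subseteq> {?m} \<or> \<Gamma> \<inter> (g ` {1 / 2..1} \<union> H) \<subseteq> {?m}"
  proof (rule punctured_connected_split[OF \<Gamma> m])
    show "closedin Y (g ` {0..1 / 2})" "closedin Y (g ` {1 / 2..1} \<union> H)"
      using arc_or_loop_closedin[OF g] H by (auto intro!: closedin_Un)
    have "{0..1} = {0..1 / 2} \<union> {1 / 2..1::real}" by auto
    then show "\<Gamma> \<subseteq> g ` {0..1 / 2} \<union> (g ` {1 / 2..1} \<union> H)" using sub by auto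
    show "g ` {0..1 / 2} \<inter> (g ` {1 / 2..1} \<union> H) \<inter> \<Gamma> \<subseteq> {?m}"
    proof
      fix v assume v: "v \<in> g ` {0..1 / 2} \<inter> (g ` {1 / 2..1} \<union> H) \<inter> \<Gamma>"
      then obtain s where s: "v = g s" "s \<in> {0..1 / 2}" by blast
      then have "v \<notin> H" using H(2) by fastforce
      then obtain t where t: "v = g t" "t \<in> {1 / 2..1}" using v by auto
      have "s \<noteq> 0 \<or> t \<noteq> 1" using s t ends by auto
      then have "s = t" using inj[of s t] inj[of t s] s t by auto
      then have "t = 1 / 2" using s t by auto
      then show "v \<in> {?m}" using t(1) by blast
    qed
  qed
  moreover have "g 0 \<in> \<Gamma> \<inter> g ` {0..1 / 2}" "g 1 \<in> \<Gamma> \<inter> (g ` {1 / 2..1} \<union> H)" using all by auto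
  moreover have "g 0 \<noteq> ?m" "g 1 \<noteq> ?m" using inj[of "1/2" 0] inj[of "1/2" 1] by auto
  ultimately show False by blast
qed

text \<open>Removing the base point of the loop separates the loop from the rest of the curve.\<close>

lemma contained_loop_is_all:
  assumes \<Gamma>: "punctured_connected Y \<Gamma>" and g: "arc_or_loop Y g"
    and H: "closedin Y H" "H \<inter> g ` {0<..<1} = {}" and sub: "\<Gamma> \<subseteq> g ` {0..1} \<union> H"
    and loop: "g 0 = g 1" and all: "g ` {0..1} \<subseteq> \<Gamma>"
  shows "\<Gamma> = g ` {0..1}"
proof -
  have inj: "\<And>s t. s \<in> {0<..<1} \<Longrightarrow> t \<in> {0..1} \<Longrightarrow> g s = g t \<Longrightarrow> s = t"
    using g unfolding arc_or_loop_def by blast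
  have g0: "g 0 \<in> \<Gamma>" using all by auto
  have "\<Gamma> \<inter> g ` {0..1} \<subseteq> {g 0} \<or> \<Gamma> \<inter> H \<subseteq> {g 0}"
  proof (rule punctured_connected_split[OF \<Gamma> g0])
    show "closedin Y (g ` {0..1})" using arc_or_loop_closedin[OF g] by auto
    show "g ` {0..1} \<inter> H \<inter> \<Gamma> \<subseteq> {g 0}"
    proof
      fix v assume v: "v \<in> g ` {0..1} \<inter> H \<inter> \<Gamma>"
      then obtain s where s: "v = g s" "s \<in> {0..1}" by auto
      then have "s \<notin> {0<..<1}" using v H(2) by blast
      then have "s = 0 \<or> s = 1" using s by auto
      then show "v \<in> {g 0}" using s loop by auto
    qed
  qed (use H sub in auto)
  moreover have "g (1 / 2) \<in> \<Gamma> \<inter> g ` {0..1}" "g (1 / 2) \<noteq> g 0" using all inj[of "1/2" 0] by auto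
  ultimately have "\<Gamma> \<inter> H \<subseteq> {g 0}" by blast
  then show ?thesis using sub all by force
qed

text \<open>If the first side is avoided, then the two others form a path, and its sides are dead ends that the curve has to
  avoid one after the other.\<close>

lemma triangle_side_contained:
  assumes \<Gamma>: "punctured_connected Y \<Gamma>"
    and g: "arc_or_loop Y g1" "arc_or_loop Y g2" "arc_or_loop Y g3"
    and joins: "g1 1 = g2 0" "g2 1 = g3 0" "g3 1 = g1 0"
    and corners: "g1 0 \<noteq> g2 0" "g2 0 \<noteq> g3 0" "g3 0 \<noteq> g1 0"
    and disj: "g2 ` {0..1} \<inter> g1 ` {0<..<1} = {}" "g3 ` {0..1} \<inter> g1 ` {0<..<1} = {}"
      "g3 ` {0..1} \<inter> g2 ` {0<..<1} = {}" "g2 ` {0..1} \<inter> g3 ` {0<..<1} = {}"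
    and sub: "\<Gamma> \<subseteq> g1 ` {0..1} \<union> g2 ` {0..1} \<union> g3 ` {0..1}"
  shows "g1 ` {0..1} \<subseteq> \<Gamma>"
proof (rule ccontr)
  assume no: "\<not> ?thesis"
  have cl: "closedin Y (g2 ` {a..b})" "closedin Y (g3 ` {a..b})" if "0 \<le> a" "b \<le> 1" for a b
    using arc_or_loop_closedin[OF g(2) that] arc_or_loop_closedin[OF g(3) that] by auto
  have split: "g ` {0..1} = insert (g 0) (insert (g 1) (g ` {0<..<1}))" for g :: "real \<Rightarrow> 'a"
  proof -
    have "{0..1} = insert 0 (insert 1 {0<..<1::real})" by auto
    then show ?thesis by (metis image_insert)
  qed
  have "\<Gamma> \<inter> g1 ` {0<..<1} = {}"
  proof -
    have "(g2 ` {0..1} \<union> g3 ` {0..1}) \<inter> g1 ` {0<..<1} = {}" using disj(1,2) by (simp add: Int_Un_distrib2)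
    moreover have "\<Gamma> \<subseteq> g1 ` {0..1} \<union> (g2 ` {0..1} \<union> g3 ` {0..1})" using sub by (simp add: Un_assoc)
    ultimately show ?thesis
      using arc_contained_or_avoided[OF \<Gamma> g(1) closedin_Un[OF cl(1)[of 0 1] cl(2)[of 0 1]]] no by simp
  qed
  then have sub2: "\<Gamma> \<subseteq> g2 ` {0..1} \<union> g3 ` {0..1}"
    using sub joins unfolding split by auto
  have "g2 0 \<notin> g3 ` {0..1}" using disj(4) corners joins unfolding split[of g3] split[of g2] by auto
  then have H2: "g3 ` {0..1} \<inter> g2 ` {0..<1} = {}"
  proof -
    have "{0..<1} = insert 0 {0<..<1::real}" by auto
    then show ?thesis using disj(3) \<open>g2 0 \<notin> g3 ` {0..1}\<close> by simp
  qed
  have "\<Gamma> \<inter> g2 ` {0<..<1} = {}"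
    using dead_end_avoided[OF \<Gamma> g(2) cl(2) H2 sub2] corners joins by simp
  then have sub3: "\<Gamma> \<subseteq> g3 ` {0..1} \<union> g2 ` {0..0}"
    using sub2 joins unfolding split by auto
  have H3: "g2 ` {0..0} \<inter> g3 ` {0..<1} = {}"
    using \<open>g2 0 \<notin> g3 ` {0..1}\<close> by auto
  have "\<Gamma> \<inter> g3 ` {0<..<1} = {}"
    using dead_end_avoided[OF \<Gamma> g(3) cl(1) H3 sub3] corners joins by simp
  then have "\<Gamma> \<subseteq> {g2 0, g3 0, g3 1}" using sub3 unfolding split by auto
  then show False using \<Gamma> finite_subset unfolding punctured_connected_def by blast
qed

end

lemma connectedin_half_circle: "connectedin (top_of_set (cball 0 1)) {v \<in> sphere 0 1. 0 < Re (v * cnj w)}"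
  if w: "w \<in> sphere 0 1" for w :: complex
proof -
  have eq: "{v \<in> sphere 0 1. 0 < Re (v * cnj w)} = (\<lambda>a. w * cis a) ` {- (pi / 2)<..<pi / 2}"
  proof (intro set_eqI iffI)
    fix v assume "v \<in> {v \<in> sphere 0 1. 0 < Re (v * cnj w)}"
    then have v: "norm v = 1" "0 < Re (v * cnj w)" by auto
    define u where "u = v * cnj w"
    have u: "norm u = 1" "0 < Re u" using v w by (auto simp: u_def norm_mult)
    have "u = cis (Arg u)" using u rcis_cmod_Arg[of u] by (simp add: rcis_def)
    moreover have "\<bar>Arg u\<bar> < pi / 2" using u Arg_Re_pos by blast
    moreover have "w * cnj w = 1" using complex_norm_square[of w] w by simp
    then have "v = w * u" unfolding u_def by (simp add: mult.assoc mult.left_commute)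
    ultimately show "v \<in> (\<lambda>a. w * cis a) ` {- (pi / 2)<..<pi / 2}"
      by (intro image_eqI[of _ _ "Arg u"]) (auto simp: abs_less_iff)
  next
    fix v assume "v \<in> (\<lambda>a. w * cis a) ` {- (pi / 2)<..<pi / 2}"
    then obtain a where a: "v = w * cis a" "a \<in> {- (pi / 2)<..<pi / 2}" by blast
    have "w * cnj w = 1" using complex_norm_square[of w] w by simp
    then have "v * cnj w = cis a" using a by (simp add: mult.commute mult.left_commute)
    then have "0 < Re (v * cnj w)" using a(2) cos_gt_zero_pi[of a] by simp
    moreover have "v \<in> sphere 0 1" using a w by (simp add: norm_mult)
    ultimately show "v \<in> {v \<in> sphere 0 1. 0 < Re (v * cnj w)}" by blast
  qed
  have "connected ((\<lambda>a. w * cis a) ` {- (pi / 2)<..<pi / 2})"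
    by (intro connected_continuous_image continuous_intros) auto
  then show ?thesis unfolding eq[symmetric] by (auto simp: connectedin_subtopology)
qed

text \<open>The boundary circle minus a pair of antipodal points is mapped to the image of one of the two remaining open
  half circles.\<close>

lemma antipodal_disc_boundary_curve:
  assumes q: "antipodal_disc Y q"
  shows "punctured_connected Y (q ` sphere 0 1)" "connectedin Y (topspace Y - q ` sphere 0 1)"
proof -
  note qD = antipodal_discD[OF q]
  have "topspace Y - q ` sphere 0 1 = q ` ball 0 1"
  proof -
    have int: "q x \<notin> q ` sphere 0 1" if "x \<in> ball 0 1" for x
      using antipodal_disc_interior[OF q, of x] that by auto
    have "q ` sphere 0 1 \<inter> q ` ball 0 1 = {}"
    proof (rule equals0I)
      fix y assume "y \<in> q ` sphere 0 1 \<inter> q ` ball 0 1"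
      then obtain x where "x \<in> ball 0 1" "y = q x" "y \<in> q ` sphere 0 1" by (elim IntE imageE[of _ _ "ball 0 1"])
      then show False using int[of x] by simp
    qed
    moreover have "cball (0::complex) 1 = ball 0 1 \<union> sphere 0 1" by auto
    then have "topspace Y = q ` ball 0 1 \<union> q ` sphere 0 1" using qD(2) by (metis image_Un)
    ultimately show ?thesis by (simp add: Un_Diff Diff_triv Int_commute)
  qed
  moreover have "connectedin (top_of_set (cball 0 1)) (ball (0::complex) 1)"
    by (auto simp: connectedin_subtopology)
  ultimately show "connectedin Y (topspace Y - q ` sphere 0 1)"
    using connectedin_continuous_map_image[OF qD(1)] by simp
  have "infinite (q ` sphere 0 1)"
  proof
    assume fin: "finite (q ` sphere 0 1)"
    have "inj_on cis {0<..<1}"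
      by (rule inj_on_inverseI[of _ Arg]) (use pi_gt3 in \<open>auto intro!: Arg_cis\<close>)
    then have "infinite (cis ` {0<..<1})" by (simp add: finite_image_iff)
    moreover have "cis ` {0<..<1} \<subseteq> sphere 0 1" by auto
    ultimately have "infinite (sphere (0::complex) 1)" using finite_subset by blast
    from pigeonhole_infinite[OF this fin] obtain x
      where x: "x \<in> sphere 0 1" "infinite {a \<in> sphere 0 1. q a = q x}" by blast
    have "{a \<in> sphere 0 1. q a = q x} \<subseteq> {x, - x}"
    proof
      fix a assume "a \<in> {a \<in> sphere 0 1. q a = q x}"
      then show "a \<in> {x, - x}" using qD(3)[of x a] x(1) by auto
    qed
    then show False using x(2) finite_subset by blast
  qed
  moreover have "connectedin Y (q ` sphere 0 1 - {q z})" if z: "z \<in> sphere 0 1" for z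
  proof -
    have wz: "Re (z * cnj (\<i> * z)) = 0" by simp
    \<comment> \<open>the centre of a half circle that ends at \<open>\<plusminus>z\<close>\<close>
    let ?w = "\<i> * z"
    let ?h = "{v \<in> sphere 0 1. 0 < Re (v * cnj ?w)}"
    have eq: "q ` sphere 0 1 - {q z} = q ` ?h"
    proof (intro set_eqI iffI)
      fix y assume "y \<in> q ` sphere 0 1 - {q z}"
      then obtain v where v: "v \<in> sphere 0 1" "y = q v" "q v \<noteq> q z" by blast
      then have nz: "v \<noteq> z" "v \<noteq> - z" using qD(3)[of v z] z by auto
      have "Re (v * cnj ?w) \<noteq> 0"
      proof
        assume "Re (v * cnj ?w) = 0"
        then have im: "Im (v * cnj z) = 0" by (simp add: algebra_simps)
        have unit: "u = 1 \<or> u = -1" if "norm u = 1" "Im u = 0" for u :: complex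
          using that by (auto simp: cmod_def complex_eq_iff)
        have "norm (v * cnj z) = 1" using v z by (simp add: norm_mult)
        then have "v * cnj z = 1 \<or> v * cnj z = -1" using im by (rule unit)
        moreover have "cnj z * z = 1" using complex_norm_square[of z] z by (simp add: mult.commute)
        then have "v = (v * cnj z) * z" by (simp add: mult.assoc)
        ultimately have "v = 1 * z \<or> v = -1 * z" by metis
        then show False using nz by simp
      qed
      then consider "v \<in> ?h" | "- v \<in> ?h" using v by fastforce
      then show "y \<in> q ` ?h"
      proof cases
        case 2
        moreover have "q (- v) = y" using qD(3)[of v "- v"] v by auto
        ultimately show ?thesis by blast
      qed (use v in blast)
    next
      fix y assume "y \<in> q ` ?h"
      then obtain v where v: "v \<in> ?h" "y = q v" by blast
      have "v \<noteq> z" "v \<noteq> - z" using v(1) wz by auto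
      then have "q v \<noteq> q z" using qD(3)[of v z] v z by (auto simp: minus_equation_iff)
      moreover have "v \<in> sphere 0 1" using v(1) by blast
      ultimately show "y \<in> q ` sphere 0 1 - {q z}" unfolding v(2) by (intro DiffI imageI) simp_all
    qed
    have "?w \<in> sphere 0 1" using z by (simp add: norm_mult)
    from connectedin_continuous_map_image[OF qD(1) connectedin_half_circle[OF this]]
    show ?thesis unfolding eq .
  qed
  ultimately show "punctured_connected Y (q ` sphere 0 1)" unfolding punctured_connected_def by blast
qed

section \<open>Quotient spaces and the projective plane\<close>

lemma topspace_quotient_topology [simp]: "topspace (quotient_topology X R) = topspace X // R"
proof
  show "topspace (quotient_topology X R) \<subseteq> topspace X // R"
    using openin_topspace[of "quotient_topology X R"] unfolding openin_quotient_topology by blast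
  have "{x \<in> topspace X. R `` {x} \<in> topspace X // R} = topspace X" by (auto intro: quotientI)
  then have "openin (quotient_topology X R) (topspace X // R)"
    unfolding openin_quotient_topology by simp
  then show "topspace X // R \<subseteq> topspace (quotient_topology X R)" by (rule openin_subset)
qed

lemma continuous_map_quotient_class:
  "continuous_map X (quotient_topology X R) (\<lambda>x. R `` {x})"
  by (auto simp: continuous_map_def openin_quotient_topology intro: quotientI)

lemma continuous_map_from_quotient:
  assumes "continuous_map X Y (\<lambda>x. g (R `` {x}))"
  shows "continuous_map (quotient_topology X R) Y g"
  unfolding continuous_map_def
proof (intro conjI allI impI)
  show "g \<in> topspace (quotient_topology X R) \<rightarrow> topspace Y"
    using assms by (auto simp: continuous_map_def quotient_def Pi_iff)
  fix U assume "openin Y U"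
  then have "openin X {x \<in> topspace X. g (R `` {x}) \<in> U}"
    using assms by (simp add: continuous_map_def)
  moreover have "{x \<in> topspace X. R `` {x} \<in> {c \<in> topspace (quotient_topology X R). g c \<in> U}}
      = {x \<in> topspace X. g (R `` {x}) \<in> U}" by (auto intro: quotientI)
  ultimately show "openin (quotient_topology X R) {c \<in> topspace (quotient_topology X R). g c \<in> U}"
    unfolding openin_quotient_topology by auto
qed

lemma compact_space_quotient_topology:
  "compact_space X \<Longrightarrow> compact_space (quotient_topology X R)"
proof -
  assume "compact_space X"
  then have "compactin (quotient_topology X R) ((\<lambda>x. R `` {x}) ` topspace X)"
    using image_compactin continuous_map_quotient_class unfolding compact_space_def by blast
  moreover have "(\<lambda>x. R `` {x}) ` topspace X = topspace (quotient_topology X R)"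
    by (auto simp: quotient_def)
  ultimately show ?thesis unfolding compact_space_def by simp
qed

lemma compact_space_sum_topology:
  assumes "finite I" "\<And>i. i \<in> I \<Longrightarrow> compact_space (X i)"
  shows "compact_space (sum_topology X I)"
proof -
  have "compactin (sum_topology X I) (\<Union>i\<in>I. Pair i ` topspace (X i))"
    using assms by (intro compactin_Union[of "(\<lambda>i. Pair i ` topspace (X i)) ` I"])
      (auto simp: compact_space_def intro!: image_compactin continuous_map_component_injection)
  moreover have "(\<Union>i\<in>I. Pair i ` topspace (X i)) = topspace (sum_topology X I)" by auto
  ultimately show ?thesis unfolding compact_space_def by simp
qed

lemma continuous_map_from_sum_topology:
  assumes "\<And>i. i \<in> I \<Longrightarrow> continuous_map (X i) Y (g i)"
  shows "continuous_map (sum_topology X I) Y (\<lambda>(i, x). g i x)"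
  unfolding continuous_map_def
proof (intro conjI allI impI)
  show "(\<lambda>(i, x). g i x) \<in> topspace (sum_topology X I) \<rightarrow> topspace Y"
    using assms by (auto simp: continuous_map_def Pi_iff)
  fix U assume U: "openin Y U"
  have "openin (X i) {x. (i, x) \<in> {v \<in> topspace (sum_topology X I). (\<lambda>(i, x). g i x) v \<in> U}}" if i: "i \<in> I" for i
  proof -
    have "{x. (i, x) \<in> {v \<in> topspace (sum_topology X I). (\<lambda>(i, x). g i x) v \<in> U}} = {x \<in> topspace (X i). g i x \<in> U}"
      using i by auto
    then show ?thesis using assms[OF i] U by (simp add: continuous_map_def)
  qed
  then show "openin (sum_topology X I) {v \<in> topspace (sum_topology X I). (\<lambda>(i, x). g i x) v \<in> U}"
    unfolding openin_sum_topology by auto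
qed

text \<open>The classes of unit vectors \<open>x\<close> and \<open>y \<noteq> \<plusminus>x\<close> are separated by the
  continuous function \<open>u \<mapsto> \<bar>u \<bullet> x\<bar>\<close>, which is less than \<open>1\<close>
  at \<open>y\<close> by the Cauchy-Schwarz inequality.\<close>

lemma Hausdorff_RP2: "Hausdorff_space RP2"
  unfolding Hausdorff_space_def
proof (intro allI impI)
  define R :: "((real^3) \<times> (real^3)) set" where "R = {(x, y). y = x \<or> y = - x}"
  have Rx: "R `` {x} = {x, - x}" for x by (auto simp: R_def)
  have RP2: "RP2 = quotient_topology (top_of_set (sphere 0 1)) R" by (simp add: RP2_def R_def)
  fix c d assume cd: "c \<in> topspace RP2 \<and> d \<in> topspace RP2 \<and> c \<noteq> d"
  have top: "topspace RP2 = (\<lambda>x. {x, - x}) ` sphere 0 1" by (auto simp: RP2 quotient_def Rx)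
  obtain x where x: "x \<in> sphere 0 1" "c = {x, - x}" using cd unfolding top by blast
  obtain y where y: "y \<in> sphere 0 1" "d = {y, - y}" using cd unfolding top by blast
  define g where "g c = \<bar>(SOME u. u \<in> c) \<bullet> x\<bar>" for c
  have g: "g {u, - u} = \<bar>u \<bullet> x\<bar>" for u
  proof -
    have "(SOME v. v \<in> {u, - u}) \<in> {u, - u}" by (rule someI[of _ u]) simp
    then show ?thesis unfolding g_def by auto
  qed
  have "continuous_map (top_of_set (sphere 0 1)) euclideanreal (\<lambda>u. g (R `` {u}))"
    unfolding Rx g by (auto intro!: continuous_intros)
  then have cg: "continuous_map RP2 euclideanreal g"
    unfolding RP2 by (rule continuous_map_from_quotient)
  have gc: "g c = 1" using x by (simp add: g norm_eq_1)
  have "g d \<noteq> 1"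
  proof
    assume "g d = 1"
    then have "\<bar>y \<bullet> x\<bar> = norm y * norm x" using x y by (simp add: g)
    then have "norm y *\<^sub>R x = norm x *\<^sub>R y \<or> norm y *\<^sub>R x = - norm x *\<^sub>R y"
      unfolding norm_cauchy_schwarz_abs_eq .
    then show False using x y cd by auto
  qed
  moreover have "g d \<le> 1" using Cauchy_Schwarz_ineq2[of y x] x y by (simp add: g)
  ultimately have lt: "g d < g c" using gc by simp
  define m where "m = (g c + g d) / 2"
  have m: "g d < m" "m < g c" using lt by (auto simp: m_def)
  show "\<exists>U V. openin RP2 U \<and> openin RP2 V \<and> c \<in> U \<and> d \<in> V \<and> disjnt U V"
  proof (intro exI conjI)
    show "openin RP2 {w \<in> topspace RP2. g w \<in> {m<..}}" "openin RP2 {w \<in> topspace RP2. g w \<in> {..<m}}"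
      by (rule openin_continuous_map_preimage[OF cg]; simp)+
  qed (use m cd in \<open>auto simp: disjnt_def\<close>)
qed

section \<open>The gluing of the 2-cells along their sides\<close>

text \<open>The sides are reparametrised by the parameter on the arc on which they lie: then equally labelled sides are
  glued at equal parameters, and the orientations enter only where consecutive sides are compared. This works
  because \<open>arc_param\<close> is an involution.\<close>

definition side_point :: "surface \<Rightarrow> nat \<Rightarrow> nat \<Rightarrow> real \<Rightarrow> complex" where
  "side_point S f k s = polygon_side (length (word S f)) k (arc_param S f k s)"

definition along_arc :: "surface \<Rightarrow> nat \<Rightarrow> nat \<Rightarrow> bool" where
  "along_arc S f k = (case word S f ! k of (i, (X, b), j) \<Rightarrow> (i, j) \<in> angle_runs S X)"

definition oriented_param :: "bool \<Rightarrow> real \<Rightarrow> real" where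
  "oriented_param d t = (if d then t else 1 - t)"

lemma oriented_param_simps [simp]:
  "oriented_param d (oriented_param d t) = t"
  "oriented_param d t \<in> {0..1} \<longleftrightarrow> t \<in> {0..1}"
  "oriented_param d t \<in> {0<..<1} \<longleftrightarrow> t \<in> {0<..<1}"
  "oriented_param (\<not> d) t = oriented_param d (1 - t)"
  by (auto simp: oriented_param_def)

lemma arc_param_conv: "arc_param S f k t = oriented_param (along_arc S f k) t"
  by (auto simp: arc_param_def along_arc_def oriented_param_def split: prod.splits)

lemma side_point_arc_param: "side_point S f k (arc_param S f k t) = polygon_side (length (word S f)) k t"
  by (simp add: side_point_def arc_param_conv)

definition is_side :: "surface \<Rightarrow> nat \<times> nat \<Rightarrow> bool" where
  "is_side S x \<longleftrightarrow> fst x < 4 \<and> snd x < length (word S (fst x))"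

lemma side_gluing_iff:
  "(v, w) \<in> side_gluing S \<longleftrightarrow>
     (\<exists>f k f' k' s. v = (f, side_point S f k s) \<and> w = (f', side_point S f' k' s) \<and> s \<in> {0..1} \<and>
        is_side S (f, k) \<and> is_side S (f', k') \<and>
        side_arc S f k = side_arc S f' k' \<and> side_arc S f k \<in> glued_arcs S)" (is "?L = ?R")
proof
  assume ?L
  then obtain f k t f' k' t' where *: "v = (f, polygon_side (length (word S f)) k t)"
    "w = (f', polygon_side (length (word S f')) k' t')"
    "f < 4" "k < length (word S f)" "t \<in> {0..1}" "f' < 4" "k' < length (word S f')"
    "side_arc S f k = side_arc S f' k'" "side_arc S f k \<in> glued_arcs S"
    "arc_param S f k t = arc_param S f' k' t'"
    unfolding side_gluing_def by blast
  have "v = (f, side_point S f k (arc_param S f k t))"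
    unfolding *(1) by (simp only: side_point_arc_param)
  moreover have "w = (f', side_point S f' k' (arc_param S f k t))"
    unfolding *(2,10) by (simp only: side_point_arc_param)
  moreover have "arc_param S f k t \<in> {0..1}" using *(5) unfolding arc_param_conv oriented_param_simps .
  ultimately show ?R using * unfolding is_side_def by fastforce
next
  assume ?R
  then obtain f k f' k' s where *: "v = (f, side_point S f k s)" "w = (f', side_point S f' k' s)" "s \<in> {0..1}"
    "is_side S (f, k)" "is_side S (f', k')"
    "side_arc S f k = side_arc S f' k'" "side_arc S f k \<in> glued_arcs S" by blast
  have "arc_param S f k (arc_param S f k s) = arc_param S f' k' (arc_param S f' k' s)"
    "arc_param S f k s \<in> {0..1}" "arc_param S f' k' s \<in> {0..1}"
    using *(3) unfolding arc_param_conv oriented_param_simps by simp_all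
  then show ?L using * unfolding side_gluing_def side_point_def is_side_def
    by (auto intro!: exI)
qed

lemma sym_side_gluing: "sym (side_gluing S)"
  by (rule symI) (unfold side_gluing_iff, metis)

lemma side_gluing_rtrancl_sym: "(v, w) \<in> (side_gluing S)\<^sup>* \<Longrightarrow> (w, v) \<in> (side_gluing S)\<^sup>*"
  using sym_rtrancl[OF sym_side_gluing] by (rule symD)

lemma gluing_class_eqI:
  assumes vw: "(v, w) \<in> (side_gluing S)\<^sup>*"
  shows "(side_gluing S)\<^sup>* `` {v} = (side_gluing S)\<^sup>* `` {w}"
proof -
  have "(w, v) \<in> (side_gluing S)\<^sup>*" using vw by (rule side_gluing_rtrancl_sym)
  with vw show ?thesis by (auto intro: rtrancl_trans)
qed

lemma norm_polygon_side [simp]: "norm (polygon_side n k t) = 1"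
  by (simp add: polygon_side_def)

lemma norm_side_point [simp]: "norm (side_point S f k s) = 1"
  by (simp add: side_point_def polygon_side_def)

definition pieces :: "(nat \<times> complex) set" where "pieces = {..<4} \<times> cball 0 1"

lemma topspace_planar_model: "topspace (planar_model S) = pieces // (side_gluing S)\<^sup>*"
  unfolding planar_model_def pieces_def by simp

definition respects_gluing :: "surface \<Rightarrow> (nat \<Rightarrow> complex \<Rightarrow> 'b) \<Rightarrow> bool" where
  "respects_gluing S g \<longleftrightarrow> (\<forall>v w. (v, w) \<in> side_gluing S \<longrightarrow> g (fst v) (snd v) = g (fst w) (snd w))"

lemma planar_map_class:
  assumes "respects_gluing S g"
  shows "planar_map g ((side_gluing S)\<^sup>* `` {(f, z)}) = g f z"
proof -
  have *: "g (fst v) (snd v) = g (fst w) (snd w)" if "(v, w) \<in> (side_gluing S)\<^sup>*" for v w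
    using that assms by induction (auto simp: respects_gluing_def)
  have "(SOME v. v \<in> (side_gluing S)\<^sup>* `` {(f, z)}) \<in> (side_gluing S)\<^sup>* `` {(f, z)}"
    by (rule someI[of _ "(f, z)"]) simp
  then have "g (fst (SOME v. v \<in> (side_gluing S)\<^sup>* `` {(f, z)})) (snd (SOME v. v \<in> (side_gluing S)\<^sup>* `` {(f, z)})) = g f z"
    using *[of "(f, z)"] by simp
  then show ?thesis unfolding planar_map_def by (simp add: case_prod_unfold)
qed

lemma continuous_map_planar_map:
  assumes "respects_gluing S g"
    and "\<And>f. f < 4 \<Longrightarrow> continuous_map (top_of_set (cball 0 1)) Y (g f)"
  shows "continuous_map (planar_model S) Y (planar_map g)"
  unfolding planar_model_def
proof (rule continuous_map_from_quotient)
  have "continuous_map (sum_topology (\<lambda>f. top_of_set (cball 0 1)) {..<4}) Y (\<lambda>(f, z). g f z)"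
    using assms(2) by (intro continuous_map_from_sum_topology) auto
  then show "continuous_map (sum_topology (\<lambda>f. top_of_set (cball 0 1)) {..<4}) Y (\<lambda>x. planar_map g ((side_gluing S)\<^sup>* `` {x}))"
    by (rule continuous_map_eq) (auto simp: planar_map_class[OF assms(1)])
qed

lemma compact_planar_model: "compact_space (planar_model S)"
  unfolding planar_model_def
  by (intro compact_space_quotient_topology compact_space_sum_topology) (auto simp: compact_space_subtopology)

text \<open>Maps on the 2-cells whose fibres are the gluing classes induce a continuous bijection from a compact space to
  the disc.\<close>

lemma homeomorphic_map_planar_model:
  assumes compat: "respects_gluing S g"
    and cont: "\<And>f. f < 4 \<Longrightarrow> continuous_on (cball 0 1) (g f)"
    and cover: "(\<Union>f<4. g f ` cball 0 1) = cball (0::complex) 1"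
    and kernel: "\<And>f z f' z'. \<lbrakk>f < 4; f' < 4; z \<in> cball 0 1; z' \<in> cball 0 1; g f z = g f' z'\<rbrakk>
        \<Longrightarrow> ((f, z), (f', z')) \<in> (side_gluing S)\<^sup>*"
  shows "homeomorphic_map (planar_model S) (top_of_set (cball 0 1)) (planar_map g)"
proof (rule continuous_imp_homeomorphic_map)
  note cls = planar_map_class[OF compat]
  show "continuous_map (planar_model S) (top_of_set (cball 0 1)) (planar_map g)"
    using cont cover by (intro continuous_map_planar_map compat) (auto simp: continuous_map_in_subtopology)
  show "compact_space (planar_model S)" by (rule compact_planar_model)
  show "Hausdorff_space (top_of_set (cball (0::complex) 1))"
    by (simp add: Hausdorff_space_subtopology)
  show "planar_map g ` topspace (planar_model S) = topspace (top_of_set (cball 0 1))"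
  proof -
    have "planar_map g ` topspace (planar_model S) = (\<Union>f<4. g f ` cball 0 1)"
      unfolding topspace_planar_model quotient_def pieces_def using cls by (force simp: image_iff)
    then show ?thesis using cover by simp
  qed
  show "inj_on (planar_map g) (topspace (planar_model S))"
  proof (rule inj_onI)
    fix c d assume cd: "c \<in> topspace (planar_model S)" "d \<in> topspace (planar_model S)" "planar_map g c = planar_map g d"
    then obtain f z f' z' where *: "f < 4" "z \<in> cball 0 1" "c = (side_gluing S)\<^sup>* `` {(f, z)}"
      "f' < 4" "z' \<in> cball 0 1" "d = (side_gluing S)\<^sup>* `` {(f', z')}"
      unfolding topspace_planar_model quotient_def pieces_def by auto
    then have "((f, z), (f', z')) \<in> (side_gluing S)\<^sup>*"
      using cd(3) cls by (intro kernel) auto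
    then show "c = d" unfolding * by (rule gluing_class_eqI)
  qed
qed

section \<open>Pasting polygons together\<close>

lemma continuous_on_bubble_map: "continuous_on A bubble_map"
  unfolding bubble_map_def by (intro continuous_intros) auto

lemma inj_bubble_map: "bubble_map z = bubble_map w \<longleftrightarrow> z = w"
  by (simp add: bubble_map_def)

lemma polygon_side_periodic: "0 < n \<Longrightarrow> polygon_side n (i + n) t = polygon_side n i t"
proof -
  assume "0 < n"
  then have "2 * pi * (real (i + n) + t) / real n = 2 * pi * (real i + t) / real n + 2 * pi"
    by (simp add: field_simps)
  then show ?thesis by (simp add: polygon_side_def flip: cis_mult)
qed

lemma polygon_side_rotate:
  "0 < n \<Longrightarrow> cis (- (2 * pi * real m / real n)) * polygon_side n (i + m) t = polygon_side n i t"
  unfolding polygon_side_def cis_mult by (rule arg_cong[of _ _ cis]) (simp add: field_simps)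

lemma polygon_side_next: "0 < n \<Longrightarrow> polygon_side n i 1 = polygon_side n (Suc i) 0"
  by (simp add: polygon_side_def add.commute)

lemma polygon_side_antipode: "0 < h \<Longrightarrow> polygon_side (2 * h) (i + h) t = - polygon_side (2 * h) i t"
proof -
  assume "0 < h"
  then have "2 * pi * (real (i + h) + t) / real (2 * h) = 2 * pi * (real i + t) / real (2 * h) + pi"
    by (simp add: field_simps)
  then show ?thesis by (simp add: polygon_side_def flip: cis_mult)
qed

lemma sphere_polygon_side:
  assumes "0 < n" "z \<in> sphere 0 1"
  obtains i t where "i < n" "0 \<le> t" "t < 1" "z = polygon_side n i t"
proof -
  obtain \<tau> where t: "0 \<le> \<tau>" "\<tau> < 1" "z = norm z *\<^sub>R cis (2 * pi * \<tau>)" by (rule polar_unit_interval)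
  define i where "i = nat \<lfloor>real n * \<tau>\<rfloor>"
  have "0 \<le> real n * \<tau>" using t by simp
  then have i: "real i \<le> real n * \<tau>" "real n * \<tau> < real i + 1"
    unfolding i_def by (simp_all add: of_nat_nat)
  have "real n * \<tau> < real n" using t assms by simp
  then have "i < n" using i by linarith
  moreover have "z = polygon_side n i (real n * \<tau> - real i)"
    using t assms by (simp add: polygon_side_def mult.assoc)
  ultimately show ?thesis using that[of i "real n * \<tau> - real i"] i by simp
qed

text \<open>The polygon with \<open>n + m\<close> sides is pinched with \<open>c = n / (n + m)\<close>: its first
  \<open>n\<close> sides become the sides of the pinched polygon, and its last \<open>m\<close> sides those of
  the filling polygon, in reverse order and with reversed direction.\<close>

lemma pinch_disc_outer_side:
  assumes n: "0 < n" and m: "0 < m" and i: "i < n" and t: "t \<in> {0..1}"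
  shows "pinch_disc (real n / real (n + m)) (polygon_side (n + m) i t) = polygon_side n i t"
proof -
  let ?\<sigma> = "(real i + t) / real n"
  have "real i + t \<le> real n" using i t by (simp add: nat_less_real_le)
  then have "0 \<le> ?\<sigma>" "?\<sigma> \<le> 1" using n t by auto
  from pinch_disc_outer[OF _ _ this, of "real n / real (n + m)"]
  show ?thesis using n m by (simp add: polygon_side_def)
qed

lemma pinch_disc_inner_side:
  assumes n: "0 < n" and m: "0 < m" and i: "i < m" and t: "t \<in> {0..1}"
  shows "pinch_disc (real n / real (n + m)) (polygon_side (n + m) (n + i) t) =
    bubble_map (polygon_side m (m - 1 - i) (1 - t))"
proof -
  let ?c = "real n / real (n + m)" and ?\<sigma> = "(real i + t) / real m"
  have "real i + t \<le> real m" using i t by (simp add: nat_less_real_le)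
  then have s: "0 \<le> ?\<sigma>" "?\<sigma> \<le> 1" using m t by auto
  have c: "0 < ?c" "?c < 1" using n m by auto
  have "1 - ?c = real m / real (n + m)" using n by (simp add: field_simps)
  then have "?c + (1 - ?c) * ?\<sigma> = (real n + real m * ?\<sigma>) / real (n + m)"
    by (simp add: add_divide_distrib)
  moreover have "real m * ?\<sigma> = real i + t" using m by simp
  ultimately have "?c + (1 - ?c) * ?\<sigma> = (real (n + i) + t) / real (n + m)" by simp
  moreover have "1 - ?\<sigma> = (real (m - 1 - i) + (1 - t)) / real m"
    using i m by (simp add: of_nat_diff field_simps)
  ultimately show ?thesis
    using pinch_disc_inner[OF c s] by (simp add: polygon_side_def mult.assoc)
qed

lemma pinch_disc_filled_side:
  assumes n: "0 < n" and m: "0 < m" and z: "z \<in> cball 0 1"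
    "pinch_disc (real n / real (n + m)) z = bubble_map w" "w \<in> cball 0 1"
  obtains i t where "i < m" "t \<in> {0..1}" "z = polygon_side (n + m) (n + i) t"
    "w = polygon_side m (m - 1 - i) (1 - t)"
proof -
  let ?c = "real n / real (n + m)"
  have c: "0 < ?c" "?c < 1" using n m by auto
  obtain \<sigma> where s: "0 \<le> \<sigma>" "\<sigma> \<le> 1" "z = cis (2 * pi * (?c + (1 - ?c) * \<sigma>))"
    using pinch_disc_meets_bubble[OF c z(1)] z(2,3) by (metis imageI)
  have ex: "\<exists>i t. i < m \<and> t \<in> {0..1} \<and> real m * \<sigma> = real i + t"
  proof (cases "\<sigma> = 1")
    case True
    then show ?thesis using m by (intro exI[of _ "m - 1"] exI[of _ 1]) (auto simp: of_nat_diff)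
  next
    case False
    define i where "i = nat \<lfloor>real m * \<sigma>\<rfloor>"
    have "0 \<le> real m * \<sigma>" using s by simp
    then have i: "real i \<le> real m * \<sigma>" "real m * \<sigma> < real i + 1"
      unfolding i_def by (simp_all add: of_nat_nat)
    have "real m * \<sigma> < real m" using s m False by simp
    then have "i < m" using i by linarith
    then show ?thesis using i by (intro exI[of _ i] exI[of _ "real m * \<sigma> - real i"]) auto
  qed
  then obtain i t where it: "i < m" "t \<in> {0..1}" "real m * \<sigma> = real i + t" by blast
  have "1 - ?c = real m / real (n + m)" using n by (simp add: field_simps)
  then have "?c + (1 - ?c) * \<sigma> = (real n + real m * \<sigma>) / real (n + m)"
    by (simp add: add_divide_distrib)
  then have "?c + (1 - ?c) * \<sigma> = (real (n + i) + t) / real (n + m)" using it(3) by simp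
  then have z': "z = polygon_side (n + m) (n + i) t" using s(3) by (simp add: polygon_side_def)
  moreover have "w = polygon_side m (m - 1 - i) (1 - t)"
    using pinch_disc_inner_side[OF n m it(1,2)] z(2) unfolding z' by (metis inj_bubble_map)
  ultimately show ?thesis using that it by blast
qed

text \<open>The pair \<open>((f, k), d)\<close> is the \<open>k\<close>-th side of the \<open>f\<close>-th 2-cell, traversed
  along its arc if \<open>d\<close> holds and against it otherwise.\<close>

type_synonym oriented_side = "(nat \<times> nat) \<times> bool"

text \<open>The maps \<open>\<Phi> f\<close> exhibit the unit disc as the result of gluing the 2-cells in \<open>F\<close>:
  they cover the disc and identify no more points than the full gluing relation does. The list \<open>bs\<close>
  contains the sides that still lie on the boundary circle, counterclockwise, each occupying an equal arc with
  constant speed. The set \<open>gl\<close> records the pairs of sides that have been glued.\<close>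

definition pasted_disc :: "surface \<Rightarrow> nat set \<Rightarrow> (nat \<Rightarrow> complex \<Rightarrow> complex) \<Rightarrow> oriented_side list \<Rightarrow>
    ((nat \<times> nat) \<times> (nat \<times> nat)) set \<Rightarrow> bool" where
  "pasted_disc S F \<Phi> bs gl \<longleftrightarrow>
     F \<subseteq> {..<4} \<and> (\<forall>f\<in>F. continuous_on (cball 0 1) (\<Phi> f)) \<and>
     (\<Union>f\<in>F. \<Phi> f ` cball 0 1) = cball 0 1 \<and>
     (\<forall>f\<in>F. \<forall>f'\<in>F. \<forall>z\<in>cball 0 1. \<forall>z'\<in>cball 0 1.
        \<Phi> f z = \<Phi> f' z' \<longrightarrow> ((f, z), (f', z')) \<in> (side_gluing S)\<^sup>*) \<and>
     (\<forall>i<length bs. \<forall>f k d. bs ! i = ((f, k), d) \<longrightarrow> f \<in> F \<and> is_side S (f, k) \<and>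
        (\<forall>t\<in>{0..1}. \<Phi> f (side_point S f k (oriented_param d t)) = polygon_side (length bs) i t)) \<and>
     (\<forall>f k f' k'. ((f, k), (f', k')) \<in> gl \<longrightarrow> f \<in> F \<and> f' \<in> F \<and>
        (\<forall>s\<in>{0..1}. \<Phi> f (side_point S f k s) = \<Phi> f' (side_point S f' k' s)))"

lemma pasted_discD:
  assumes "pasted_disc S F \<Phi> bs gl"
  shows "F \<subseteq> {..<4}" "\<And>f. f \<in> F \<Longrightarrow> continuous_on (cball 0 1) (\<Phi> f)"
    "(\<Union>f\<in>F. \<Phi> f ` cball 0 1) = cball 0 1"
    "\<And>f f' z z'. \<lbrakk>f \<in> F; f' \<in> F; z \<in> cball 0 1; z' \<in> cball 0 1; \<Phi> f z = \<Phi> f' z'\<rbrakk>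
       \<Longrightarrow> ((f, z), (f', z')) \<in> (side_gluing S)\<^sup>*"
    "\<And>i f k d. \<lbrakk>i < length bs; bs ! i = ((f, k), d)\<rbrakk> \<Longrightarrow> f \<in> F"
    "\<And>i f k d. \<lbrakk>i < length bs; bs ! i = ((f, k), d)\<rbrakk> \<Longrightarrow> is_side S (f, k)"
    "\<And>i f k d t. \<lbrakk>i < length bs; bs ! i = ((f, k), d); t \<in> {0..1}\<rbrakk>
       \<Longrightarrow> \<Phi> f (side_point S f k (oriented_param d t)) = polygon_side (length bs) i t"
    "\<And>f k f' k'. ((f, k), (f', k')) \<in> gl \<Longrightarrow> f \<in> F"
    "\<And>f k f' k'. ((f, k), (f', k')) \<in> gl \<Longrightarrow> f' \<in> F"
    "\<And>f k f' k' s. \<lbrakk>((f, k), (f', k')) \<in> gl; s \<in> {0..1}\<rbrakk>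
       \<Longrightarrow> \<Phi> f (side_point S f k s) = \<Phi> f' (side_point S f' k' s)"
  using assms unfolding pasted_disc_def by (elim conjE; blast)+

definition face_boundary :: "surface \<Rightarrow> nat \<Rightarrow> oriented_side list" where
  "face_boundary S f = map (\<lambda>k. ((f, k), along_arc S f k)) [0..<length (word S f)]"

lemma pasted_disc_face:
  assumes "f < 4" shows "\<exists>\<Phi>. pasted_disc S {f} \<Phi> (face_boundary S f) {}"
proof
  show "pasted_disc S {f} (\<lambda>_. id) (face_boundary S f) {}"
    unfolding pasted_disc_def using assms
    by (auto simp: face_boundary_def is_side_def side_point_def arc_param_conv id_def)
qed

text \<open>A monogon may be used with either orientation, as complex conjugation reverses its only side.\<close>

lemma pasted_disc_monogon_reversed:
  assumes "f < 4" "length (word S f) = 1"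
  shows "\<exists>\<Phi>. pasted_disc S {f} \<Phi> [((f, 0), \<not> along_arc S f 0)] {}"
proof
  have "cnj ` cball 0 1 = cball 0 1"
    by (force intro: image_eqI[of _ cnj "cnj _"])
  moreover have "cnj (polygon_side (Suc 0) 0 (1 - t)) = polygon_side (Suc 0) 0 t" for t
    by (simp add: polygon_side_def cis_cnj algebra_simps complex_eq_iff cos_diff sin_diff)
  ultimately show "pasted_disc S {f} (\<lambda>_. cnj) [((f, 0), \<not> along_arc S f 0)] {}"
    unfolding pasted_disc_def using assms
    by (auto simp: is_side_def side_point_def arc_param_conv intro!: continuous_intros)
qed

lemma pasted_disc_rotate:
  assumes "\<exists>\<Phi>. pasted_disc S F \<Phi> (xs @ ys) gl"
  shows "\<exists>\<Phi>. pasted_disc S F \<Phi> (ys @ xs) gl"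
proof -
  obtain \<Phi> where \<Phi>: "pasted_disc S F \<Phi> (xs @ ys) gl" using assms by blast
  note D = pasted_discD[OF \<Phi>]
  define n where "n = length (xs @ ys)"
  define \<omega> where "\<omega> = cis (- (2 * pi * real (length xs) / real n))"
  have \<omega>: "norm \<omega> = 1" "\<omega> \<noteq> 0" by (auto simp: \<omega>_def cis_neq_zero)
  have img: "(\<lambda>z. \<omega> * z) ` cball 0 1 = cball 0 1"
  proof (intro equalityI subsetI)
    fix z :: complex assume "z \<in> cball 0 1"
    then show "z \<in> (\<lambda>z. \<omega> * z) ` cball 0 1"
      using \<omega> by (intro image_eqI[of _ _ "z / \<omega>"]) (auto simp: norm_divide)
  qed (use \<omega> in \<open>auto simp: norm_mult\<close>)
  have "pasted_disc S F (\<lambda>f z. \<omega> * \<Phi> f z) (ys @ xs) gl"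
    unfolding pasted_disc_def
  proof (intro conjI ballI allI impI)
    show "continuous_on (cball 0 1) (\<lambda>z. \<omega> * \<Phi> f z)" if "f \<in> F" for f
      using D(2)[OF that] by (intro continuous_intros)
    have "(\<Union>f\<in>F. (\<lambda>z. \<omega> * \<Phi> f z) ` cball 0 1) = (\<lambda>z. \<omega> * z) ` (\<Union>f\<in>F. \<Phi> f ` cball 0 1)"
      by (simp add: image_UN image_image)
    then show "(\<Union>f\<in>F. (\<lambda>z. \<omega> * \<Phi> f z) ` cball 0 1) = cball 0 1" unfolding D(3) img .
    show "((f, z), (f', z')) \<in> (side_gluing S)\<^sup>*"
      if "f \<in> F" "f' \<in> F" "z \<in> cball 0 1" "z' \<in> cball 0 1" "\<omega> * \<Phi> f z = \<omega> * \<Phi> f' z'" for f f' z z'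
      using D(4) that \<omega> by simp
    fix i f k d assume i: "i < length (ys @ xs)" "(ys @ xs) ! i = ((f, k), d)"
    have n: "0 < n" using i by (auto simp: n_def)
    define j where "j = (if i < length ys then i + length xs else i - length ys)"
    have j: "j < length (xs @ ys)" "(xs @ ys) ! j = ((f, k), d)"
      using i by (auto simp: j_def nth_append split: if_splits)
    show "f \<in> F" "is_side S (f, k)" using D(5,6)[OF j] by auto
    fix t :: real assume "t \<in> {0..1}"
    then have "\<Phi> f (side_point S f k (oriented_param d t)) = polygon_side n j t"
      using D(7)[OF j] by (simp add: n_def)
    also have "\<dots> = polygon_side n (i + length xs) t"
    proof (cases "i < length ys")
      case False
      then have "i + length xs = j + n" by (auto simp: j_def n_def)
      then show ?thesis using polygon_side_periodic[OF n] by metis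
    qed (simp add: j_def)
    finally show "\<omega> * \<Phi> f (side_point S f k (oriented_param d t)) = polygon_side (length (ys @ xs)) i t"
      using polygon_side_rotate[OF n, of "length xs" i t] by (simp add: \<omega>_def n_def add.commute)
  qed (use D(1,8,9,10) in auto)
  then show ?thesis by blast
qed

text \<open>The sides \<open>vs\<close> at the end of the boundary are filled by the disc with boundary \<open>ws\<close>.
  The only identification that does not come from the two given discs or from gluing \<open>vs\<close> to
  \<open>ws\<close> is that of the two ends of the arc formed by \<open>vs\<close>. It is forced by the gluing,
  since both ends are glued to the starting point of the boundary of the second disc.\<close>

lemma pasted_disc_fill:
  assumes ex1: "\<exists>\<Phi>. pasted_disc S F1 \<Phi> (us @ vs) gl1"
    and ex2: "\<exists>\<Phi>. pasted_disc S F2 \<Phi> ws gl2"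
    and disj: "F1 \<inter> F2 = {}" and ne: "us \<noteq> []" "vs \<noteq> []"
    and match: "list_all2 (\<lambda>((f, k), d) ((f', k'), d'). side_arc S f k = side_arc S f' k' \<and>
        side_arc S f k \<in> glued_arcs S \<and> d' = (\<not> d)) vs (rev ws)"
  shows "\<exists>\<Phi>. pasted_disc S (F1 \<union> F2) \<Phi> us (gl1 \<union> gl2 \<union> set (zip (map fst vs) (map fst (rev ws))))"
proof -
  obtain \<Phi>1 where \<Phi>1: "pasted_disc S F1 \<Phi>1 (us @ vs) gl1" using ex1 by blast
  obtain \<Phi>2 where \<Phi>2: "pasted_disc S F2 \<Phi>2 ws gl2" using ex2 by blast
  note D1 = pasted_discD[OF \<Phi>1] and D2 = pasted_discD[OF \<Phi>2]
  define n m where "n = length us" and "m = length vs"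
  have n: "0 < n" and m: "0 < m" using ne by (auto simp: n_def m_def)
  have lw: "length ws = m" using list_all2_lengthD[OF match] by (simp add: m_def)
  define c where "c = real n / real (n + m)"
  have c: "0 < c" "c < 1" using n m by (auto simp: c_def)
  define \<Phi> where "\<Phi> f = (if f \<in> F1 then pinch_disc c \<circ> \<Phi>1 f else bubble_map \<circ> \<Phi>2 f)" for f
  have \<Phi>_1: "\<Phi> f z = pinch_disc c (\<Phi>1 f z)" if "f \<in> F1" for f z using that by (simp add: \<Phi>_def)
  have \<Phi>_2: "\<Phi> f z = bubble_map (\<Phi>2 f z)" if "f \<in> F2" for f z using that disj by (auto simp: \<Phi>_def)
  have in1: "\<Phi>1 f z \<in> cball 0 1" if "f \<in> F1" "z \<in> cball 0 1" for f z using D1(3) that by blast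
  have in2: "\<Phi>2 f z \<in> cball 0 1" if "f \<in> F2" "z \<in> cball 0 1" for f z using D2(3) that by blast
  have pair: "\<exists>f k d f' k'. vs ! i = ((f, k), d) \<and> ws ! (m - 1 - i) = ((f', k'), \<not> d) \<and>
      side_arc S f k = side_arc S f' k' \<and> side_arc S f k \<in> glued_arcs S" if "i < m" for i
  proof -
    have "rev ws ! i = ws ! (m - 1 - i)" using that lw by (simp add: rev_nth)
    then show ?thesis using list_all2_nthD[OF match] that
      by (cases "vs ! i"; cases "ws ! (m - 1 - i)") (fastforce simp: m_def split: prod.splits)
  qed
  \<comment> \<open>the two points that are glued at parameter \<open>t\<close> of the \<open>i\<close>-th filled side\<close>
  have seam: "\<exists>f k f' k' s. f \<in> F1 \<and> f' \<in> F2 \<and> s \<in> {0..1} \<and>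
      \<Phi>1 f (side_point S f k s) = polygon_side (n + m) (n + i) t \<and>
      \<Phi>2 f' (side_point S f' k' s) = polygon_side m (m - 1 - i) (1 - t) \<and>
      ((f, side_point S f k s), (f', side_point S f' k' s)) \<in> side_gluing S"
    if i: "i < m" and t: "t \<in> {0..1}" for i t
  proof -
    obtain f k d f' k' where *: "vs ! i = ((f, k), d)" "ws ! (m - 1 - i) = ((f', k'), \<not> d)"
      "side_arc S f k = side_arc S f' k'" "side_arc S f k \<in> glued_arcs S" using pair[OF i] by blast
    have nth: "n + i < length (us @ vs)" "(us @ vs) ! (n + i) = ((f, k), d)" "m - 1 - i < length ws"
      using * i lw by (auto simp: n_def m_def nth_append)
    let ?s = "oriented_param d t"
    have s: "?s \<in> {0..1}" using t by (simp only: oriented_param_simps)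
    have "\<Phi>1 f (side_point S f k ?s) = polygon_side (n + m) (n + i) t"
      using D1(7)[OF nth(1,2) t] by (simp add: n_def m_def)
    moreover have "1 - t \<in> {0..1}" using t by auto
    from D2(7)[OF nth(3) *(2) this] have "\<Phi>2 f' (side_point S f' k' ?s) = polygon_side m (m - 1 - i) (1 - t)"
      by (simp add: lw)
    moreover have "((f, side_point S f k ?s), (f', side_point S f' k' ?s)) \<in> side_gluing S"
      unfolding side_gluing_iff using * s D1(6)[OF nth(1,2)] D2(6)[OF nth(3) *(2)] by blast
    ultimately show ?thesis using D1(5)[OF nth(1,2)] D2(5)[OF nth(3) *(2)] s by blast
  qed
  have ker12: "((f, z), (f', z')) \<in> (side_gluing S)\<^sup>*"
    if z: "f \<in> F1" "f' \<in> F2" "z \<in> cball 0 1" "z' \<in> cball 0 1" "\<Phi> f z = \<Phi> f' z'" for f f' z z'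
  proof -
    have "pinch_disc c (\<Phi>1 f z) = bubble_map (\<Phi>2 f' z')" using that \<Phi>_1 \<Phi>_2 by simp
    then obtain i t where it: "i < m" "t \<in> {0..1}" "\<Phi>1 f z = polygon_side (n + m) (n + i) t"
      "\<Phi>2 f' z' = polygon_side m (m - 1 - i) (1 - t)"
      using pinch_disc_filled_side[OF n m in1[OF z(1,3)]] in2[OF z(2,4)] unfolding c_def by metis
    obtain g k g' k' s where *: "g \<in> F1" "g' \<in> F2" "s \<in> {0..1}"
      "\<Phi>1 g (side_point S g k s) = \<Phi>1 f z" "\<Phi>2 g' (side_point S g' k' s) = \<Phi>2 f' z'"
      "((g, side_point S g k s), (g', side_point S g' k' s)) \<in> side_gluing S"
      using seam[OF it(1,2)] it(3,4) by metis
    have "((f, z), (g, side_point S g k s)) \<in> (side_gluing S)\<^sup>*"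
      by (rule D1(4)) (use that * in auto)
    moreover have "((g', side_point S g' k' s), (f', z')) \<in> (side_gluing S)\<^sup>*"
      by (rule D2(4)) (use that * in auto)
    ultimately show ?thesis using *(6) by (meson r_into_rtrancl rtrancl_trans)
  qed
  have c1: "cis (2 * pi * c) = polygon_side (n + m) (n + 0) 0"
    by (simp add: polygon_side_def c_def)
  have c2: "1 = polygon_side (n + m) (n + (m - 1)) 1"
    using m by (simp add: polygon_side_def of_nat_diff)
  have c3: "polygon_side m (m - 1) 1 = polygon_side m 0 0"
    using m by (simp add: polygon_side_def of_nat_diff)
  \<comment> \<open>the ends of the filled arc are related through the boundary of the filling disc\<close>
  have ends: "((f, z), (f', z')) \<in> (side_gluing S)\<^sup>*"
    if "f \<in> F1" "f' \<in> F1" "z \<in> cball 0 1" "z' \<in> cball 0 1"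
      "\<Phi>1 f z = 1" "\<Phi>1 f' z' = cis (2 * pi * c)" for f f' z z'
  proof -
    obtain g k g' k' s where *: "g \<in> F1" "g' \<in> F2" "s \<in> {0..1}"
      "\<Phi>1 g (side_point S g k s) = 1" "\<Phi>2 g' (side_point S g' k' s) = polygon_side m 0 0"
      "((g, side_point S g k s), (g', side_point S g' k' s)) \<in> side_gluing S"
      using seam[of "m - 1" 1] m c2 by force
    obtain h j h' j' r where **: "h \<in> F1" "h' \<in> F2" "r \<in> {0..1}"
      "\<Phi>1 h (side_point S h j r) = cis (2 * pi * c)" "\<Phi>2 h' (side_point S h' j' r) = polygon_side m 0 0"
      "((h, side_point S h j r), (h', side_point S h' j' r)) \<in> side_gluing S"
      using seam[of 0 0] m c1 c3 by force
    have "((f, z), (g, side_point S g k s)) \<in> (side_gluing S)\<^sup>*" by (rule D1(4)) (use that * in auto)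
    moreover have "((g', side_point S g' k' s), (h', side_point S h' j' r)) \<in> (side_gluing S)\<^sup>*"
      by (rule D2(4)) (use * ** in auto)
    moreover have "((h, side_point S h j r), (f', z')) \<in> (side_gluing S)\<^sup>*" by (rule D1(4)) (use that ** in auto)
    moreover have "((h', side_point S h' j' r), (h, side_point S h j r)) \<in> side_gluing S"
      using **(6) sym_side_gluing by (meson symD)
    ultimately show ?thesis using *(6) by (meson r_into_rtrancl rtrancl_trans)
  qed
  have ker11: "((f, z), (f', z')) \<in> (side_gluing S)\<^sup>*"
    if "f \<in> F1" "f' \<in> F1" "z \<in> cball 0 1" "z' \<in> cball 0 1" "\<Phi> f z = \<Phi> f' z'" for f f' z z'
  proof -
    have "pinch_disc c (\<Phi>1 f z) = pinch_disc c (\<Phi>1 f' z')" using that \<Phi>_1 by simp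
    from pinch_disc_inj[OF c in1 in1 this] that
    consider "\<Phi>1 f z = \<Phi>1 f' z'" | "\<Phi>1 f z = 1" "\<Phi>1 f' z' = cis (2 * pi * c)"
      | "\<Phi>1 f z = cis (2 * pi * c)" "\<Phi>1 f' z' = 1" by auto
    then show ?thesis
    proof cases
      case 1 then show ?thesis using D1(4) that by blast
    next
      case 2 then show ?thesis using ends that by blast
    next
      case 3 then show ?thesis using ends[of f' f z' z] that side_gluing_rtrancl_sym by blast
    qed
  qed
  have "pasted_disc S (F1 \<union> F2) \<Phi> us (gl1 \<union> gl2 \<union> set (zip (map fst vs) (map fst (rev ws))))"
    unfolding pasted_disc_def
  proof (intro conjI ballI allI impI)
    show "F1 \<union> F2 \<subseteq> {..<4}" using D1(1) D2(1) by blast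
    show "continuous_on (cball 0 1) (\<Phi> f)" if "f \<in> F1 \<union> F2" for f
    proof (cases "f \<in> F1")
      case True
      have "continuous_on (cball 0 1) (\<lambda>z. pinch_disc c (\<Phi>1 f z))"
        using in1[OF True]
        by (intro continuous_on_compose2[OF continuous_on_pinch_disc[OF c] D1(2)[OF True]]) blast
      then show ?thesis using True by (simp add: \<Phi>_def o_def)
    next
      case False
      then have "continuous_on (cball 0 1) (\<lambda>z. bubble_map (\<Phi>2 f z))"
        using D2(2)[of f] that by (intro continuous_on_compose2[OF continuous_on_bubble_map[of UNIV]]) auto
      then show ?thesis using False by (simp add: \<Phi>_def o_def)
    qed
    have "(\<Union>f\<in>F1 \<union> F2. \<Phi> f ` cball 0 1) = (\<Union>f\<in>F1. \<Phi> f ` cball 0 1) \<union> (\<Union>f\<in>F2. \<Phi> f ` cball 0 1)" by blast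
    also have "\<dots> = (\<Union>f\<in>F1. pinch_disc c ` \<Phi>1 f ` cball 0 1) \<union> (\<Union>f\<in>F2. bubble_map ` \<Phi>2 f ` cball 0 1)"
      by (simp add: \<Phi>_1 \<Phi>_2 image_image)
    also have "\<dots> = pinch_disc c ` (\<Union>f\<in>F1. \<Phi>1 f ` cball 0 1) \<union> bubble_map ` (\<Union>f\<in>F2. \<Phi>2 f ` cball 0 1)"
      by (simp only: image_UN)
    also have "\<dots> = cball 0 1" unfolding D1(3) D2(3) by (rule pinch_disc_range[OF c])
    finally show "(\<Union>f\<in>F1 \<union> F2. \<Phi> f ` cball 0 1) = cball 0 1" .
    show "((f, z), (f', z')) \<in> (side_gluing S)\<^sup>*"
      if z: "f \<in> F1 \<union> F2" "f' \<in> F1 \<union> F2" "z \<in> cball 0 1" "z' \<in> cball 0 1" "\<Phi> f z = \<Phi> f' z'" for f f' z z'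
    proof -
      note that = z
      from z consider "f \<in> F1" "f' \<in> F1" | "f \<in> F1" "f' \<in> F2" | "f \<in> F2" "f' \<in> F1" | "f \<in> F2" "f' \<in> F2"
        by blast
      then show ?thesis
      proof cases
        case 1 then show ?thesis using ker11 that by blast
      next
        case 2 then show ?thesis using ker12 that by blast
      next
        case 3 then show ?thesis using ker12[of f' f z' z] that side_gluing_rtrancl_sym by auto
      next
        case 4 then show ?thesis using D2(4) that by (simp add: \<Phi>_2 inj_bubble_map)
      qed
    qed
  next
    fix i f k d assume i: "i < length us" "us ! i = ((f, k), d)"
    then have i': "i < length (us @ vs)" "(us @ vs) ! i = ((f, k), d)" by (auto simp: nth_append)
    show f: "f \<in> F1 \<union> F2" and "is_side S (f, k)" using D1(5,6)[OF i'] by auto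
    fix t :: real assume t: "t \<in> {0..1}"
    have "\<Phi> f (side_point S f k (oriented_param d t)) = pinch_disc c (polygon_side (n + m) i t)"
      using D1(5)[OF i'] D1(7)[OF i' t] by (simp add: \<Phi>_1 n_def m_def)
    then show "\<Phi> f (side_point S f k (oriented_param d t)) = polygon_side (length us) i t"
      using pinch_disc_outer_side[OF n m _ t, of i] i by (simp add: c_def n_def)
  next
    fix f k f' k' assume "((f, k), (f', k')) \<in> gl1 \<union> gl2 \<union> set (zip (map fst vs) (map fst (rev ws)))"
    then consider "((f, k), (f', k')) \<in> gl1" | "((f, k), (f', k')) \<in> gl2"
      | i where "i < m" "fst (vs ! i) = (f, k)" "fst (ws ! (m - 1 - i)) = (f', k')"
      by (auto simp: set_zip m_def rev_nth lw)
    then have "f \<in> F1 \<union> F2 \<and> f' \<in> F1 \<union> F2 \<and>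
        (\<forall>s\<in>{0..1}. \<Phi> f (side_point S f k s) = \<Phi> f' (side_point S f' k' s))"
    proof cases
      case 1 then show ?thesis using D1(8,9,10)[OF 1] by (simp add: \<Phi>_1)
    next
      case 2 then show ?thesis using D2(8,9,10)[OF 2] by (simp add: \<Phi>_2)
    next
      case 3
      obtain d where d: "vs ! i = ((f, k), d)" "ws ! (m - 1 - i) = ((f', k'), \<not> d)"
        using pair[OF 3(1)] 3 by auto
      have nth: "n + i < length (us @ vs)" "(us @ vs) ! (n + i) = ((f, k), d)" "m - 1 - i < length ws"
        using d 3 lw by (auto simp: n_def m_def nth_append)
      have "\<Phi> f (side_point S f k s) = \<Phi> f' (side_point S f' k' s)" if s: "s \<in> {0..1}" for s
      proof -
        let ?t = "oriented_param d s"
        have t: "?t \<in> {0..1}" "1 - ?t \<in> {0..1}" using s by (auto simp: oriented_param_def)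
        have "\<Phi> f (side_point S f k s) = pinch_disc c (polygon_side (n + m) (n + i) ?t)"
          using D1(5)[OF nth(1,2)] D1(7)[OF nth(1,2) t(1)] by (simp add: \<Phi>_1 n_def m_def)
        also have "\<dots> = bubble_map (polygon_side m (m - 1 - i) (1 - ?t))"
          unfolding c_def by (rule pinch_disc_inner_side[OF n m 3(1) t(1)])
        also have "\<dots> = \<Phi> f' (side_point S f' k' s)"
          using D2(5)[OF nth(3) d(2)] D2(7)[OF nth(3) d(2) t(2)] by (simp add: \<Phi>_2 lw)
        finally show ?thesis .
      qed
      then show ?thesis using D1(5)[OF nth(1,2)] D2(5)[OF nth(3) d(2)] by blast
    qed
    then show "f \<in> F1 \<union> F2" "f' \<in> F1 \<union> F2"
      "\<And>s. s \<in> {0..1} \<Longrightarrow> \<Phi> f (side_point S f k s) = \<Phi> f' (side_point S f' k' s)" by auto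
  qed
  then show ?thesis by blast
qed

section \<open>The 2-cells of Boy's and Girl's surfaces\<close>

text \<open>The boundary of the pasted disc for the two surfaces. In both cases it runs twice through the arcs that are not
  glued, so that antipodal boundary points lie on the same arc at the same parameter.\<close>

fun outer_sides :: "surface \<Rightarrow> oriented_side list" where
  "outer_sides Boy = [((3, 2), True), ((3, 3), True), ((3, 5), True), ((3, 6), True), ((3, 8), True), ((3, 0), True)]"
| "outer_sides Girl = [((2, 1), False), ((2, 2), False)]"

fun seams :: "surface \<Rightarrow> ((nat \<times> nat) \<times> (nat \<times> nat)) set" where
  "seams Boy = {((3, 7), (0, 0)), ((3, 4), (1, 0)), ((3, 1), (2, 0))}"
| "seams Girl = {((3, 4), (1, 0)), ((3, 1), (0, 0)), ((2, 3), (3, 2)), ((2, 4), (3, 0)), ((2, 0), (3, 3))}"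

text \<open>The monogons fill the sides \<open>A'\<close>, \<open>B'\<close>, \<open>C'\<close> of the nonagon one after the
  other.\<close>

lemma pasting_Boy: "\<exists>\<Phi>. pasted_disc Boy {..<4} \<Phi> (outer_sides Boy) (seams Boy)"
proof -
  let ?n = "\<lambda>k. ((3::nat, k::nat), True)" and ?r = "\<lambda>k. ((3::nat, k::nat), False)"
  have mono: "\<exists>\<Phi>. pasted_disc Boy {f} \<Phi> [((f, 0), True)] {}" if "f \<in> {0, 1, 2}" for f
    using pasted_disc_face[of f Boy] that by (auto simp: face_boundary_def along_arc_def)
  have "face_boundary Boy 3 = [?n 0, ?r 1, ?n 2, ?n 3, ?r 4, ?n 5, ?n 6, ?r 7] @ [?n 8]"
    by (simp add: face_boundary_def along_arc_def upt_rec)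
  with pasted_disc_face[of 3 Boy]
  have "\<exists>\<Phi>. pasted_disc Boy {3} \<Phi> ([?n 0, ?r 1, ?n 2, ?n 3, ?r 4, ?n 5, ?n 6, ?r 7] @ [?n 8]) {}" by simp
  from pasted_disc_rotate[OF this]
  have "\<exists>\<Phi>. pasted_disc Boy {3} \<Phi> ([?n 8, ?n 0, ?r 1, ?n 2, ?n 3, ?r 4, ?n 5, ?n 6] @ [?r 7]) {}" by simp
  from pasted_disc_fill[OF this mono[of 0]]
  have "\<exists>\<Phi>. pasted_disc Boy {3, 0} \<Phi> ([?n 8, ?n 0, ?r 1, ?n 2, ?n 3, ?r 4] @ [?n 5, ?n 6]) {((3, 7), (0, 0))}" by (simp add: insert_commute)
  from pasted_disc_rotate[OF this]
  have "\<exists>\<Phi>. pasted_disc Boy {3, 0} \<Phi> ([?n 5, ?n 6, ?n 8, ?n 0, ?r 1, ?n 2, ?n 3] @ [?r 4]) {((3, 7), (0, 0))}" by simp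
  from pasted_disc_fill[OF this mono[of 1]]
  have "\<exists>\<Phi>. pasted_disc Boy {3, 0, 1} \<Phi> ([?n 5, ?n 6, ?n 8, ?n 0, ?r 1] @ [?n 2, ?n 3]) {((3, 7), (0, 0)), ((3, 4), (1, 0))}"
    by (simp add: insert_commute)
  from pasted_disc_rotate[OF this]
  have "\<exists>\<Phi>. pasted_disc Boy {3, 0, 1} \<Phi> ([?n 2, ?n 3, ?n 5, ?n 6, ?n 8, ?n 0] @ [?r 1]) {((3, 7), (0, 0)), ((3, 4), (1, 0))}" by simp
  from pasted_disc_fill[OF this mono[of 2]]
  have "\<exists>\<Phi>. pasted_disc Boy ({3, 0, 1} \<union> {2}) \<Phi> (outer_sides Boy) (seams Boy)"
    by (simp add: insert_commute)
  moreover have "{3, 0, 1} \<union> {2} = {..<4::nat}" by auto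
  ultimately show ?thesis by simp
qed

text \<open>The monogons fill \<open>B'\<close> and \<open>A'\<close> in the last 2-cell. This leaves a triangle with the
  sides \<open>A\<close>, \<open>C\<close>, \<open>B\<close>, all traversed backwards, which fills the sides
  \<open>B\<close>, \<open>C\<close>, \<open>A\<close> of the other 2-cell.\<close>

lemma pasting_Girl: "\<exists>\<Phi>. pasted_disc Girl {..<4} \<Phi> (outer_sides Girl) (seams Girl)"
proof -
  let ?p = "\<lambda>k. ((3::nat, k::nat), True)" and ?r = "\<lambda>k. ((3::nat, k::nat), False)"
  let ?u = "\<lambda>k. ((2::nat, k::nat), True)" and ?v = "\<lambda>k. ((2::nat, k::nat), False)"
  \<comment> \<open>\<open>A'\<close> and \<open>B'\<close> are traversed forwards by the pentagon as well, so the monogons have to be reversed\<close>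
  have mono: "\<exists>\<Phi>. pasted_disc Girl {f} \<Phi> [((f, 0), False)] {}" if "f \<in> {0, 1}" for f
    using pasted_disc_monogon_reversed[of f Girl] that by (auto simp: along_arc_def)
  have "face_boundary Girl 3 = [?r 0, ?p 1, ?r 2, ?r 3] @ [?p 4]"
    by (simp add: face_boundary_def along_arc_def upt_rec)
  with pasted_disc_face[of 3 Girl]
  have "\<exists>\<Phi>. pasted_disc Girl {3} \<Phi> ([?r 0, ?p 1, ?r 2, ?r 3] @ [?p 4]) {}" by simp
  from pasted_disc_fill[OF this mono[of 1]]
  have "\<exists>\<Phi>. pasted_disc Girl {3, 1} \<Phi> ([?r 0, ?p 1] @ [?r 2, ?r 3]) {((3, 4), (1, 0))}" by (simp add: insert_commute)
  from pasted_disc_rotate[OF this]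
  have "\<exists>\<Phi>. pasted_disc Girl {3, 1} \<Phi> ([?r 2, ?r 3, ?r 0] @ [?p 1]) {((3, 4), (1, 0))}" by simp
  from pasted_disc_fill[OF this mono[of 0]]
  have "\<exists>\<Phi>. pasted_disc Girl {3, 1, 0} \<Phi> ([?r 2] @ [?r 3, ?r 0]) {((3, 4), (1, 0)), ((3, 1), (0, 0))}"
    by (simp add: insert_commute)
  from pasted_disc_rotate[OF this]
  have triangle: "\<exists>\<Phi>. pasted_disc Girl {3, 1, 0} \<Phi> [?r 3, ?r 0, ?r 2] {((3, 4), (1, 0)), ((3, 1), (0, 0))}" by simp
  have "face_boundary Girl 2 = [?u 0] @ [?v 1, ?v 2, ?u 3, ?u 4]"
    by (simp add: face_boundary_def along_arc_def upt_rec)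
  with pasted_disc_face[of 2 Girl]
  have "\<exists>\<Phi>. pasted_disc Girl {2} \<Phi> ([?u 0] @ [?v 1, ?v 2, ?u 3, ?u 4]) {}" by simp
  from pasted_disc_rotate[OF this]
  have "\<exists>\<Phi>. pasted_disc Girl {2} \<Phi> ([?v 1, ?v 2] @ [?u 3, ?u 4, ?u 0]) {}" by simp
  from pasted_disc_fill[OF this triangle]
  have "\<exists>\<Phi>. pasted_disc Girl ({2} \<union> {3, 1, 0}) \<Phi> (outer_sides Girl) (seams Girl)"
    by (simp add: insert_commute)
  moreover have "{2} \<union> {3, 1, 0} = {..<4::nat}" by auto
  ultimately show ?thesis by simp
qed

lemma pasting: "\<exists>\<Phi>. pasted_disc S {..<4} \<Phi> (outer_sides S) (seams S)"
  using pasting_Boy pasting_Girl by (cases S) auto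

lemma word_nonempty: "f < 4 \<Longrightarrow> 0 < length (word S f)"
  by (cases S) (auto simp: less_Suc_eq numeral_eq_Suc)

lemma is_side_Boy: "is_side Boy x \<longleftrightarrow> x \<in> {(0, 0), (1, 0), (2, 0), (3, 0), (3, 1), (3, 2), (3, 3), (3, 4), (3, 5), (3, 6), (3, 7), (3, 8)}"
proof -
  obtain f k where x: "x = (f, k)" by fastforce
  consider "f = 0" | "f = 1" | "f = 2" | "f = 3" | "4 \<le> f" by arith
  then show ?thesis by cases (simp_all add: x is_side_def, arith)
qed

lemma is_side_Girl: "is_side Girl x \<longleftrightarrow> x \<in> {(0, 0), (1, 0), (2, 0), (2, 1), (2, 2), (2, 3), (2, 4), (3, 0), (3, 1), (3, 2), (3, 3), (3, 4)}"
proof -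
  obtain f k where x: "x = (f, k)" by fastforce
  consider "f = 0" | "f = 1" | "f = 2" | "f = 3" | "4 \<le> f" by arith
  then show ?thesis by cases (simp_all add: x is_side_def, arith+)
qed

abbreviation arc_of :: "surface \<Rightarrow> nat \<times> nat \<Rightarrow> arc" where
  "arc_of S x \<equiv> side_arc S (fst x) (snd x)"

text \<open>Each preimage arc lies on the boundary of the 2-cells exactly twice.\<close>

fun occurrences :: "surface \<Rightarrow> arc \<Rightarrow> (nat \<times> nat) set" where
  "occurrences Boy (LoopA, False) = {(3, 0), (3, 5)}"
| "occurrences Boy (LoopB, False) = {(3, 2), (3, 6)}"
| "occurrences Boy (LoopC, False) = {(3, 3), (3, 8)}"
| "occurrences Boy (LoopA, True) = {(0, 0), (3, 7)}"
| "occurrences Boy (LoopB, True) = {(1, 0), (3, 4)}"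
| "occurrences Boy (LoopC, True) = {(2, 0), (3, 1)}"
| "occurrences Girl (LoopA, False) = {(2, 0), (3, 3)}"
| "occurrences Girl (LoopB, False) = {(2, 3), (3, 2)}"
| "occurrences Girl (LoopC, False) = {(2, 4), (3, 0)}"
| "occurrences Girl (LoopA, True) = {(0, 0), (3, 1)}"
| "occurrences Girl (LoopB, True) = {(1, 0), (3, 4)}"
| "occurrences Girl (LoopC, True) = {(2, 1), (2, 2)}"

lemma occurrences: "is_side S x \<Longrightarrow> x \<in> occurrences S (arc_of S x)"
proof (cases S)
  case Boy
  assume "is_side S x"
  then show ?thesis unfolding Boy is_side_Boy by (elim insertE emptyE; simp)
next
  case Girl
  assume "is_side S x"
  then show ?thesis unfolding Girl is_side_Girl by (elim insertE emptyE; simp)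
qed

lemma glued_sides_are_seams:
  assumes "is_side S x" "is_side S y" "arc_of S x = arc_of S y" "arc_of S x \<in> glued_arcs S"
  shows "x = y \<or> (x, y) \<in> seams S \<or> (y, x) \<in> seams S"
proof -
  obtain X b where e: "arc_of S x = (X, b)" by fastforce
  have "x \<in> occurrences S (X, b)" "y \<in> occurrences S (X, b)" "(X, b) \<in> glued_arcs S"
    using occurrences[OF assms(1)] occurrences[OF assms(2)] assms(3,4) e by simp_all
  then show ?thesis by (cases S; cases X; cases b) auto
qed

lemma side_is_outer_iff:
  "is_side S x \<Longrightarrow> x \<in> fst ` set (outer_sides S) \<longleftrightarrow> arc_of S x \<notin> glued_arcs S"
proof -
  assume x: "is_side S x"
  obtain X b where e: "arc_of S x = (X, b)" by fastforce
  have "x \<in> occurrences S (X, b)" using occurrences[OF x] e by simp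
  then show ?thesis unfolding e by (cases S; cases X; cases b) auto
qed

definition half_length :: "surface \<Rightarrow> nat" where
  "half_length S = length (outer_sides S) div 2"

lemma length_outer_sides: "length (outer_sides S) = 2 * half_length S" "0 < half_length S"
  by (cases S; simp add: half_length_def)+

lemma outer_sides_repeat:
  "list_all2 (\<lambda>a b. arc_of S (fst a) = arc_of S (fst b) \<and> snd a = snd b)
     (take (half_length S) (outer_sides S)) (drop (half_length S) (outer_sides S))"
  "distinct (map (arc_of S \<circ> fst) (take (half_length S) (outer_sides S)))"
  by (cases S; simp add: half_length_def)+

lemma outer_side_antipode:
  assumes "i < half_length S"
  shows "arc_of S (fst (outer_sides S ! (i + half_length S))) = arc_of S (fst (outer_sides S ! i))"
    "snd (outer_sides S ! (i + half_length S)) = snd (outer_sides S ! i)"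
  using list_all2_nthD[OF outer_sides_repeat(1), of i] assms length_outer_sides[of S]
  by (simp_all add: add.commute)

text \<open>The arcs in the first half of the boundary are distinct and recur in the second half, so the arc determines the
  position up to the antipodal map.\<close>

lemma outer_side_index_unique:
  assumes "i < length (outer_sides S)" "j < length (outer_sides S)"
    and "arc_of S (fst (outer_sides S ! i)) = arc_of S (fst (outer_sides S ! j))"
  shows "snd (outer_sides S ! i) = snd (outer_sides S ! j)"
    "i = j \<or> i = j + half_length S \<or> j = i + half_length S"
proof -
  let ?h = "half_length S"
  define r where "r k = (if k < ?h then k else k - ?h)" for k
  have r: "r k < ?h \<and> (k = r k \<or> k = r k + ?h) \<and> arc_of S (fst (outer_sides S ! r k)) = arc_of S (fst (outer_sides S ! k)) \<and>
      snd (outer_sides S ! r k) = snd (outer_sides S ! k)" if "k < length (outer_sides S)" for k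
    using outer_side_antipode[of "r k" S] that length_outer_sides[of S] by (auto simp: r_def)
  have "map (arc_of S \<circ> fst) (take ?h (outer_sides S)) ! r i = map (arc_of S \<circ> fst) (take ?h (outer_sides S)) ! r j"
    using r[OF assms(1)] r[OF assms(2)] assms(3) length_outer_sides[of S] by simp
  then have "r i = r j"
    using nth_eq_iff_index_eq[OF outer_sides_repeat(2)[of S], of "r i" "r j"]
      r[OF assms(1)] r[OF assms(2)] length_outer_sides[of S] by simp
  then show "snd (outer_sides S ! i) = snd (outer_sides S ! j)"
    "i = j \<or> i = j + half_length S \<or> j = i + half_length S"
    using r[OF assms(1)] r[OF assms(2)] by auto
qed

lemma arc_has_side: "\<exists>x. is_side S x \<and> arc_of S x = e"
proof -
  obtain X b where e: "e = (X, b)" by fastforce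
  have "\<exists>x\<in>occurrences S (X, b). is_side S x \<and> arc_of S x = (X, b)"
    by (cases S; cases X; cases b; simp add: is_side_def)
  then show ?thesis unfolding e by blast
qed

text \<open>The end of each side is the start of the next one. This is how the boundary words determine the vertices.\<close>

lemma side_point_next:
  assumes "is_side S (f, k)"
  shows "side_point S f k (oriented_param (along_arc S f k) 1) =
    side_point S f (Suc k mod length (word S f)) (oriented_param (along_arc S f (Suc k mod length (word S f))) 0)"
proof -
  let ?n = "length (word S f)"
  have n: "0 < ?n" "k < ?n" using assms by (auto simp: is_side_def)
  have "polygon_side ?n k 1 = polygon_side ?n (Suc k mod ?n) 0"
  proof (cases "Suc k < ?n")
    case True
    then show ?thesis using polygon_side_next[OF n(1)] by simp
  next
    case False
    then have "Suc k = ?n" using n by simp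
    then show ?thesis using polygon_side_next[OF n(1), of k] polygon_side_periodic[OF n(1), of 0] by simp
  qed
  then show ?thesis by (simp add: side_point_def arc_param_conv)
qed

section \<open>The cell structure on the projective plane\<close>

context
  fixes S :: surface
    and p :: "(real^3) set \<Rightarrow> real^3"
    and v0 :: "real^3"
    and \<alpha> :: "arc \<Rightarrow> real \<Rightarrow> (real^3) set"
    and \<psi> :: "nat \<Rightarrow> complex \<Rightarrow> (real^3) set"
  assumes CW: "natural_CW_structure S p v0 \<alpha> \<psi>" and three: "card (fibre p v0) = 3"
begin

lemma CW_parts:
  "disjoint_family_on (open_cell p v0 \<alpha> \<psi>) cells"
  "(\<Union>c\<in>cells. open_cell p v0 \<alpha> \<psi> c) = p ` topspace RP2"
  "\<forall>e. continuous_map (top_of_set {0..1}) RP2 (\<alpha> e)"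
  "\<forall>X. inj_on (\<lambda>t. p (\<alpha> (X, False) t)) {0<..<1}"
  "\<forall>X. \<forall>t\<in>{0..1}. p (\<alpha> (X, True) t) = p (\<alpha> (X, False) t)"
  "\<forall>X. \<forall>t\<in>{0<..<1}. \<alpha> (X, True) t \<noteq> \<alpha> (X, False) t \<and>
        fibre p (p (\<alpha> (X, False) t)) = {\<alpha> (X, False) t, \<alpha> (X, True) t}"
  "fibre p v0 = (\<Union>e. {\<alpha> e 0, \<alpha> e 1})"
  "\<forall>f<4. continuous_map (top_of_set (cball 0 1)) RP2 (\<psi> f) \<and>
        inj_on (\<lambda>z. p (\<psi> f z)) (ball 0 1) \<and>
        (\<forall>z\<in>ball 0 1. fibre p (p (\<psi> f z)) = {\<psi> f z}) \<and>
        (\<forall>k<length (word S f). \<forall>t\<in>{0..1}.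
           \<psi> f (polygon_side (length (word S f)) k t) = \<alpha> (side_arc S f k) (arc_param S f k t))"
  using CW unfolding natural_CW_structure_def by - (elim conjE, assumption)+

lemmas CW_disjoint = CW_parts(1) and CW_cover = CW_parts(2) and CW_arc = CW_parts(3)[rule_format]
  and CW_arc_inj = CW_parts(4)[rule_format] and CW_arc_pair = CW_parts(5)[rule_format]
  and CW_vertex_fibre = CW_parts(7)

lemma CW_arc_distinct: "t \<in> {0<..<1} \<Longrightarrow> \<alpha> (X, True) t \<noteq> \<alpha> (X, False) t"
  and CW_arc_fibre: "t \<in> {0<..<1} \<Longrightarrow> fibre p (p (\<alpha> (X, False) t)) = {\<alpha> (X, False) t, \<alpha> (X, True) t}"
  by (rule CW_parts(6)[THEN spec, THEN bspec, THEN conjunct1], assumption,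
      rule CW_parts(6)[THEN spec, THEN bspec, THEN conjunct2], assumption)

lemma CW_face_all:
  assumes "f < 4"
  shows "continuous_map (top_of_set (cball 0 1)) RP2 (\<psi> f)" "inj_on (\<lambda>z. p (\<psi> f z)) (ball 0 1)"
    "\<And>z. z \<in> ball 0 1 \<Longrightarrow> fibre p (p (\<psi> f z)) = {\<psi> f z}"
    "\<And>k t. k < length (word S f) \<Longrightarrow> t \<in> {0..1} \<Longrightarrow>
       \<psi> f (polygon_side (length (word S f)) k t) = \<alpha> (side_arc S f k) (arc_param S f k t)"
proof -
  note * = CW_parts(8)[THEN spec, THEN mp, OF assms]
  show "continuous_map (top_of_set (cball 0 1)) RP2 (\<psi> f)" "inj_on (\<lambda>z. p (\<psi> f z)) (ball 0 1)"
    using * by - (elim conjE, assumption)+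
  show "fibre p (p (\<psi> f z)) = {\<psi> f z}" if "z \<in> ball 0 1" for z
    by (rule *[THEN conjunct2, THEN conjunct2, THEN conjunct1, THEN bspec, OF that])
  show "\<psi> f (polygon_side (length (word S f)) k t) = \<alpha> (side_arc S f k) (arc_param S f k t)"
    if "k < length (word S f)" "t \<in> {0..1}" for k t
    by (rule *[THEN conjunct2, THEN conjunct2, THEN conjunct2, THEN spec, THEN mp, OF that(1), THEN bspec, OF that(2)])
qed

lemmas CW_face = CW_face_all(1) and CW_face_inj = CW_face_all(2) and CW_face_fibre = CW_face_all(3)

lemma face_side:
  assumes "is_side S (f, k)" "s \<in> {0..1}"
  shows "\<psi> f (side_point S f k s) = \<alpha> (side_arc S f k) s"
proof -
  have "arc_param S f k s \<in> {0..1}"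
    using assms(2) unfolding arc_param_conv oriented_param_simps .
  then have "\<psi> f (side_point S f k s) = \<alpha> (side_arc S f k) (arc_param S f k (arc_param S f k s))"
    using assms(1) CW_face_all(4)[of f k] unfolding side_point_def is_side_def by simp
  then show ?thesis by (simp add: arc_param_conv)
qed

lemma RP2_face: "f < 4 \<Longrightarrow> z \<in> cball 0 1 \<Longrightarrow> \<psi> f z \<in> topspace RP2"
  using CW_face[of f] by (auto simp: continuous_map_def Pi_iff)

lemma arc_end_over_vertex: "s \<in> {0, 1} \<Longrightarrow> p (\<alpha> e s) = v0"
  using CW_vertex_fibre unfolding fibre_def by blast

lemma arc_over_edge: "t \<in> {0<..<1} \<Longrightarrow> p (\<alpha> (X, b) t) \<in> open_cell p v0 \<alpha> \<psi> (Edge X)"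
  using CW_arc_pair[of t X] by (cases b) auto

lemma open_cells_disjoint:
  "y \<in> open_cell p v0 \<alpha> \<psi> c \<Longrightarrow> y \<in> open_cell p v0 \<alpha> \<psi> c' \<Longrightarrow> c \<in> cells \<Longrightarrow> c' \<in> cells \<Longrightarrow> c = c'"
  using CW_disjoint unfolding disjoint_family_on_def by blast

lemma cells_mem [simp]: "Vertex \<in> cells" "Edge X \<in> cells" "f < 4 \<Longrightarrow> Face f \<in> cells"
  by (auto simp: cells_def)

lemma arc_over_skeleton_cell:
  assumes "t \<in> {0..1}" obtains c where "p (\<alpha> e t) \<in> open_cell p v0 \<alpha> \<psi> c" "c \<in> insert Vertex (range Edge)"
proof (cases "t \<in> {0<..<1}")
  case True
  then show ?thesis using arc_over_edge[of t "fst e" "snd e"] that[of "Edge (fst e)"] by simp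
next
  case False
  then have "p (\<alpha> e t) = v0" using assms by (intro arc_end_over_vertex) auto
  then show ?thesis using that[of Vertex] by simp
qed

text \<open>The open arcs are disjoint from each other and from the vertices, since they lie over disjoint 1-cells or, if
  they lie over the same one, consist of the two different preimages of its points.\<close>

lemma arc_point_unique:
  assumes "s \<in> {0<..<1}" "t \<in> {0..1}" "\<alpha> e s = \<alpha> e' t"
  shows "e = e'" "s = t"
proof -
  obtain X b where e: "e = (X, b)" by fastforce
  obtain X' b' where e': "e' = (X', b')" by fastforce
  have s: "p (\<alpha> e s) \<in> open_cell p v0 \<alpha> \<psi> (Edge X)" using arc_over_edge[OF assms(1)] e by simp
  have t: "t \<in> {0<..<1}"
  proof (rule ccontr)
    assume "t \<notin> {0<..<1}"
    then have "p (\<alpha> e' t) \<in> open_cell p v0 \<alpha> \<psi> Vertex" using assms(2) arc_end_over_vertex[of t e'] by auto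
    then show False using open_cells_disjoint[OF s, of Vertex] assms(3) by simp
  qed
  have "p (\<alpha> e s) \<in> open_cell p v0 \<alpha> \<psi> (Edge X')" using arc_over_edge[OF t] e' assms(3) by simp
  from open_cells_disjoint[OF s this] have X: "X = X'" by simp
  have "p (\<alpha> (X, False) s) = p (\<alpha> (X, False) t)"
    using CW_arc_pair[of s X] CW_arc_pair[of t X] assms e e' X by (cases b; cases b') auto
  then show st: "s = t" using CW_arc_inj[of X] assms(1) t by (auto dest: inj_onD)
  show "e = e'" using CW_arc_distinct[OF t, of X] assms(3) unfolding e e' X st by (cases b; cases b') auto
qed

lemma face_point_unique:
  assumes "f < 4" "f' < 4" "z \<in> ball 0 1" "z' \<in> cball 0 1" "\<psi> f z = \<psi> f' z'"
  shows "f = f' \<and> z = z'"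
proof -
  have F: "p (\<psi> f z) \<in> open_cell p v0 \<alpha> \<psi> (Face f)" using assms(3) by auto
  show ?thesis
  proof (cases "z' \<in> ball 0 1")
    case True
    then have "p (\<psi> f z) \<in> open_cell p v0 \<alpha> \<psi> (Face f')" unfolding assms(5) by auto
    from open_cells_disjoint[OF F this] assms have "f = f'" by simp
    moreover from this have "z = z'"
      using inj_onD[OF CW_face_inj[OF assms(1)], of z z'] True assms(3,5) by simp
    ultimately show ?thesis by simp
  next
    case False
    then have "z' \<in> sphere 0 1" using assms(4) by auto
    from sphere_polygon_side[OF word_nonempty[OF assms(2)] this] obtain k t where
      k: "k < length (word S f')" "0 \<le> t" "t < 1" "z' = polygon_side (length (word S f')) k t" by blast
    then have z': "z' = side_point S f' k (arc_param S f' k t)" by (simp add: side_point_arc_param)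
    have "t \<in> {0..1}" using k by simp
    then have t: "arc_param S f' k t \<in> {0..1}" unfolding arc_param_conv oriented_param_simps .
    then have "\<psi> f' z' = \<alpha> (side_arc S f' k) (arc_param S f' k t)"
      unfolding z' using k assms(2) by (intro face_side) (auto simp: is_side_def)
    then obtain c where "p (\<psi> f z) \<in> open_cell p v0 \<alpha> \<psi> c" "c \<in> insert Vertex (range Edge)"
      using arc_over_skeleton_cell[OF t] assms(5) by metis
    then have "c = Face f" using open_cells_disjoint[OF _ F] assms(1) by (auto simp: cells_def)
    then show ?thesis using \<open>c \<in> _\<close> by auto
  qed
qed

lemma boundary_point_cases:
  assumes "f < 4" "z \<in> sphere 0 1"
  obtains k s where "is_side S (f, k)" "s \<in> {0..1}" "z = side_point S f k s"
    "\<psi> f z = \<alpha> (side_arc S f k) s"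
proof -
  obtain k t where k: "k < length (word S f)" "0 \<le> t" "t < 1" "z = polygon_side (length (word S f)) k t"
    using sphere_polygon_side[OF word_nonempty[OF assms(1)] assms(2)] by blast
  then have z: "z = side_point S f k (arc_param S f k t)" by (simp add: side_point_arc_param)
  have "t \<in> {0..1}" using k by simp
  then have t: "arc_param S f k t \<in> {0..1}" unfolding arc_param_conv oriented_param_simps .
  moreover have "is_side S (f, k)" using k assms(1) by (simp add: is_side_def)
  ultimately show ?thesis using that face_side z by blast
qed

lemma faces_meet_in_boundary:
  assumes "f < 4" "f' < 4" "z \<in> cball 0 1" "z' \<in> cball 0 1" "\<psi> f z = \<psi> f' z'"
  shows "f = f' \<and> z = z' \<or> z \<in> sphere 0 1 \<and> z' \<in> sphere 0 1"
  using face_point_unique[of f f' z z'] face_point_unique[of f' f z' z] assms by fastforce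

text \<open>So the preimage of the 1-skeleton is the graph formed by the six arcs.\<close>

lemma over_skeleton_iff:
  assumes "y \<in> topspace RP2"
  shows "p y \<in> one_skeleton p v0 \<alpha> \<psi> \<longleftrightarrow> y \<in> (\<Union>e. \<alpha> e ` {0..1})"
proof
  assume "p y \<in> one_skeleton p v0 \<alpha> \<psi>"
  then obtain c where c: "p y \<in> open_cell p v0 \<alpha> \<psi> c" "c \<in> insert Vertex (range Edge)"
    unfolding one_skeleton_def by blast
  have fib: "y \<in> fibre p (p y)" using assms by (simp add: fibre_def)
  show "y \<in> (\<Union>e. \<alpha> e ` {0..1})"
  proof (cases c)
    case Vertex
    then have "y \<in> fibre p v0" using fib c by simp
    then obtain e where "y = \<alpha> e 0 \<or> y = \<alpha> e 1" unfolding CW_vertex_fibre by blast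
    then have "y \<in> \<alpha> e ` {0..1}" by auto
    then show ?thesis by blast
  next
    case (Edge X)
    then obtain t where t: "t \<in> {0<..<1}" "p y = p (\<alpha> (X, False) t)" using c by auto
    then have "y \<in> {\<alpha> (X, False) t, \<alpha> (X, True) t}" using fib CW_arc_fibre[OF t(1), of X] by simp
    moreover have "t \<in> {0..1}" using t by simp
    ultimately show ?thesis by blast
  next
    case Face
    then show ?thesis using c by auto
  qed
next
  assume "y \<in> (\<Union>e. \<alpha> e ` {0..1})"
  then obtain e t where t: "t \<in> {0..1}" and y: "y = \<alpha> e t" by blast
  obtain c where "p (\<alpha> e t) \<in> open_cell p v0 \<alpha> \<psi> c" "c \<in> insert Vertex (range Edge)"
    by (rule arc_over_skeleton_cell[OF t])
  then show "p y \<in> one_skeleton p v0 \<alpha> \<psi>"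
    unfolding one_skeleton_def y by blast
qed

lemma faces_cover: "(\<Union>f<4. \<psi> f ` cball 0 1) = topspace RP2"
proof
  show "(\<Union>f<4. \<psi> f ` cball 0 1) \<subseteq> topspace RP2" using RP2_face by auto
  show "topspace RP2 \<subseteq> (\<Union>f<4. \<psi> f ` cball 0 1)"
  proof
    fix y assume y: "y \<in> topspace RP2"
    obtain c where c: "c \<in> cells" "p y \<in> open_cell p v0 \<alpha> \<psi> c" using CW_cover y by blast
    show "y \<in> (\<Union>f<4. \<psi> f ` cball 0 1)"
    proof (cases "c \<in> insert Vertex (range Edge)")
      case True
      then have "p y \<in> one_skeleton p v0 \<alpha> \<psi>" using c(2) unfolding one_skeleton_def by blast
      then obtain e t where t: "t \<in> {0..1}" "y = \<alpha> e t" using over_skeleton_iff[OF y] by blast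
      obtain x where x: "is_side S x" "arc_of S x = e" using arc_has_side by blast
      have "\<psi> (fst x) (side_point S (fst x) (snd x) t) = y"
        using face_side[of "fst x" "snd x" t] x t by simp
      moreover have "fst x < 4" using x by (simp add: is_side_def)
      ultimately show ?thesis
        by (intro UN_I[of "fst x"] image_eqI[of _ _ "side_point S (fst x) (snd x) t"]) auto
    next
      case False
      then obtain f where f: "c = Face f" "f < 4" using c(1) by (auto simp: cells_def)
      then obtain z where z: "z \<in> ball 0 1" "p y = p (\<psi> f z)" using c by auto
      have "y \<in> fibre p (p y)" using y by (simp add: fibre_def)
      then have "y = \<psi> f z" using z(2) CW_face_fibre[OF f(2) z(1)] by simp
      moreover have "z \<in> cball 0 1" using z by simp
      ultimately show ?thesis using f(2) by blast
    qed
  qed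
qed

section \<open>The vertices\<close>

lemma side_end_joins_next:
  assumes "is_side S (f, k)" "is_side S (f, Suc k mod length (word S f))"
  shows "\<alpha> (side_arc S f k) (oriented_param (along_arc S f k) 1) =
    \<alpha> (side_arc S f (Suc k mod length (word S f))) (oriented_param (along_arc S f (Suc k mod length (word S f))) 0)"
proof -
  have 01: "oriented_param d 0 \<in> {0..1}" "oriented_param d 1 \<in> {0..1}" for d by (auto simp: oriented_param_def)
  show ?thesis using side_point_next[OF assms(1)]
    face_side[OF assms(1) 01(2)[of "along_arc S f k"]]
    face_side[OF assms(2) 01(1)[of "along_arc S f (Suc k mod length (word S f))"]] by metis
qed

text \<open>Comparing the ends of consecutive sides in the boundary words gives the same graph for both surfaces: a triangle
  with a loop at each corner.\<close>

lemma arc_ends: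
  "\<alpha> (LoopA, False) 1 = \<alpha> (LoopB, False) 0 \<and> \<alpha> (LoopB, False) 1 = \<alpha> (LoopC, False) 0 \<and>
   \<alpha> (LoopC, False) 1 = \<alpha> (LoopA, False) 0 \<and>
   \<alpha> (LoopA, True) 0 = \<alpha> (LoopC, False) 0 \<and> \<alpha> (LoopA, True) 1 = \<alpha> (LoopC, False) 0 \<and>
   \<alpha> (LoopB, True) 0 = \<alpha> (LoopA, False) 0 \<and> \<alpha> (LoopB, True) 1 = \<alpha> (LoopA, False) 0 \<and>
   \<alpha> (LoopC, True) 0 = \<alpha> (LoopB, False) 0 \<and> \<alpha> (LoopC, True) 1 = \<alpha> (LoopB, False) 0"
proof (cases S)
  note j = side_end_joins_next
  case Boy
  show ?thesis
    using j[of 3 0] j[of 3 1] j[of 3 2] j[of 3 3] j[of 3 4] j[of 3 5] j[of 3 6] j[of 3 7] j[of 3 8]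
      j[of 0 0] j[of 1 0] j[of 2 0]
    by (simp add: Boy is_side_def along_arc_def oriented_param_def)
next
  note j = side_end_joins_next
  case Girl
  show ?thesis
    using j[of 3 0] j[of 3 1] j[of 3 2] j[of 3 3] j[of 3 4]
      j[of 2 0] j[of 2 1] j[of 2 2] j[of 2 3] j[of 2 4] j[of 0 0] j[of 1 0]
    by (simp add: Girl is_side_def along_arc_def oriented_param_def)
qed

text \<open>By the previous lemma there are at most three vertices, and the triple point has three preimages.\<close>

lemma vertices_distinct:
  "\<alpha> (LoopA, False) 0 \<noteq> \<alpha> (LoopB, False) 0" "\<alpha> (LoopB, False) 0 \<noteq> \<alpha> (LoopC, False) 0"
  "\<alpha> (LoopC, False) 0 \<noteq> \<alpha> (LoopA, False) 0"
proof -
  have "{\<alpha> e 0, \<alpha> e 1} \<subseteq> {\<alpha> (LoopA, False) 0, \<alpha> (LoopB, False) 0, \<alpha> (LoopC, False) 0}" for e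
  proof -
    obtain X b where "e = (X, b)" by fastforce
    then show ?thesis by (cases X; cases b) (auto simp: arc_ends)
  qed
  then have "fibre p v0 \<subseteq> {\<alpha> (LoopA, False) 0, \<alpha> (LoopB, False) 0, \<alpha> (LoopC, False) 0}"
    unfolding CW_vertex_fibre by blast
  from card_mono[OF _ this] have "3 \<le> card {\<alpha> (LoopA, False) 0, \<alpha> (LoopB, False) 0, \<alpha> (LoopC, False) 0}"
    using three by simp
  then show "\<alpha> (LoopA, False) 0 \<noteq> \<alpha> (LoopB, False) 0" "\<alpha> (LoopB, False) 0 \<noteq> \<alpha> (LoopC, False) 0"
    "\<alpha> (LoopC, False) 0 \<noteq> \<alpha> (LoopA, False) 0"
    by (auto simp: card_insert_if split: if_splits)
qed

section \<open>The planar model is a disc representation\<close>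

lemma respects_face_maps: "respects_gluing S \<psi>"
  unfolding respects_gluing_def side_gluing_iff using face_side by (metis fst_conv snd_conv)

lemma respects_pasted:
  assumes \<Phi>: "pasted_disc S {..<4} \<Phi> (outer_sides S) (seams S)"
  shows "respects_gluing S \<Phi>"
  unfolding respects_gluing_def side_gluing_iff
proof (intro allI impI, elim exE conjE)
  fix v w f k f' k' s
  assume *: "v = (f, side_point S f k s)" "w = (f', side_point S f' k' s)" "s \<in> {0..1}"
    "is_side S (f, k)" "is_side S (f', k')" "side_arc S f k = side_arc S f' k'" "side_arc S f k \<in> glued_arcs S"
  from glued_sides_are_seams[OF *(4,5)] *(6,7)
  consider "(f, k) = (f', k')" | "((f, k), (f', k')) \<in> seams S" | "((f', k'), (f, k)) \<in> seams S" by auto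
  then show "\<Phi> (fst v) (snd v) = \<Phi> (fst w) (snd w)"
    using pasted_discD(10)[OF \<Phi> _ *(3)] *(1,2) by cases auto
qed

lemma gluing_same_image: "((f, z), (f', z')) \<in> (side_gluing S)\<^sup>* \<Longrightarrow> \<psi> f z = \<psi> f' z'"
proof -
  have "\<psi> (fst v) (snd v) = \<psi> (fst w) (snd w)" if "(v, w) \<in> (side_gluing S)\<^sup>*" for v w
    using that respects_face_maps by induction (auto simp: respects_gluing_def)
  then show "((f, z), (f', z')) \<in> (side_gluing S)\<^sup>* \<Longrightarrow> \<psi> f z = \<psi> f' z'" by fastforce
qed

text \<open>The position in the pasted disc and the vertex are tabulated for all ends of sides. For Boy's surface every
  vertex occurs at two opposite corners of the hexagon. For Girl's surface two of the vertices are single points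
  of the disc, and the third one occurs at the two opposite boundary points \<open>\<plusminus>1\<close>.\<close>

lemma corner_values:
  assumes \<Phi>: "pasted_disc S {..<4} \<Phi> (outer_sides S) (seams S)"
    and x: "is_side S (f, k)" "is_side S (f', k')" and s: "s \<in> {0, 1}" "s' \<in> {0, 1}"
    and eq: "\<alpha> (side_arc S f k) s = \<alpha> (side_arc S f' k') s'"
  shows "\<Phi> f (side_point S f k s) = \<Phi> f' (side_point S f' k' s') \<or>
    \<Phi> f (side_point S f k s) \<in> sphere 0 1 \<and> \<Phi> f' (side_point S f' k' s') = - \<Phi> f (side_point S f k s)"
proof -
  note j = side_point_next
  define a b c where abc: "a = \<alpha> (LoopA, False) 0" "b = \<alpha> (LoopB, False) 0" "c = \<alpha> (LoopC, False) 0"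
  have dist: "a \<noteq> b" "b \<noteq> c" "c \<noteq> a" using vertices_distinct unfolding abc by auto
  note ends = arc_ends[folded abc] abc[symmetric]
  have outer: "\<Phi> f (side_point S f k (oriented_param d t)) = polygon_side (length (outer_sides S)) i t"
    if "i < length (outer_sides S)" "outer_sides S ! i = ((f, k), d)" "t \<in> {0, 1}" for i f k d t
    using pasted_discD(7)[OF \<Phi> that(1,2)] that(3) by auto
  have seam: "\<Phi> f' (side_point S f' k' s) = \<Phi> f (side_point S f k s)"
    if "((f, k), (f', k')) \<in> seams S" "s \<in> {0, 1}" for f k f' k' s
    using pasted_discD(10)[OF \<Phi> that(1)] that(2) by auto
  show ?thesis
  proof (cases S)
    case Boy
    define P where "P i = polygon_side 6 i 0" for i
    have P6: "P 6 = P 0" using polygon_side_periodic[of 6 0 0] by (simp add: P_def)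
    have anti: "P 3 = - P 0" "P 4 = - P 1" "P 5 = - P 2"
      using polygon_side_antipode[of 3 0 0] polygon_side_antipode[of 3 1 0] polygon_side_antipode[of 3 2 0]
      by (simp_all add: P_def)
    have nP: "norm (P i) = 1" for i by (simp add: P_def)
    have succ: "polygon_side 6 i 1 = P (Suc i)" for i using polygon_side_next[of 6 i] by (simp add: P_def)
    have six: "Suc (Suc (Suc (Suc (Suc (Suc 0))))) = 6" by simp
    have out: "\<Phi> 3 (side_point Boy 3 2 0) = P 0" "\<Phi> 3 (side_point Boy 3 2 1) = P 1"
      "\<Phi> 3 (side_point Boy 3 3 0) = P 1" "\<Phi> 3 (side_point Boy 3 3 1) = P 2"
      "\<Phi> 3 (side_point Boy 3 5 0) = P 2" "\<Phi> 3 (side_point Boy 3 5 1) = P 3"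
      "\<Phi> 3 (side_point Boy 3 6 0) = P 3" "\<Phi> 3 (side_point Boy 3 6 1) = P 4"
      "\<Phi> 3 (side_point Boy 3 8 0) = P 4" "\<Phi> 3 (side_point Boy 3 8 1) = P 5"
      "\<Phi> 3 (side_point Boy 3 0 0) = P 5" "\<Phi> 3 (side_point Boy 3 0 1) = P 0"
      using outer[of 0 3 2 True] outer[of 1 3 3 True] outer[of 2 3 5 True] outer[of 3 3 6 True]
        outer[of 4 3 8 True] outer[of 5 3 0 True]
      by (simp_all add: Boy oriented_param_def six numeral_2_eq_2[symmetric] succ P_def[symmetric] P6)
    have corners: "side_point Boy 3 (Suc 0) 1 = side_point Boy 3 0 1" "side_point Boy 3 (Suc 0) 0 = side_point Boy 3 2 0"
      "side_point Boy 3 4 1 = side_point Boy 3 3 1" "side_point Boy 3 4 0 = side_point Boy 3 5 0"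
      "side_point Boy 3 7 1 = side_point Boy 3 6 1" "side_point Boy 3 7 0 = side_point Boy 3 8 0"
      using j[of Boy 3 0] j[of Boy 3 1] j[of Boy 3 3] j[of Boy 3 4] j[of Boy 3 6] j[of Boy 3 7]
      by (simp_all add: is_side_def along_arc_def oriented_param_def numeral_2_eq_2)
    have mono: "\<Phi> 0 (side_point Boy 0 0 s) = \<Phi> 3 (side_point Boy 3 7 s)"
      "\<Phi> (Suc 0) (side_point Boy (Suc 0) 0 s) = \<Phi> 3 (side_point Boy 3 4 s)"
      "\<Phi> 2 (side_point Boy 2 0 s) = \<Phi> 3 (side_point Boy 3 1 s)" if "s \<in> {0, 1}" for s
      using seam[of 3 7 0 0 s] seam[of 3 4 1 0 s] seam[of 3 1 2 0 s] that by (simp_all add: Boy)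
    have table: "(\<Phi> f (side_point Boy f k s), \<alpha> (side_arc Boy f k) s) \<in>
        {(P 0, b), (P 1, c), (P 2, a), (P 3, b), (P 4, c), (P 5, a)}"
      if "is_side Boy (f, k)" "s \<in> {0, 1}" for f k s
    proof -
      have s: "s = 0 \<or> s = 1" using that by simp
      show ?thesis using that(1) unfolding is_side_Boy
        by (elim insertE emptyE; use s in \<open>elim disjE; simp add: out corners mono ends\<close>)
    qed
    have "(\<Phi> f (side_point Boy f k s), \<alpha> (side_arc Boy f k) s) \<in>
        {(P 0, b), (P 1, c), (P 2, a), (P 3, b), (P 4, c), (P 5, a)}"
      "(\<Phi> f' (side_point Boy f' k' s'), \<alpha> (side_arc Boy f k) s) \<in>
        {(P 0, b), (P 1, c), (P 2, a), (P 3, b), (P 4, c), (P 5, a)}"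
      using table[of f k s] table[of f' k' s'] x s eq unfolding Boy by auto
    then show ?thesis unfolding Boy using dist anti nP
      by (elim insertE emptyE; simp)
  next
    case Girl
    define u w where "u = \<Phi> 2 (side_point Girl 2 0 0)" and "w = \<Phi> 2 (side_point Girl 2 4 0)"
    have P: "polygon_side 2 0 0 = 1" "polygon_side 2 0 1 = -1" "polygon_side 2 (Suc 0) 0 = -1" "polygon_side 2 (Suc 0) 1 = 1"
      by (simp_all add: polygon_side_def)
    have out: "\<Phi> 2 (side_point Girl 2 (Suc 0) 1) = 1" "\<Phi> 2 (side_point Girl 2 (Suc 0) 0) = -1"
      "\<Phi> 2 (side_point Girl 2 2 1) = -1" "\<Phi> 2 (side_point Girl 2 2 0) = 1"
      using outer[of 0 2 1 False 0] outer[of 0 2 1 False 1] outer[of 1 2 2 False 0] outer[of 1 2 2 False 1]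
      by (simp_all add: Girl oriented_param_def P numeral_2_eq_2[symmetric])
    have corners: "side_point Girl 2 0 1 = side_point Girl 2 (Suc 0) 1"
      "side_point Girl 2 3 0 = side_point Girl 2 2 0" "side_point Girl 2 3 1 = side_point Girl 2 4 0"
      "side_point Girl 2 4 1 = side_point Girl 2 0 0"
      "side_point Girl 3 (Suc 0) 0 = side_point Girl 3 0 0" "side_point Girl 3 (Suc 0) 1 = side_point Girl 3 2 1"
      "side_point Girl 3 4 0 = side_point Girl 3 3 0" "side_point Girl 3 4 1 = side_point Girl 3 0 1"
      using j[of Girl 2 0] j[of Girl 2 2] j[of Girl 2 3] j[of Girl 2 4]
        j[of Girl 3 0] j[of Girl 3 1] j[of Girl 3 3] j[of Girl 3 4]
      by (simp_all add: is_side_def along_arc_def oriented_param_def numeral_2_eq_2)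
    have gl: "\<Phi> (Suc 0) (side_point Girl (Suc 0) 0 s) = \<Phi> 3 (side_point Girl 3 4 s)"
      "\<Phi> 0 (side_point Girl 0 0 s) = \<Phi> 3 (side_point Girl 3 (Suc 0) s)"
      "\<Phi> 3 (side_point Girl 3 2 s) = \<Phi> 2 (side_point Girl 2 3 s)"
      "\<Phi> 3 (side_point Girl 3 0 s) = \<Phi> 2 (side_point Girl 2 4 s)"
      "\<Phi> 3 (side_point Girl 3 3 s) = \<Phi> 2 (side_point Girl 2 0 s)" if "s \<in> {0, 1}" for s
      using seam[of 3 4 1 0 s] seam[of 3 1 0 0 s] seam[of 2 3 3 2 s] seam[of 2 4 3 0 s] seam[of 2 0 3 3 s] that
      by (simp_all add: Girl)
    have table: "(\<Phi> f (side_point Girl f k s), \<alpha> (side_arc Girl f k) s) \<in> {(u, a), (w, c), (1, b), (-1, b)}"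
      if "is_side Girl (f, k)" "s \<in> {0, 1}" for f k s
    proof -
      have s: "s = 0 \<or> s = 1" using that by simp
      show ?thesis using that(1) unfolding is_side_Girl
        by (elim insertE emptyE; use s in \<open>elim disjE; simp add: out corners gl ends u_def[symmetric] w_def[symmetric]\<close>)
    qed
    have "(\<Phi> f (side_point Girl f k s), \<alpha> (side_arc Girl f k) s) \<in> {(u, a), (w, c), (1, b), (-1, b)}"
      "(\<Phi> f' (side_point Girl f' k' s'), \<alpha> (side_arc Girl f k) s) \<in> {(u, a), (w, c), (1, b), (-1, b)}"
      using table[of f k s] table[of f' k' s'] x s eq unfolding Girl by auto
    then show ?thesis unfolding Girl using dist
      by (elim insertE emptyE; simp)
  qed
qed

text \<open>A boundary point of the disc need not be presented as a point on an outer side; this only holds up to gluing,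
  which the maps \<open>\<psi> f\<close> respect.\<close>

lemma outer_point_value:
  assumes \<Phi>: "pasted_disc S {..<4} \<Phi> (outer_sides S) (seams S)"
    and f: "f < 4" "z \<in> cball 0 1" and i: "i < length (outer_sides S)" "t \<in> {0..1}"
    and eq: "\<Phi> f z = polygon_side (length (outer_sides S)) i t"
  shows "\<psi> f z = \<alpha> (arc_of S (fst (outer_sides S ! i))) (oriented_param (snd (outer_sides S ! i)) t)"
proof -
  obtain g k d where g: "outer_sides S ! i = ((g, k), d)" by (metis prod.exhaust)
  let ?s = "oriented_param d t"
  have s: "?s \<in> {0..1}" using i(2) by (simp only: oriented_param_simps)
  have "\<Phi> g (side_point S g k ?s) = \<Phi> f z" using pasted_discD(7)[OF \<Phi> i(1) g i(2)] eq by simp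
  then have "((g, side_point S g k ?s), (f, z)) \<in> (side_gluing S)\<^sup>*"
    using pasted_discD(5)[OF \<Phi> i(1) g] f by (intro pasted_discD(4)[OF \<Phi>]) auto
  then have "\<psi> f z = \<psi> g (side_point S g k ?s)" using gluing_same_image by metis
  also have "\<dots> = \<alpha> (side_arc S g k) ?s" using face_side[OF pasted_discD(6)[OF \<Phi> i(1) g] s] .
  finally show ?thesis using g by simp
qed

text \<open>Two points of the 2-cells have the same image in the projective plane iff they are equal or lie on sides with
  the same arc at the same parameter, or are corners at the same vertex. If the arc is glued, then they coincide
  in the disc; otherwise the arc occurs at two antipodal boundary positions.\<close>

lemma planar_kernel:
  assumes \<Phi>: "pasted_disc S {..<4} \<Phi> (outer_sides S) (seams S)"
    and f: "f < 4" "f' < 4" and z: "z \<in> cball 0 1" "z' \<in> cball 0 1"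
  shows "\<psi> f z = \<psi> f' z' \<longleftrightarrow> \<Phi> f z = \<Phi> f' z' \<or> \<Phi> f z \<in> sphere 0 1 \<and> \<Phi> f' z' = - \<Phi> f z"
proof
  let ?n = "length (outer_sides S)" and ?h = "half_length S"
  have n: "?n = 2 * ?h" "0 < ?h" by (rule length_outer_sides)+
  assume eq: "\<psi> f z = \<psi> f' z'"
  show "\<Phi> f z = \<Phi> f' z' \<or> \<Phi> f z \<in> sphere 0 1 \<and> \<Phi> f' z' = - \<Phi> f z"
  proof (cases "z \<in> sphere 0 1 \<and> z' \<in> sphere 0 1")
    case False
    then show ?thesis using faces_meet_in_boundary[OF f z eq] by auto
  next
    case True
    then obtain k s k' s' where k: "is_side S (f, k)" "s \<in> {0..1}" "z = side_point S f k s"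
        "\<psi> f z = \<alpha> (side_arc S f k) s"
      and k': "is_side S (f', k')" "s' \<in> {0..1}" "z' = side_point S f' k' s'"
        "\<psi> f' z' = \<alpha> (side_arc S f' k') s'"
      using boundary_point_cases[OF f(1), of z] boundary_point_cases[OF f(2), of z'] by metis
    have aeq: "\<alpha> (side_arc S f k) s = \<alpha> (side_arc S f' k') s'" using eq k(4) k'(4) by simp
    show ?thesis
    proof (cases "s \<in> {0<..<1} \<or> s' \<in> {0<..<1}")
      case False
      then have "s \<in> {0, 1}" "s' \<in> {0, 1}" using k(2) k'(2) by auto
      from corner_values[OF \<Phi> k(1) k'(1) this aeq] show ?thesis unfolding k(3) k'(3) .
    next
      case True
      then have "side_arc S f k = side_arc S f' k' \<and> s = s'"
      proof
        assume "s \<in> {0<..<1}"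
        from arc_point_unique[OF this k'(2) aeq] show ?thesis by (rule conjI)
      next
        assume "s' \<in> {0<..<1}"
        from arc_point_unique[OF this k(2) aeq[symmetric]] show ?thesis by (metis)
      qed
      then have same: "side_arc S f k = side_arc S f' k'" "s = s'" by (rule conjunct1, rule conjunct2)
      show ?thesis
      proof (cases "side_arc S f k \<in> glued_arcs S")
        case True
        then have "((f, z), (f', z')) \<in> side_gluing S"
          unfolding side_gluing_iff k(3) k'(3) using same k(1,2) k'(1) by blast
        then show ?thesis using respects_pasted[OF \<Phi>] unfolding respects_gluing_def by fastforce
      next
        case False
        have "(f, k) \<in> fst ` set (outer_sides S)" "(f', k') \<in> fst ` set (outer_sides S)"
          using side_is_outer_iff[OF k(1)] side_is_outer_iff[OF k'(1)] False same by auto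
        then obtain i d j d' where i: "i < ?n" "outer_sides S ! i = ((f, k), d)"
          and j: "j < ?n" "outer_sides S ! j = ((f', k'), d')"
          by (auto simp: in_set_conv_nth)
        have arc: "arc_of S (fst (outer_sides S ! i)) = arc_of S (fst (outer_sides S ! j))"
          using i j same by simp
        have d: "d = d'" using outer_side_index_unique(1)[OF i(1) j(1) arc] i j by simp
        let ?t = "oriented_param d s"
        have t: "?t \<in> {0..1}" using k(2) by (simp only: oriented_param_simps)
        have v: "\<Phi> f z = polygon_side ?n i ?t" "\<Phi> f' z' = polygon_side ?n j ?t"
          using pasted_discD(7)[OF \<Phi> i t] pasted_discD(7)[OF \<Phi> j, of ?t] t k(3) k'(3) same(2) d by simp_all
        have "i = j \<or> i = j + ?h \<or> j = i + ?h" by (rule outer_side_index_unique(2)[OF i(1) j(1) arc])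
        then show ?thesis unfolding v n(1)
          using polygon_side_antipode[OF n(2)] by auto
      qed
    qed
  qed
next
  let ?n = "length (outer_sides S)" and ?h = "half_length S"
  have n: "?n = 2 * ?h" "0 < ?h" by (rule length_outer_sides)+
  assume "\<Phi> f z = \<Phi> f' z' \<or> \<Phi> f z \<in> sphere 0 1 \<and> \<Phi> f' z' = - \<Phi> f z"
  then show "\<psi> f z = \<psi> f' z'"
  proof
    assume "\<Phi> f z = \<Phi> f' z'"
    then show ?thesis using pasted_discD(4)[OF \<Phi> _ _ z] f gluing_same_image by blast
  next
    assume *: "\<Phi> f z \<in> sphere 0 1 \<and> \<Phi> f' z' = - \<Phi> f z"
    have "0 < ?n" using n by simp
    then obtain i t where i: "i < ?n" "0 \<le> t" "t < 1" "\<Phi> f z = polygon_side ?n i t"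
      using sphere_polygon_side[of ?n "\<Phi> f z"] * by blast
    have t: "t \<in> {0..1}" using i by simp
    define j where "j = (if i < ?h then i + ?h else i - ?h)"
    have j: "j < ?n" "arc_of S (fst (outer_sides S ! j)) = arc_of S (fst (outer_sides S ! i))"
      "snd (outer_sides S ! j) = snd (outer_sides S ! i)"
      using outer_side_antipode[of i S] outer_side_antipode[of "i - ?h" S] i(1) n by (auto simp: j_def)
    have "polygon_side ?n j t = - polygon_side ?n i t"
      using polygon_side_antipode[OF n(2), of i t] polygon_side_antipode[OF n(2), of "i - ?h" t]
      unfolding n(1) by (auto simp: j_def)
    then have "\<Phi> f' z' = polygon_side ?n j t" using * i by simp
    from outer_point_value[OF \<Phi> f(2) z(2) j(1) t this] outer_point_value[OF \<Phi> f(1) z(1) i(1) t i(4)] j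
    show ?thesis by simp
  qed
qed

lemma planar_model_represents:
  "disc_representation p (one_skeleton p v0 \<alpha> \<psi>) (planar_model S) (planar_map \<psi>)"
proof -
  obtain \<Phi> where \<Phi>: "pasted_disc S {..<4} \<Phi> (outer_sides S) (seams S)" using pasting by blast
  note D = pasted_discD[OF \<Phi>]
  note ker = planar_kernel[OF \<Phi>]
  note cls\<Phi> = planar_map_class[OF respects_pasted[OF \<Phi>]] and cls\<psi> = planar_map_class[OF respects_face_maps]
  let ?c = "\<lambda>f z. (side_gluing S)\<^sup>* `` {(f, z)}"
  have point: "\<exists>f z. f < 4 \<and> z \<in> cball 0 1 \<and> x = ?c f z" if "x \<in> topspace (planar_model S)" for x
    using that unfolding topspace_planar_model quotient_def pieces_def by blast
  have in_model: "?c f z \<in> topspace (planar_model S)" if "f < 4" "z \<in> cball 0 1" for f z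
    unfolding topspace_planar_model pieces_def using that by (intro quotientI) auto
  show ?thesis unfolding disc_representation_def
  proof (intro exI[of _ "planar_map \<Phi>"] conjI ballI impI)
    show "homeomorphic_map (planar_model S) (top_of_set (cball 0 1)) (planar_map \<Phi>)"
      using D(2,3,4) by (intro homeomorphic_map_planar_model respects_pasted[OF \<Phi>]) auto
    have cont: "continuous_map (planar_model S) RP2 (planar_map \<psi>)"
      by (intro continuous_map_planar_map respects_face_maps CW_face)
    have "planar_map \<psi> ` topspace (planar_model S) = (\<Union>f<4. \<psi> f ` cball 0 1)"
    proof (intro equalityI subsetI)
      fix y assume "y \<in> planar_map \<psi> ` topspace (planar_model S)"
      then obtain x where "x \<in> topspace (planar_model S)" "y = planar_map \<psi> x" by blast
      moreover from point[OF this(1)] obtain f z where "f < 4" "z \<in> cball 0 1" "x = ?c f z" by blast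
      ultimately have "y = \<psi> f z" "f < 4" "z \<in> cball 0 1" using cls\<psi> by auto
      then show "y \<in> (\<Union>f<4. \<psi> f ` cball 0 1)" by blast
    next
      fix y assume "y \<in> (\<Union>f<4. \<psi> f ` cball 0 1)"
      then obtain f z where "f < 4" "z \<in> cball 0 1" "y = \<psi> f z" by blast
      then show "y \<in> planar_map \<psi> ` topspace (planar_model S)"
        using in_model[of f z] cls\<psi>[of f z] by (metis imageI)
    qed
    then have surj: "planar_map \<psi> ` topspace (planar_model S) = topspace RP2" using faces_cover by simp
    show "quotient_map (planar_model S) RP2 (planar_map \<psi>)"
      by (intro continuous_closed_imp_quotient_map cont surj
          continuous_imp_closed_map[OF cont compact_planar_model Hausdorff_RP2])
  next
    fix x y assume "x \<in> topspace (planar_model S)" "y \<in> topspace (planar_model S)"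
    then obtain f z f' z' where *: "f < 4" "z \<in> cball 0 1" "x = ?c f z" "f' < 4" "z' \<in> cball 0 1" "y = ?c f' z'"
      using point by metis
    have "x = y \<longleftrightarrow> \<Phi> f z = \<Phi> f' z'"
    proof
      assume "x = y"
      then have "planar_map \<Phi> x = planar_map \<Phi> y" by simp
      then show "\<Phi> f z = \<Phi> f' z'" unfolding * cls\<Phi> .
    next
      assume "\<Phi> f z = \<Phi> f' z'"
      then have "((f, z), (f', z')) \<in> (side_gluing S)\<^sup>*" using D(4) * by auto
      then show "x = y" unfolding * by (rule gluing_class_eqI)
    qed
    then show "planar_map \<psi> x = planar_map \<psi> y \<longleftrightarrow>
        x = y \<or> planar_map \<Phi> x \<in> sphere 0 1 \<and> planar_map \<Phi> y = - planar_map \<Phi> x"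
      unfolding *(3,6) cls\<Phi> cls\<psi> using ker[OF *(1,4,2,5)] by blast
  next
    fix x assume "x \<in> topspace (planar_model S)" and sph: "planar_map \<Phi> x \<in> sphere 0 1"
    then obtain f z where *: "f < 4" "z \<in> cball 0 1" "x = ?c f z" using point by metis
    have w: "\<Phi> f z \<in> sphere 0 1" using sph unfolding * cls\<Phi> .
    let ?n = "length (outer_sides S)"
    have "0 < ?n" using length_outer_sides[of S] by simp
    from sphere_polygon_side[OF this w] obtain i t where i: "i < ?n" "0 \<le> t" "t < 1" "\<Phi> f z = polygon_side ?n i t" by blast
    then have t: "t \<in> {0..1}" by simp
    have "\<psi> f z = \<alpha> (arc_of S (fst (outer_sides S ! i))) (oriented_param (snd (outer_sides S ! i)) t)"
      by (rule outer_point_value[OF \<Phi> *(1,2) i(1) t i(4)])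
    moreover have "oriented_param (snd (outer_sides S ! i)) t \<in> {0..1}" using t by (simp only: oriented_param_simps)
    ultimately have "\<psi> f z \<in> (\<Union>e. \<alpha> e ` {0..1})" by blast
    then show "p (planar_map \<psi> x) \<in> one_skeleton p v0 \<alpha> \<psi>"
      using over_skeleton_iff[OF RP2_face[OF *(1,2)]] unfolding * cls\<psi> by blast
  qed
qed

section \<open>The boundary curve of a disc representation\<close>

lemma arc_or_loop_arc: "arc_or_loop RP2 (\<alpha> e)"
  unfolding arc_or_loop_def using CW_arc arc_point_unique(2) by blast

lemma arc_interior_disjoint: "e \<noteq> e' \<Longrightarrow> \<alpha> e' ` {0..1} \<inter> \<alpha> e ` {0<..<1} = {}"
  using arc_point_unique(1) by blast

lemma UNIV_arc: "UNIV = {(LoopA, False), (LoopB, False), (LoopC, False), (LoopA, True), (LoopB, True), (LoopC, True)}"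
proof (intro equalityI subsetI)
  fix e :: arc
  obtain X b where e: "e = (X, b)" by fastforce
  show "e \<in> {(LoopA, False), (LoopB, False), (LoopC, False), (LoopA, True), (LoopB, True), (LoopC, True)}"
    unfolding e by (cases X; cases b) auto
qed simp

lemma closedin_arcs: "closedin RP2 (\<Union>e\<in>E. \<alpha> e ` {0..1})"
proof -
  have "finite (UNIV :: arc set)" unfolding UNIV_arc by simp
  then have "finite E" by (rule finite_subset[OF subset_UNIV])
  then show ?thesis
    using arc_or_loop_closedin[OF Hausdorff_RP2 arc_or_loop_arc] by (intro closedin_Union) auto
qed

lemma face_centre_off_arcs: "f < 4 \<Longrightarrow> t \<in> {0..1} \<Longrightarrow> \<psi> f 0 \<noteq> \<alpha> e t"
proof
  assume f: "f < 4" and t: "t \<in> {0..1}" and eq: "\<psi> f 0 = \<alpha> e t"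
  obtain x where x: "is_side S x" "arc_of S x = e" using arc_has_side by blast
  then have "\<psi> (fst x) (side_point S (fst x) (snd x) t) = \<psi> f 0"
    using face_side[of "fst x" "snd x" t] t eq by simp
  moreover have "fst x < 4" using x by (simp add: is_side_def)
  ultimately have "0 = side_point S (fst x) (snd x) t"
    using face_point_unique[OF f, of "fst x" 0 "side_point S (fst x) (snd x) t"] by auto
  then show False using norm_side_point[of S "fst x" "snd x" t] by simp
qed

lemma closedin_faces: "closedin RP2 (\<Union>f\<in>A. \<psi> f ` cball 0 1)" if "A \<subseteq> {..<4}"
proof -
  have "closedin RP2 (\<psi> f ` cball 0 1)" if "f < 4" for f
    using image_compactin[of "top_of_set (cball 0 1)" "cball 0 1" RP2 "\<psi> f"] CW_face[OF that]
      compactin_imp_closedin[OF Hausdorff_RP2] by (auto simp: compactin_subtopology)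
  moreover have "finite A" using that finite_subset by blast
  ultimately show ?thesis using that by (intro closedin_Union) auto
qed

text \<open>If the 2-cells are divided into two nonempty classes, then the connected complement of \<open>\<Gamma>\<close>
  contains a point at which 2-cells of different classes meet. For the centres of the 2-cells lie in the
  complement, and the unions of the closed 2-cells in both classes are closed.\<close>

lemma not_separating:
  assumes conn: "connectedin RP2 (topspace RP2 - \<Gamma>)" and \<Gamma>: "\<Gamma> \<subseteq> (\<Union>e. \<alpha> e ` {0..1})"
    and A: "A \<subseteq> {..<4}" "f \<in> A" "f' < 4" "f' \<notin> A"
  obtains g g' z z' where "g \<in> A" "g' < 4" "g' \<notin> A" "z \<in> sphere 0 1" "z' \<in> sphere 0 1" "\<psi> g z = \<psi> g' z'" "\<psi> g z \<notin> \<Gamma>"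
proof (rule ccontr)
  assume contra: "\<not> thesis"
  let ?E1 = "\<Union>f\<in>A. \<psi> f ` cball 0 1" and ?E2 = "\<Union>f\<in>{..<4} - A. \<psi> f ` cball 0 1"
  have centre: "\<psi> g 0 \<in> topspace RP2 - \<Gamma>" if "g < 4" for g
  proof (rule DiffI)
    show "\<psi> g 0 \<in> topspace RP2" using RP2_face[OF that, of 0] by simp
    show "\<psi> g 0 \<notin> \<Gamma>"
    proof
      assume "\<psi> g 0 \<in> \<Gamma>"
      then obtain e t where "t \<in> {0..1}" "\<psi> g 0 = \<alpha> e t" using \<Gamma> by blast
      then show False using face_centre_off_arcs[OF that] by blast
    qed
  qed
  have cl: "closedin RP2 ?E1" "closedin RP2 ?E2"
    using closedin_faces[OF A(1)] closedin_faces[of "{..<4} - A", OF Diff_subset] by simp_all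
  have "topspace RP2 - \<Gamma> \<subseteq> ?E1 \<union> ?E2"
  proof
    fix y assume "y \<in> topspace RP2 - \<Gamma>"
    then have "y \<in> (\<Union>f<4. \<psi> f ` cball 0 1)" unfolding faces_cover by (rule DiffD1)
    then obtain g where "g < 4" "y \<in> \<psi> g ` cball 0 1" by blast
    then show "y \<in> ?E1 \<union> ?E2" by (cases "g \<in> A") auto
  qed
  moreover have "?E1 \<inter> ?E2 \<inter> (topspace RP2 - \<Gamma>) = {}"
  proof (rule equals0I)
    fix y assume "y \<in> ?E1 \<inter> ?E2 \<inter> (topspace RP2 - \<Gamma>)"
    then obtain g z g' z' where *: "g \<in> A" "z \<in> cball 0 1" "y = \<psi> g z" "g' < 4" "g' \<notin> A" "z' \<in> cball 0 1" "y = \<psi> g' z'" "y \<notin> \<Gamma>"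
      by blast
    then have "g < 4" "g \<noteq> g'" using A by auto
    then have "z \<in> sphere 0 1 \<and> z' \<in> sphere 0 1"
      using faces_meet_in_boundary[of g g' z z'] * by auto
    then show False using that[of g g' z z'] * contra by blast
  qed
  moreover have "\<psi> f 0 \<in> ?E1 \<inter> (topspace RP2 - \<Gamma>)"
    using centre[of f] A by (intro IntI UN_I[of f] image_eqI[of _ _ 0]) auto
  moreover have "\<psi> f' 0 \<in> ?E2 \<inter> (topspace RP2 - \<Gamma>)"
    using centre[of f'] A by (intro IntI UN_I[of f'] image_eqI[of _ _ 0]) auto
  moreover note connectedin_closed_cover[OF conn cl]
  ultimately show False by (metis empty_iff)
qed

context
  fixes q :: "complex \<Rightarrow> (real^3) set"
  assumes q: "antipodal_disc RP2 q" and skel: "\<And>x. x \<in> sphere 0 1 \<Longrightarrow> p (q x) \<in> one_skeleton p v0 \<alpha> \<psi>"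
begin

abbreviation "curve \<equiv> q ` sphere 0 1"

lemma curve_punctured: "punctured_connected RP2 curve" and curve_complement: "connectedin RP2 (topspace RP2 - curve)"
  by (rule antipodal_disc_boundary_curve[OF q])+

lemma curve_in_arcs: "curve \<subseteq> (\<Union>e. \<alpha> e ` {0..1})"
proof
  fix y assume "y \<in> curve"
  then obtain x where x: "x \<in> sphere 0 1" "y = q x" by blast
  then have "y \<in> topspace RP2" using antipodal_discD(2)[OF q] by force
  then show "y \<in> (\<Union>e. \<alpha> e ` {0..1})" using over_skeleton_iff skel[OF x(1)] x(2) by blast
qed

lemma curve_arc_dichotomy: "\<alpha> e ` {0..1} \<subseteq> curve \<or> curve \<inter> \<alpha> e ` {0<..<1} = {}"
proof (rule arc_contained_or_avoided[OF Hausdorff_RP2 curve_punctured arc_or_loop_arc closedin_arcs[of "- {e}"]])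
  show "(\<Union>e'\<in>- {e}. \<alpha> e' ` {0..1}) \<inter> \<alpha> e ` {0<..<1} = {}"
  proof (rule equals0I)
    fix y assume y: "y \<in> (\<Union>e'\<in>- {e}. \<alpha> e' ` {0..1}) \<inter> \<alpha> e ` {0<..<1}"
    then obtain e' where "e' \<noteq> e" "y \<in> \<alpha> e' ` {0..1}" by blast
    then show False using arc_interior_disjoint[of e e'] y by blast
  qed
  show "curve \<subseteq> \<alpha> e ` {0..1} \<union> (\<Union>e'\<in>- {e}. \<alpha> e' ` {0..1})"
  proof
    fix y assume "y \<in> curve"
    from subsetD[OF curve_in_arcs this] obtain e' where "y \<in> \<alpha> e' ` {0..1}" by (rule UN_E)
    then show "y \<in> \<alpha> e ` {0..1} \<union> (\<Union>e'\<in>- {e}. \<alpha> e' ` {0..1})" by (cases "e' = e") auto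
  qed
qed

text \<open>A 2-cell with one side meets the other 2-cells only along this side, so a curve containing the side would cut it
  off.\<close>

lemma curve_avoids_monogon:
  assumes "f < 4" "length (word S f) = 1"
  shows "curve \<inter> \<alpha> (side_arc S f 0) ` {0<..<1} = {}"
proof -
  have False if sub: "\<alpha> (side_arc S f 0) ` {0..1} \<subseteq> curve"
  proof -
    have "\<exists>f'<4. f' \<notin> {f}" by (intro exI[of _ "if f = 0 then 1 else 0"]) auto
    then obtain f' where f': "f' < 4" "f' \<notin> {f}" by blast
    have "{f} \<subseteq> {..<4}" "f \<in> {f}" using assms(1) by auto
    then obtain g g' z z' where "g \<in> {f}" "g' < 4" "g' \<notin> {f}" "z \<in> sphere 0 1" "z' \<in> sphere 0 1"
        "\<psi> g z = \<psi> g' z'" "\<psi> g z \<notin> curve"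
      by (rule not_separating[OF curve_complement curve_in_arcs _ _ f']) (rule that)
    then have z: "z \<in> sphere 0 1" "\<psi> f z \<notin> curve" by simp_all
    obtain k s where k: "is_side S (f, k)" "s \<in> {0..1}" "z = side_point S f k s" "\<psi> f z = \<alpha> (side_arc S f k) s"
      by (rule boundary_point_cases[OF assms(1) z(1)])
    then have "k = 0" using assms(2) by (simp add: is_side_def)
    then have "\<psi> f z \<in> curve" using k(2,4) sub by blast
    then show False using z(2) by contradiction
  qed
  then show ?thesis using curve_arc_dichotomy by blast
qed

text \<open>The triangle has no smaller closed curves.\<close>

lemma curve_in_triangle_imp_triangle:
  assumes "curve \<subseteq> (\<Union>X. \<alpha> (X, False) ` {0..1})"
  shows "\<alpha> (X, False) ` {0..1} \<subseteq> curve"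
proof -
  have UX: "(\<Union>X. \<alpha> (X, False) ` {0..1}) = \<alpha> (LoopA, False) ` {0..1} \<union> \<alpha> (LoopB, False) ` {0..1} \<union> \<alpha> (LoopC, False) ` {0..1}"
  proof -
    have edges: "UNIV = {LoopA, LoopB, LoopC}" using edge.exhaust by blast
    show ?thesis unfolding edges by (simp add: Un_assoc)
  qed
  have disj: "\<alpha> (Y, False) ` {0..1} \<inter> \<alpha> (X, False) ` {0<..<1} = {}" if "X \<noteq> Y" for X Y
    using that by (intro arc_interior_disjoint) simp
  note tri = triangle_side_contained[OF Hausdorff_RP2 curve_punctured arc_or_loop_arc arc_or_loop_arc arc_or_loop_arc]
  have "\<alpha> (LoopA, False) ` {0..1} \<subseteq> curve"
    by (rule tri[of "(LoopA, False)" "(LoopB, False)" "(LoopC, False)"])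
      (use assms arc_ends vertices_distinct in \<open>auto simp: UX intro!: disj\<close>)
  moreover have "\<alpha> (LoopB, False) ` {0..1} \<subseteq> curve"
    by (rule tri[of "(LoopB, False)" "(LoopC, False)" "(LoopA, False)"])
      (use assms arc_ends vertices_distinct in \<open>auto simp: UX intro!: disj\<close>)
  moreover have "\<alpha> (LoopC, False) ` {0..1} \<subseteq> curve"
    by (rule tri[of "(LoopC, False)" "(LoopA, False)" "(LoopB, False)"])
      (use assms arc_ends vertices_distinct in \<open>auto simp: UX intro!: disj\<close>)
  ultimately show ?thesis by (cases X) auto
qed

lemma arc_end_in_triangle: "s \<in> {0, 1} \<Longrightarrow> \<alpha> e s \<in> (\<Union>X. \<alpha> (X, False) ` {0..1})"
proof -
  assume s: "s \<in> {0, 1}"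
  have "\<alpha> (X, False) 0 \<in> (\<Union>X. \<alpha> (X, False) ` {0..1})" for X by (rule UN_I[of X]) auto
  moreover have "\<exists>X. \<alpha> e s = \<alpha> (X, False) 0"
  proof -
    obtain Y b where e: "e = (Y, b)" by fastforce
    show ?thesis using s unfolding e by (cases Y; cases b) (auto simp: arc_ends)
  qed
  ultimately show ?thesis by metis
qed

lemma curve_point_off_triangle:
  assumes "y \<in> curve" "y \<notin> (\<Union>X. \<alpha> (X, False) ` {0..1})"
  obtains X t where "t \<in> {0<..<1}" "y = \<alpha> (X, True) t"
proof -
  obtain e t where t: "t \<in> {0..1}" "y = \<alpha> e t" using subsetD[OF curve_in_arcs assms(1)] by blast
  have "t \<notin> {0, 1}" using arc_end_in_triangle[of t e] t(2) assms(2) by blast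
  then have "t \<in> {0<..<1}" using t(1) by auto
  moreover have "snd e"
  proof (rule ccontr)
    assume "\<not> snd e"
    then have "e = (fst e, False)" by (cases e) simp
    then have "y \<in> \<alpha> (fst e, False) ` {0..1}" using t by (metis imageI)
    then show False using assms(2) by blast
  qed
  then have "e = (fst e, True)" by (cases e) simp
  ultimately show ?thesis using that t(2) by metis
qed

lemma curve_in_triangle:
  assumes "\<And>X. curve \<inter> \<alpha> (X, True) ` {0<..<1} = {}"
  shows "curve \<subseteq> (\<Union>X. \<alpha> (X, False) ` {0..1})"
proof (rule subsetI, rule ccontr)
  fix y assume y: "y \<in> curve" "y \<notin> (\<Union>X. \<alpha> (X, False) ` {0..1})"
  then obtain X t where "t \<in> {0<..<1}" "y = \<alpha> (X, True) t" by (rule curve_point_off_triangle)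
  then show False using assms[of X] y(1) by blast
qed

text \<open>For Boy's surface the three monogons exclude \<open>A'\<close>, \<open>B'\<close>, \<open>C'\<close>. For Girl's
  surface a curve that contains \<open>C'\<close> is equal to \<open>C'\<close>. A curve that avoids it is the
  triangle, whose complement is not connected: the pentagon with the sides \<open>C'\<close> meets the other
  2-cells only along \<open>A\<close>, \<open>B\<close>, \<open>C\<close>.\<close>

lemma curve_eq_unglued_arcs: "curve = (\<Union>e\<in>- glued_arcs S. \<alpha> e ` {0..1})"
proof (cases S)
  case Boy
  have "- glued_arcs S = {(X, False) | X. True}"
    unfolding Boy using edge.exhaust by auto
  then have un: "(\<Union>e\<in>- glued_arcs S. \<alpha> e ` {0..1}) = (\<Union>X. \<alpha> (X, False) ` {0..1})" by auto
  have av: "curve \<inter> \<alpha> (X, True) ` {0<..<1} = {}" for X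
    using curve_avoids_monogon[of 0] curve_avoids_monogon[of 1] curve_avoids_monogon[of 2]
    unfolding Boy by (cases X) simp_all
  have sub: "curve \<subseteq> (\<Union>X. \<alpha> (X, False) ` {0..1})" by (rule curve_in_triangle[OF av])
  moreover have "(\<Union>X. \<alpha> (X, False) ` {0..1}) \<subseteq> curve"
    using curve_in_triangle_imp_triangle[OF sub] by (rule UN_least)
  ultimately show ?thesis unfolding un by (rule subset_antisym)
next
  case Girl
  have "- glued_arcs S = {(LoopC, True)}" unfolding Girl by simp
  then have un: "(\<Union>e\<in>- glued_arcs S. \<alpha> e ` {0..1}) = \<alpha> (LoopC, True) ` {0..1}" by simp
  have av: "curve \<inter> \<alpha> (X, True) ` {0<..<1} = {}" if "X \<noteq> LoopC" for X
    using curve_avoids_monogon[of 0] curve_avoids_monogon[of 1] that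
    unfolding Girl by (cases X) simp_all
  let ?T = "\<Union>X. \<alpha> (X, False) ` {0..1}"
  have sub: "curve \<subseteq> \<alpha> (LoopC, True) ` {0..1} \<union> ?T"
  proof
    fix y assume y: "y \<in> curve"
    show "y \<in> \<alpha> (LoopC, True) ` {0..1} \<union> ?T"
    proof (cases "y \<in> ?T")
      case False
      then obtain X t where t: "t \<in> {0<..<1}" "y = \<alpha> (X, True) t"
        by (rule curve_point_off_triangle[OF y])
      then have "X = LoopC" using av[of X] y by blast
      then have "y \<in> \<alpha> (LoopC, True) ` {0..1}" using t by auto
      then show ?thesis by (rule UnI1)
    qed (rule UnI2)
  qed
  have "(\<Union>e\<in>range (\<lambda>X. (X, False)). \<alpha> e ` {0..1}) = ?T" by simp
  then have clT: "closedin RP2 ?T" using closedin_arcs[of "range (\<lambda>X. (X, False))"] by simp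
  have T_disj: "?T \<inter> \<alpha> (LoopC, True) ` {0<..<1} = {}"
  proof (rule equals0I)
    fix y assume y: "y \<in> ?T \<inter> \<alpha> (LoopC, True) ` {0<..<1}"
    then obtain X where "y \<in> \<alpha> (X, False) ` {0..1}" by blast
    then show False using arc_interior_disjoint[of "(LoopC, True)" "(X, False)"] y by blast
  qed
  consider "\<alpha> (LoopC, True) ` {0..1} \<subseteq> curve" | "curve \<inter> \<alpha> (LoopC, True) ` {0<..<1} = {}"
    using curve_arc_dichotomy by blast
  then show ?thesis
  proof cases
    case 1
    have "curve = \<alpha> (LoopC, True) ` {0..1}"
      by (rule contained_loop_is_all[OF Hausdorff_RP2 curve_punctured arc_or_loop_arc clT T_disj sub _ 1])
        (simp add: arc_ends)
    then show ?thesis unfolding un .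
  next
    case 2
    have "curve \<inter> \<alpha> (X, True) ` {0<..<1} = {}" for X using av[of X] 2 by (cases "X = LoopC") simp_all
    then have subT: "curve \<subseteq> ?T" by (rule curve_in_triangle)
    have "?T \<subseteq> curve"
      using curve_in_triangle_imp_triangle[OF subT] by (rule UN_least)
    have "{2} \<subseteq> {..<4::nat}" "2 \<in> {2::nat}" "3 < (4::nat)" "3 \<notin> {2::nat}" by auto
    then obtain g g' z z' where g: "g \<in> {2}" "g' < 4" "g' \<notin> {2}" "z \<in> sphere 0 1" "z' \<in> sphere 0 1"
        "\<psi> g z = \<psi> g' z'" "\<psi> g z \<notin> curve"
      by (rule not_separating[OF curve_complement curve_in_arcs]) (rule that)
    have two: "(2::nat) < 4" by simp
    obtain k s where k: "is_side S (2, k)" "s \<in> {0..1}" "z = side_point S 2 k s" "\<psi> 2 z = \<alpha> (side_arc S 2 k) s"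
      by (rule boundary_point_cases[OF two g(4)])
    obtain k' s' where k': "is_side S (g', k')" "s' \<in> {0..1}" "z' = side_point S g' k' s'" "\<psi> g' z' = \<alpha> (side_arc S g' k') s'"
      by (rule boundary_point_cases[OF g(2,5)])
    have eq: "\<alpha> (side_arc S 2 k) s = \<alpha> (side_arc S g' k') s'" using k(4) k'(4) g(1,6) by simp
    have "\<alpha> (side_arc S 2 k) s \<notin> curve" using k(4) g(1,7) by simp
    with \<open>?T \<subseteq> curve\<close> have nin: "\<alpha> (side_arc S 2 k) s \<notin> ?T" by (rule contra_subsetD)
    then have "s \<notin> {0, 1}" using arc_end_in_triangle by blast
    then have "s \<in> {0<..<1}" using k(2) by auto
    from arc_point_unique(1)[OF this k'(2) eq] have arc: "side_arc S 2 k = side_arc S g' k'" .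
    obtain X b where e: "side_arc S 2 k = (X, b)" by fastforce
    have "(2, k) \<in> occurrences Girl (X, b)" "(g', k') \<in> occurrences Girl (X, b)"
      using occurrences[OF k(1)] occurrences[OF k'(1)] arc e unfolding Girl by simp_all
    then have "\<not> b" using g(3) by (cases X; cases b) auto
    then have "\<alpha> (side_arc S 2 k) s \<in> ?T" using k(2) unfolding e by (intro UN_I[of X]) auto
    then show ?thesis using nin by contradiction
  qed
qed

end

end

section \<open>Equivalence of disc representations\<close>

lemma disc_representation_antipodal_disc:
  assumes "disc_representation p K X q"
  obtains \<phi> \<phi>' where "homeomorphic_maps X (top_of_set (cball 0 1)) \<phi> \<phi>'"
    "antipodal_disc RP2 (q \<circ> \<phi>')" "\<And>x. x \<in> sphere 0 1 \<Longrightarrow> p ((q \<circ> \<phi>') x) \<in> K"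
proof -
  obtain \<phi> where \<phi>: "homeomorphic_map X (top_of_set (cball (0::complex) 1)) \<phi> \<and> quotient_map X RP2 q \<and>
      (\<forall>x\<in>topspace X. \<forall>y\<in>topspace X. q x = q y \<longleftrightarrow> x = y \<or> \<phi> x \<in> sphere 0 1 \<and> \<phi> y = - \<phi> x) \<and>
      (\<forall>x\<in>topspace X. \<phi> x \<in> sphere 0 1 \<longrightarrow> p (q x) \<in> K)"
    using assms unfolding disc_representation_def by (rule exE) (rule that)
  then have hom: "homeomorphic_map X (top_of_set (cball 0 1)) \<phi>" and q: "quotient_map X RP2 q" by blast+
  have ker: "\<And>x y. x \<in> topspace X \<Longrightarrow> y \<in> topspace X \<Longrightarrow>
      q x = q y \<longleftrightarrow> x = y \<or> \<phi> x \<in> sphere 0 1 \<and> \<phi> y = - \<phi> x"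
    using \<phi> by meson
  have K: "\<And>x. x \<in> topspace X \<Longrightarrow> \<phi> x \<in> sphere 0 1 \<Longrightarrow> p (q x) \<in> K"
    using \<phi> by meson
  obtain \<phi>' where maps: "homeomorphic_maps X (top_of_set (cball 0 1)) \<phi> \<phi>'"
    using hom homeomorphic_map_maps by blast
  then have inv: "\<phi> (\<phi>' z) = z" "\<phi>' z \<in> topspace X" if "z \<in> cball 0 1" for z
    using that by (auto simp: homeomorphic_maps_def continuous_map_def Pi_iff)
  have hom': "homeomorphic_map (top_of_set (cball 0 1)) X \<phi>'"
    using maps homeomorphic_maps_sym homeomorphic_maps_map by blast
  have "antipodal_disc RP2 (q \<circ> \<phi>')"
    unfolding antipodal_disc_def
  proof (intro conjI ballI)
    show "continuous_map (top_of_set (cball 0 1)) RP2 (q \<circ> \<phi>')"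
      using homeomorphic_imp_continuous_map[OF hom'] quotient_imp_continuous_map[OF q]
      by (rule continuous_map_compose)
    have "\<phi>' ` cball 0 1 = topspace X" using homeomorphic_imp_surjective_map[OF hom'] by simp
    then show "(q \<circ> \<phi>') ` cball 0 1 = topspace RP2"
      using quotient_imp_surjective_map[OF q] by (metis image_comp)
    fix x y :: complex assume xy: "x \<in> cball 0 1" "y \<in> cball 0 1"
    have "\<phi>' x = \<phi>' y \<longleftrightarrow> x = y" using inv(1)[OF xy(1)] inv(1)[OF xy(2)] by metis
    then show "(q \<circ> \<phi>') x = (q \<circ> \<phi>') y \<longleftrightarrow> x = y \<or> x \<in> sphere 0 1 \<and> y = - x"
      unfolding o_apply ker[OF inv(2)[OF xy(1)] inv(2)[OF xy(2)]] inv(1)[OF xy(1)] inv(1)[OF xy(2)] by simp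
  qed
  moreover have "p ((q \<circ> \<phi>') x) \<in> K" if "x \<in> sphere 0 1" for x
    using K[of "\<phi>' x"] inv[of x] that by simp
  ultimately show ?thesis using that[OF maps] by blast
qed

lemma induced_cells_homeomorphic:
  assumes h: "homeomorphic_map X Y h" and fg: "\<And>x. x \<in> topspace X \<Longrightarrow> g (h x) = f x"
  shows "(\<lambda>c. h ` c) ` induced_cells X f \<C> = induced_cells Y g \<C>"
proof -
  have "(\<lambda>c. h ` c) ` connected_components_of (subtopology X {x \<in> topspace X. f x \<in> C}) =
      connected_components_of (subtopology Y {y \<in> topspace Y. g y \<in> C})" for C
  proof -
    have "homeomorphic_map (subtopology X {x \<in> topspace X. f x \<in> C}) (subtopology Y {y \<in> topspace Y. g y \<in> C}) h"
      by (rule homeomorphic_map_subtopologies_alt[OF h]) (auto simp: fg)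
    from homeomorphic_map_connected_components_of[OF this] show ?thesis by simp
  qed
  then show ?thesis unfolding induced_cells_def by (simp add: image_UN)
qed

text \<open>If all discs with boundary over \<open>K\<close> have the same boundary curve \<open>\<Gamma>\<close>, then any
  two representations are equivalent, as the homeomorphism of the discs over the identity of the projective
  plane maps induced cells to induced cells.\<close>

lemma disc_representations_equivalent:
  assumes X: "disc_representation p K X q" and Y: "disc_representation p K Y r"
    and unique: "\<And>s. antipodal_disc RP2 s \<Longrightarrow> (\<And>x. x \<in> sphere 0 1 \<Longrightarrow> p (s x) \<in> K) \<Longrightarrow> s ` sphere 0 1 = \<Gamma>"
  shows "equivalent_representations p \<C> X q Y r"
proof -
  obtain \<phi> \<phi>' where \<phi>: "homeomorphic_maps X (top_of_set (cball 0 1)) \<phi> \<phi>'" "antipodal_disc RP2 (q \<circ> \<phi>')"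
    "\<And>x. x \<in> sphere 0 1 \<Longrightarrow> p ((q \<circ> \<phi>') x) \<in> K"
    using disc_representation_antipodal_disc[OF X] by blast
  obtain \<theta> \<theta>' where \<theta>: "homeomorphic_maps Y (top_of_set (cball 0 1)) \<theta> \<theta>'" "antipodal_disc RP2 (r \<circ> \<theta>')"
    "\<And>x. x \<in> sphere 0 1 \<Longrightarrow> p ((r \<circ> \<theta>') x) \<in> K"
    using disc_representation_antipodal_disc[OF Y] by blast
  have "(q \<circ> \<phi>') ` sphere 0 1 = (r \<circ> \<theta>') ` sphere 0 1"
    using unique[OF \<phi>(2,3)] unique[OF \<theta>(2,3)] by simp
  then obtain k where k: "homeomorphic_map (top_of_set (cball 0 1)) (top_of_set (cball 0 1)) k"
    "\<And>x. x \<in> cball 0 1 \<Longrightarrow> (r \<circ> \<theta>') (k x) = (q \<circ> \<phi>') x"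
    using antipodal_discs_homeomorphic[OF Hausdorff_RP2 \<phi>(2) \<theta>(2)] by blast
  define h where "h = \<theta>' \<circ> k \<circ> \<phi>"
  have "homeomorphic_map X (top_of_set (cball 0 1)) \<phi>" using \<phi>(1) homeomorphic_maps_map by blast
  moreover have "homeomorphic_map (top_of_set (cball 0 1)) Y \<theta>'"
    using \<theta>(1) homeomorphic_maps_sym homeomorphic_maps_map by blast
  ultimately have h: "homeomorphic_map X Y h"
    unfolding h_def using k(1) by (meson homeomorphic_map_compose)
  have rh: "r (h x) = q x" if "x \<in> topspace X" for x
  proof -
    have "\<phi> x \<in> cball 0 1" "\<phi>' (\<phi> x) = x"
      using \<phi>(1) that by (auto simp: homeomorphic_maps_def continuous_map_def Pi_iff)
    then show ?thesis using k(2)[of "\<phi> x"] by (simp add: h_def)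
  qed
  show ?thesis unfolding equivalent_representations_def
  proof (intro exI[of _ h] conjI ballI)
    show "(\<lambda>c. h ` c) ` induced_cells X (p \<circ> q) \<C> = induced_cells Y (p \<circ> r) \<C>"
      by (rule induced_cells_homeomorphic[OF h]) (simp add: rh)
  qed (use h rh in auto)
qed

theorem lemma1:
  fixes S :: surface
    and p :: "(real^3) set \<Rightarrow> real^3"
    and v0 :: "real^3"
    and \<alpha> :: "arc \<Rightarrow> real \<Rightarrow> (real^3) set"
    and \<psi> :: "nat \<Rightarrow> complex \<Rightarrow> (real^3) set"
  assumes "single_triple_point_immersion p v0"
    and "natural_CW_structure S p v0 \<alpha> \<psi>"
  shows "disc_representation p (one_skeleton p v0 \<alpha> \<psi>) (planar_model S) (planar_map \<psi>) \<and>
    (\<forall>(X :: 'd topology) q.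
       disc_representation p (one_skeleton p v0 \<alpha> \<psi>) X q \<longrightarrow>
       equivalent_representations p (open_cell p v0 \<alpha> \<psi> ` cells)
         X q (planar_model S) (planar_map \<psi>))"
proof -
  have three: "card (fibre p v0) = 3"
    using assms(1) unfolding single_triple_point_immersion_def by blast
  note model = planar_model_represents[OF assms(2) three]
  show ?thesis
    using model disc_representations_equivalent[OF _ model curve_eq_unglued_arcs[OF assms(2) three]]
    by blast
qed

end
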